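(* Let $n\geq 3$ and $-2n-1\leq p<-n$. Suppose $K\in\mathcal{K}_+^2$ is origin-centred and $S_2$-isotropic, and its support function $h_K$ solves $$h_K^{1-p}\det(\nabla^2 h_K+h_K I)=1\quad\text{on }\mathbb{S}^{n-1}.$$ If moreover $\lambda_2(-L_K)\geq \frac{-p-1}{n-1}$, then $K$ is the unit ball.
   Context: For a convex body $K\subset\mathbb{R}^n$ with the origin in its interior, $h_K(x)=\max_{y\in K}\langle x,y\rangle$, $x\in\mathbb{S}^{n-1}$, is its support function. $\mathcal{K}_+^2$ denotes the class of convex bodies in $\mathbb{R}^n$ containing the origin in their interior, with $C^2$ boundary and strictly positive Gauss curvature. Notation on the sphere: - $\nabla$ is the Levi-Civita connection of the round metric on $\mathbb{S}^{n-1}$ and $\mu$ is the spherical Lebesgue measure. - For $h\in C^2(\mathbb{S}^{n-1})$, $D^2h=\nabla^2h+h\,I$; it is positive definite when $h=h_K$ with $K\in\mathcal{K}_+^2$. - The cone-volume measure is $dV_K=\frac1n h_K\det(D^2h_K)\,d\mu$. - The $L_2$-surface-area measure is $dS_2K=h_K^{-1}\det(D^2h_K)\,d\mu$. A finite measure $\mathbf m$ on $\mathbb{S}^{n-1}$ is isotropic if $\int\langle x,w\rangle^2 d\mathbf m(x)=\frac{\mathbf m(\mathbb{S}^{n-1})}{n}|w|^2$ for all $w\in\mathbb{R}^n$. $K$ is called $S_2$-isotropic if $S_2K$ is isotropic. $K$ is origin-centred if its centroid is the origin. The Hilbert–Brunn–Minkowski operator is $L_Kz=\frac{1}{n-1}\mathrm{tr}\big((D^2h_K)^{-1}D^2(zh_K)\big)-z$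 for $z\in C^2(\mathbb{S}^{n-1})$. Set $\ell_v^K(x)=\langle x,v\rangle/h_K(x)$ for $v\in\mathbb{R}^n$. Then $$\lambda_2(-L_K)=\inf\Big\{\tfrac{\int z(-L_Kz)\,dV_K}{\int z^2\,dV_K}:\ z\in C^2(\mathbb{S}^{n-1}),\ z\not\equiv0,\ \int z\,dV_K=0,\ \int z\,\ell_v^K\,dV_K=0\ \forall v\in\mathbb{R}^n\Big\}.$$ This is the second nonzero eigenvalue of the self-adjoint operator $-L_K$ on $L^2(V_K)$. The spectrum of that operator is $0$ (on constants), $1$ (on $\mathrm{span}\{\ell_v^K\}$), then $\lambda_2(-L_K)>1$, and so on. *)

theory Defs
  imports "HOL-Analysis.Analysis"
begin

definition C2_with :: "(real^'n) set \<Rightarrow> (real^'n \<Rightarrow> real) \<Rightarrow> (real^'n \<Rightarrow> real^'n)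
    \<Rightarrow> (real^'n \<Rightarrow> real^'n \<Rightarrow> real^'n) \<Rightarrow> bool" where
  "C2_with U f G H \<longleftrightarrow>
     (\<forall>x\<in>U. (f has_derivative (\<lambda>v. G x \<bullet> v)) (at x)) \<and>
     (\<forall>x\<in>U. (G has_derivative H x) (at x)) \<and>
     (\<forall>v. continuous_on U (\<lambda>x. H x v))"

definition C2_on :: "(real^'n) set \<Rightarrow> (real^'n \<Rightarrow> real) \<Rightarrow> bool" where
  "C2_on U f \<longleftrightarrow> open U \<and> (\<exists>G H. C2_with U f G H)"

definition tproj :: "real^'n \<Rightarrow> real^'n \<Rightarrow> real^'n" where
  "tproj x v = v - (v \<bullet> x) *\<^sub>R x"

(* ---------- Gauss curvature of a level set {g = 0} at p, outer normal G p / |G p|: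
   determinant of the second fundamental form (Hessian of g restricted to the tangent
   hyperplane, divided by |grad g|).  The determinant over the tangent hyperplane is
   computed as det(P H P + nu nu^T) in the standard basis, P = projection onto nu^perp. *)
definition gauss_curv :: "(real^'n \<Rightarrow> real^'n) \<Rightarrow> (real^'n \<Rightarrow> real^'n \<Rightarrow> real^'n)
    \<Rightarrow> real^'n \<Rightarrow> real" where
  "gauss_curv G H p =
     (let nu = G p /\<^sub>R norm (G p) in
      det (\<chi> i j. (H p (tproj nu (axis i 1)) \<bullet> tproj nu (axis j 1)) / norm (G p)
                   + nu $ i * nu $ j))"

definition Kplus2 :: "(real^'n) set \<Rightarrow> bool" where
  "Kplus2 K \<longleftrightarrow> compact K \<and> convex K \<and> 0 \<in> interior K \<and>
     (\<forall>p\<in>frontier K. \<exists>U g G H. open U \<and> p \<in> U \<and> C2_with U g G H \<and>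
          (\<forall>y\<in>U. G y \<noteq> 0) \<and> K \<inter> U = {y\<in>U. g y \<le> 0} \<and> gauss_curv G H p > 0)"

definition supp :: "(real^'n) set \<Rightarrow> real^'n \<Rightarrow> real" where
  "supp K x = Sup ((\<lambda>y. x \<bullet> y) ` K)"

definition centroid :: "(real^'n) set \<Rightarrow> real^'n" where
  "centroid K = integral K (\<lambda>y. y) /\<^sub>R measure lborel K"

(* ---------- covariant Hessian on the round sphere, via geodesics ----------
   For x on the sphere and tangent u, nabla^2 h(x)(u,u) = (h o gamma)''(0) where
   gamma(t) = cos(t|u|) x + sin(t|u|) u/|u| is the geodesic with gamma'(0) = u;
   the bilinear form is obtained by polarisation. *)
definition sph_Q :: "(real^'n \<Rightarrow> real) \<Rightarrow> real^'n \<Rightarrow> real^'n \<Rightarrow> real" where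
  "sph_Q h x u = deriv (deriv (\<lambda>t. h (cos (t * norm u) *\<^sub>R x + sin (t * norm u) *\<^sub>R (u /\<^sub>R norm u)))) 0"

definition sph_hess :: "(real^'n \<Rightarrow> real) \<Rightarrow> real^'n \<Rightarrow> real^'n \<Rightarrow> real^'n \<Rightarrow> real" where
  "sph_hess h x u v = (sph_Q h x (u + v) - sph_Q h x (u - v)) / 4"

(* D^2 h = nabla^2 h + h I on T_x S^{n-1}, as a matrix in the standard basis (zero on x) *)
definition Dmat :: "(real^'n \<Rightarrow> real) \<Rightarrow> real^'n \<Rightarrow> real^'n^'n" where
  "Dmat h x = (\<chi> i j. sph_hess h x (tproj x (axis i 1)) (tproj x (axis j 1))
                     + h x * (tproj x (axis i 1) \<bullet> tproj x (axis j 1)))"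

(* the same, completed by the identity on the normal direction x *)
definition Dmat1 :: "(real^'n \<Rightarrow> real) \<Rightarrow> real^'n \<Rightarrow> real^'n^'n" where
  "Dmat1 h x = (\<chi> i j. Dmat h x $ i $ j + x $ i * x $ j)"

(* det(D^2 h(x)) as an endomorphism of T_x S^{n-1} *)
definition tdet :: "(real^'n \<Rightarrow> real) \<Rightarrow> real^'n \<Rightarrow> real" where
  "tdet h x = det (Dmat1 h x)"

(* tr((D^2 h)^{-1} D^2 w) on T_x S^{n-1} *)
definition ttr :: "(real^'n \<Rightarrow> real) \<Rightarrow> (real^'n \<Rightarrow> real) \<Rightarrow> real^'n \<Rightarrow> real" where
  "ttr h w x = trace (matrix_inv (Dmat1 h x) ** Dmat w x)"

(* ---------- spherical Lebesgue measure: int f dmu = n * int_{B} f(y/|y|) dy ---------- *)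
definition sph_int :: "(real^'n \<Rightarrow> real) \<Rightarrow> real" where
  "sph_int f = real CARD('n) * (LINT y : ball 0 1 | lborel. f (y /\<^sub>R norm y))"

(* integral with respect to the cone-volume measure dV_K = (1/n) h_K det(D^2 h_K) dmu *)
definition cv_int :: "(real^'n) set \<Rightarrow> (real^'n \<Rightarrow> real) \<Rightarrow> real" where
  "cv_int K f = sph_int (\<lambda>x. f x * supp K x * tdet (supp K) x / real CARD('n))"

(* integral with respect to the L_2 surface area measure dS_2K = h_K^{-1} det(D^2 h_K) dmu *)
definition S2_int :: "(real^'n) set \<Rightarrow> (real^'n \<Rightarrow> real) \<Rightarrow> real" where
  "S2_int K f = sph_int (\<lambda>x. f x * tdet (supp K) x / supp K x)"

definition S2_isotropic :: "(real^'n) set \<Rightarrow> bool" where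
  "S2_isotropic K \<longleftrightarrow> (\<forall>w. S2_int K (\<lambda>x. (x \<bullet> w)^2)
                        = S2_int K (\<lambda>x. 1) / real CARD('n) * (norm w)^2)"

definition HBM :: "(real^'n) set \<Rightarrow> (real^'n \<Rightarrow> real) \<Rightarrow> real^'n \<Rightarrow> real" where
  "HBM K z x = ttr (supp K) (\<lambda>y. z y * supp K y) x / (real CARD('n) - 1) - z x"

definition ellv :: "(real^'n) set \<Rightarrow> real^'n \<Rightarrow> real^'n \<Rightarrow> real" where
  "ellv K v x = (x \<bullet> v) / supp K x"

(* C^2 functions on the sphere: restrictions of C^2 functions on an open neighbourhood *)
definition admissible :: "(real^'n) set \<Rightarrow> (real^'n \<Rightarrow> real) \<Rightarrow> bool" where
  "admissible K z \<longleftrightarrow> (\<exists>U. sphere 0 1 \<subseteq> U \<and> C2_on U z) \<and>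
     (\<exists>x\<in>sphere 0 1. z x \<noteq> 0) \<and> cv_int K z = 0 \<and>
     (\<forall>v. cv_int K (\<lambda>x. z x * ellv K v x) = 0)"

definition lambda2 :: "(real^'n) set \<Rightarrow> real" where
  "lambda2 K = Inf {cv_int K (\<lambda>x. z x * (- HBM K z x)) / cv_int K (\<lambda>x. (z x)^2) | z. admissible K z}"

end

(* Let h be the support function, X its gradient (the boundary point with given outer normal), V the total
   cone volume and rho the integral of h^-2 against it.  The coordinates X_k serve as test functions for
   lambda_2, after projection onto the orthogonal complement of the constants and the l_v; isotropy of S_2 K
   makes this projection explicit, and the X_k have mean zero because the centroid is 0.  Summing over k and
   writing q = (-p - 1)/(n - 1) gives
     q (int |X|^2 - V^2/rho) <= (n - 1)^-1 int h tr(D^2 h) - V^2/rho      (integrals against dV_K).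
   The equation says n dV_K = h^p dmu, so the divergence theorem on the round sphere, applied to h^(p+1) X,
   turns the first term on the right into int h^2 + q (int |X|^2 - int h^2).  As p < -n means q > 1, this leaves
   int h^2 <= V^2/rho, that is, int (h - c/h)^2 <= 0 with c = V/rho.  So h is constant, and the equation
   forces h = 1.  Since X_k is only C^1, it is approximated by difference quotients of h. *)
theory Submission
  imports Defs
begin

text \<open>Both integrations by parts, on K and on the round sphere, must work with X merely C^1;
  they come from one variational principle. The map T(y) = |y| X(y) carries the unit ball
  bijectively onto K, and a perturbation of T that vanishes on the unit sphere still covers K. So
  the integral of the absolute Jacobian is smallest, equal to the volume, at the unperturbed map,
  and its first variation vanishes. The perturbing field enters with one derivative only, which
  admits products of a C^1 function with a C^1 gradient and the X_k as test functions. For the unit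
  ball, where X is the identity on the sphere, the same identity is the divergence theorem on the
  sphere.

  Isotropy makes the l_v orthogonal with a known norm, and X_k pairs with l_v to v_k V/n. As the l_v
  have eigenvalue 1, projecting them away lowers energy and squared norm by the same amount; summed
  over k it is V^2/rho, which is why this term occurs on both sides of the inequality.\<close>

section \<open>Change of variables for arbitrary finite index types\<close>

text \<open>A copy of the index type that carries the order of the natural numbers. Vectors indexed
  by it can be fed to theorems about well-ordered index types; the transport back is by a fixed
  bijection.\<close>

typedef (overloaded) ('a::finite) idx = "{..<CARD('a)}"
  by (rule exI[of _ 0]) simp

setup_lifting type_definition_idx

instantiation idx :: (finite) linorder
begin
lift_definition less_eq_idx :: "'a idx \<Rightarrow> 'a idx \<Rightarrow> bool" is "(\<le>)" .
lift_definition less_idx :: "'a idx \<Rightarrow> 'a idx \<Rightarrow> bool" is "(<)" .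
instance by standard (transfer; auto)+
end

instance idx :: (finite) finite
proof
  have "(UNIV :: 'a idx set) = Abs_idx ` {..<CARD('a)}"
    by (metis type_definition.Abs_image type_definition_idx)
  then show "finite (UNIV :: 'a idx set)" by (metis finite_imageI finite_lessThan)
qed

instance idx :: (finite) wellorder
proof
  fix P :: "'a idx \<Rightarrow> bool" and a
  assume *: "\<And>x. (\<And>y. y < x \<Longrightarrow> P y) \<Longrightarrow> P x"
  show "P a"
  proof (induction "Rep_idx a" arbitrary: a rule: less_induct)
    case less
    show ?case by (rule *) (simp add: less less_idx.rep_eq)
  qed
qed

lemma card_idx: "CARD('a::finite idx) = CARD('a)"
  by (simp add: type_definition.card[OF type_definition_idx])

lemma ex_bij_idx: "\<exists>b :: 'a::finite idx \<Rightarrow> 'a. bij b"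
  using finite_same_card_bij[of "UNIV :: 'a idx set" "UNIV :: 'a set"] by (simp add: card_idx)

definition idx_bij :: "'a::finite idx \<Rightarrow> 'a" where
  "idx_bij = (SOME b. bij b)"

lemma bij_idx_bij: "bij (idx_bij :: 'a::finite idx \<Rightarrow> 'a)"
  unfolding idx_bij_def using ex_bij_idx by (rule someI_ex)

lemma idx_bij_inv [simp]: "idx_bij (inv idx_bij i) = (i :: 'a::finite)" "inv idx_bij (idx_bij j) = (j :: 'a idx)"
  using bij_idx_bij[where 'a='a] by (auto simp: bij_is_surj surj_f_inv_f bij_is_inj)

definition relab :: "real^'n \<Rightarrow> real^('n::finite idx)" where
  "relab x = (\<chi> i. x $ idx_bij i)"

definition unrelab :: "real^('n::finite idx) \<Rightarrow> real^'n" where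
  "unrelab y = (\<chi> i. y $ inv idx_bij i)"

lemma relab_inverse [simp]: "unrelab (relab x) = x" "relab (unrelab y) = y"
  by (simp_all add: relab_def unrelab_def vec_eq_iff)

lemma bounded_linear_relab: "bounded_linear relab" "bounded_linear unrelab"
  by (auto simp: relab_def unrelab_def vec_eq_iff algebra_simps intro!: linear_conv_bounded_linear[THEN iffD1] linearI)

lemma relab_axis: "unrelab (axis i 1) = axis (idx_bij i) 1"
  by (auto simp: unrelab_def axis_def vec_eq_iff)

text \<open>Relabelling rows and columns by the same bijection conjugates the permutations in the
  Leibniz sum; conjugation is a bijection between the two symmetric groups and preserves
  signs.\<close>

lemma det_relab:
  fixes A :: "real^'n^'n"
  shows "det (\<chi> i j. A $ idx_bij i $ idx_bij j) = det A"
proof -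
  let ?m = "map_permutation UNIV (idx_bij :: 'n idx \<Rightarrow> 'n)"
  have m: "?m p (idx_bij i) = idx_bij (p i)" for p :: "'n idx \<Rightarrow> 'n idx" and i
    using bij_idx_bij[where 'a='n] by (simp add: map_permutation_def restrict_id_def bij_is_surj bij_is_inj)
  have eq: "?m p = (\<lambda>x. if x \<in> UNIV then idx_bij (p (inv_into UNIV idx_bij x)) else x)" for p
    using bij_idx_bij[where 'a='n] by (auto simp: map_permutation_def restrict_id_def bij_is_surj fun_eq_iff)
  have bij: "bij_betw ?m {p. p permutes UNIV} {p. p permutes UNIV}"
    using bij_betw_permutations[OF bij_idx_bij[where 'a='n]] unfolding eq .
  have "det A = (\<Sum>p | p permutes UNIV. of_int (sign (?m p)) * (\<Prod>i\<in>UNIV. A $ i $ ?m p i))"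
    unfolding det_def by (rule sum.reindex_bij_betw[OF bij, symmetric])
  also have "\<dots> = (\<Sum>p | p permutes UNIV. of_int (sign p) * (\<Prod>i\<in>UNIV. A $ idx_bij i $ idx_bij (p i)))"
  proof (rule sum.cong[OF refl])
    fix p :: "'n idx \<Rightarrow> 'n idx" assume "p \<in> {p. p permutes UNIV}"
    then have "p permutes UNIV" by simp
    then have s: "sign (?m p) = sign p"
      by (intro sign_map_permutation) (use bij_idx_bij[where 'a='n] in \<open>auto simp: bij_is_inj\<close>)
    have "(\<Prod>i\<in>UNIV. A $ i $ ?m p i) = (\<Prod>i\<in>UNIV. A $ idx_bij i $ ?m p (idx_bij i))"
      using prod.reindex_bij_betw[OF bij_idx_bij[where 'a='n], of "\<lambda>i. A $ i $ ?m p i"] by simp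
    then show "of_int (sign (?m p)) * (\<Prod>i\<in>UNIV. A $ i $ ?m p i)
        = real_of_int (sign p) * (\<Prod>i\<in>UNIV. A $ idx_bij i $ idx_bij (p i))"
      by (simp add: m s)
  qed
  also have "\<dots> = det (\<chi> i j. A $ idx_bij i $ idx_bij j)"
    by (simp add: det_def)
  finally show ?thesis by simp
qed

lemma det_matrix_relab:
  fixes f :: "real^'n \<Rightarrow> real^'n"
  shows "det (matrix (\<lambda>x. relab (f (unrelab x)))) = det (matrix f)"
proof -
  have "matrix (\<lambda>x. relab (f (unrelab x))) = (\<chi> i j. matrix f $ idx_bij i $ idx_bij j)"
    by (simp add: matrix_def vec_eq_iff relab_axis) (simp add: relab_def)
  then show ?thesis by (simp add: det_relab)
qed

lemma inner_relab: "relab x \<bullet> y = x \<bullet> unrelab y"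
proof -
  have "(\<Sum>i\<in>UNIV. x $ idx_bij i * y $ i) = (\<Sum>i\<in>UNIV. x $ i * y $ inv idx_bij i)"
    using sum.reindex_bij_betw[OF bij_idx_bij, of "\<lambda>i. x $ i * y $ inv idx_bij i"] by simp
  then show ?thesis by (simp add: inner_vec_def relab_def unrelab_def)
qed

lemma bij_betw_unrelab_Basis: "bij_betw (unrelab :: real^('n::finite idx) \<Rightarrow> real^'n) Basis Basis"
proof -
  have "inj_on (unrelab :: real^'n idx \<Rightarrow> real^'n) Basis" by (rule inj_on_inverseI[of _ relab]) simp
  moreover have "(unrelab :: real^'n idx \<Rightarrow> real^'n) ` Basis = Basis"
  proof safe
    fix b :: "real^'n idx" assume "b \<in> Basis"
    then show "unrelab b \<in> Basis" by (auto simp: Basis_vec_def relab_axis)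
  next
    fix b :: "real^'n" assume "b \<in> Basis"
    then obtain i where "b = axis i 1" by (auto simp: Basis_vec_def)
    then have "b = unrelab (axis (inv idx_bij i) 1)" by (simp add: relab_axis)
    then show "b \<in> unrelab ` Basis" by (auto simp: Basis_vec_def)
  qed
  ultimately show ?thesis by (simp add: bij_betw_def)
qed

lemma measurable_relab: "relab \<in> borel \<rightarrow>\<^sub>M borel"
  using bounded_linear_relab(1) by (intro borel_measurable_continuous_onI linear_continuous_on)

lemma measurable_unrelab: "unrelab \<in> borel \<rightarrow>\<^sub>M borel"
  using bounded_linear_relab(2) by (intro borel_measurable_continuous_onI linear_continuous_on)

text \<open>Lebesgue measure is determined by its values on boxes, and a relabelling only permutes
  the sides of a box.\<close>

lemma distr_relab_lborel: "distr lborel borel relab = (lborel :: (real^('n::finite idx)) measure)"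
proof (rule lborel_eqI[symmetric])
  fix l u :: "real^'n idx"
  assume lu: "\<And>b. b \<in> Basis \<Longrightarrow> l \<bullet> b \<le> u \<bullet> b"
  have B: "unrelab ` Basis = (Basis :: (real^'n) set)"
    using bij_betw_unrelab_Basis[where 'n='n] by (simp add: bij_betw_def)
  have un: "unrelab a \<bullet> unrelab b = a \<bullet> b" for a b :: "real^'n idx"
    by (simp flip: inner_relab)
  have v: "relab -` box l u = box (unrelab l) (unrelab u)"
    by (auto simp: mem_box un inner_relab simp flip: B)
  have "emeasure (distr lborel borel relab) (box l u) = emeasure lborel (box (unrelab l) (unrelab u))"
    by (subst emeasure_distr) (use measurable_relab v in auto)
  also have "\<dots> = ennreal (\<Prod>b\<in>Basis. (unrelab u - unrelab l) \<bullet> b)"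
    by (rule emeasure_lborel_box) (use lu in \<open>auto simp: un simp flip: B\<close>)
  also have "\<dots> = ennreal (\<Prod>b\<in>Basis. (u - l) \<bullet> b)"
    using prod.reindex_bij_betw[OF bij_betw_unrelab_Basis, of "\<lambda>b. (unrelab u - unrelab l) \<bullet> b"]
    by (simp add: inner_diff_left un)
  finally show "emeasure (distr lborel borel relab) (box l u) = (\<Prod>b\<in>Basis. (u - l) \<bullet> b)" .
qed simp

lemma relab_lebesgue:
  shows distr_relab_lebesgue: "distr lebesgue lebesgue relab = (lebesgue :: (real^('n::finite idx)) measure)"
    and measurable_relab_lebesgue: "relab \<in> lebesgue \<rightarrow>\<^sub>M (lebesgue :: (real^('n::finite idx)) measure)"
proof -
  have d: "distr lebesgue lborel relab = (lborel :: (real^('n idx)) measure)"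
    by (simp add: distr_completion measurable_relab distr_relab_lborel cong: distr_cong)
  show "relab \<in> lebesgue \<rightarrow>\<^sub>M (lebesgue :: (real^('n::finite idx)) measure)"
    by (rule completion.measurable_completion2) (simp_all add: d measurable_completion measurable_relab)
  show "distr lebesgue lebesgue relab = (lebesgue :: (real^('n::finite idx)) measure)"
    by (subst completion.completion_distr_eq[symmetric]) (simp_all add: d measurable_completion measurable_relab)
qed

lemma unrelab_lebesgue:
  shows measurable_unrelab_lebesgue: "unrelab \<in> (lebesgue :: (real^('n::finite idx)) measure) \<rightarrow>\<^sub>M lebesgue"
    and distr_unrelab_lebesgue: "distr (lebesgue :: (real^('n::finite idx)) measure) lebesgue unrelab = lebesgue"
proof -
  have "distr lborel borel unrelab = distr (distr lborel borel relab) borel (unrelab :: real^'n idx \<Rightarrow> real^'n)"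
    by (simp add: distr_relab_lborel)
  also have "\<dots> = (lborel :: (real^'n) measure)"
    using measurable_relab measurable_unrelab
    by (subst distr_distr) (auto simp: o_def intro: distr_id2)
  finally have "distr lborel borel unrelab = (lborel :: (real^'n) measure)" .
  then have d: "distr lebesgue lborel unrelab = (lborel :: (real^'n) measure)"
    by (simp add: distr_completion measurable_unrelab cong: distr_cong)
  show "unrelab \<in> (lebesgue :: (real^('n idx)) measure) \<rightarrow>\<^sub>M lebesgue"
    by (rule completion.measurable_completion2) (simp_all add: d measurable_completion measurable_unrelab)
  show "distr (lebesgue :: (real^('n idx)) measure) lebesgue unrelab = lebesgue"
    by (subst completion.completion_distr_eq[symmetric]) (simp_all add: d measurable_completion measurable_unrelab)
qed

lemma relab_integrable:
  fixes F :: "real^'n \<Rightarrow> 'k::euclidean_space"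
  shows "(\<lambda>x. F (unrelab x)) absolutely_integrable_on relab ` S \<longleftrightarrow> F absolutely_integrable_on S"
    and "F absolutely_integrable_on S \<Longrightarrow> integral (relab ` S) (\<lambda>x. F (unrelab x)) = integral S F"
proof -
  let ?F = "\<lambda>x. indicator S x *\<^sub>R F x" and ?G = "\<lambda>x. indicator (relab ` S) x *\<^sub>R F (unrelab x)"
  have i: "indicator (relab ` S) x = (indicator S (unrelab x) :: real)" for x
    by (auto simp: indicator_def image_iff) (metis relab_inverse)
  have 1: "integrable lebesgue ?G" if "integrable lebesgue ?F"
    using integrable_distr[OF measurable_unrelab_lebesgue, of ?F] that
    by (simp add: distr_unrelab_lebesgue i)
  have 2: "integrable lebesgue ?F" if "integrable lebesgue ?G"
    using integrable_distr[OF measurable_relab_lebesgue, of ?G] that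
    by (simp add: distr_relab_lebesgue i)
  show iff: "(\<lambda>x. F (unrelab x)) absolutely_integrable_on relab ` S \<longleftrightarrow> F absolutely_integrable_on S"
    using 1 2 by (auto simp: set_integrable_def)
  assume F: "F absolutely_integrable_on S"
  have "integral\<^sup>L lebesgue ?F = integral\<^sup>L lebesgue ?G"
    using integral_distr[OF measurable_unrelab_lebesgue, of ?F] F
    by (simp add: distr_unrelab_lebesgue i set_integrable_def)
  then show "integral (relab ` S) (\<lambda>x. F (unrelab x)) = integral S F"
    using set_lebesgue_integral_eq_integral(2)[OF F]
      set_lebesgue_integral_eq_integral(2)[OF iff[THEN iffD2, OF F]]
    by (simp add: set_lebesgue_integral_def)
qed

lemma relab_image_sets: "S \<in> sets lebesgue \<Longrightarrow> relab ` S \<in> sets lebesgue"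
proof -
  assume "S \<in> sets lebesgue"
  then have "unrelab -` S \<inter> space lebesgue \<in> sets lebesgue"
    by (rule measurable_sets[OF measurable_unrelab_lebesgue])
  moreover have "unrelab -` S = relab ` S"
    by (auto simp: image_iff) (metis relab_inverse)
  ultimately show ?thesis by simp
qed

lemma relab_has_derivative:
  assumes "(g has_derivative g') (at x within S)"
  shows "((\<lambda>y. relab (g (unrelab y))) has_derivative (\<lambda>v. relab (g' (unrelab v)))) (at (relab x) within relab ` S)"
proof -
  have im: "unrelab ` relab ` S = S" by (simp add: image_image)
  have u: "(unrelab has_derivative unrelab) (at (relab x) within relab ` S)"
    by (rule bounded_linear_imp_has_derivative) (rule bounded_linear_relab)
  have "((g \<circ> unrelab) has_derivative (g' \<circ> unrelab)) (at (relab x) within relab ` S)"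
    by (rule diff_chain_within[OF u]) (simp add: im assms)
  from bounded_linear.has_derivative[OF bounded_linear_relab(1) this]
  show ?thesis by (simp add: o_def)
qed

text \<open>The library states the change of variables formula for well-ordered index types only.\<close>

theorem change_of_variables_finite:
  fixes f :: "real^'n \<Rightarrow> real^'k" and g :: "real^'n \<Rightarrow> real^'n"
  assumes S: "S \<in> sets lebesgue"
    and der_g: "\<And>x. x \<in> S \<Longrightarrow> (g has_derivative g' x) (at x within S)"
    and inj: "inj_on g S"
    and ai: "(\<lambda>x. \<bar>det (matrix (g' x))\<bar> *\<^sub>R f (g x)) absolutely_integrable_on S"
  shows "f absolutely_integrable_on g ` S"
    and "integral (g ` S) f = integral S (\<lambda>x. \<bar>det (matrix (g' x))\<bar> *\<^sub>R f (g x))"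
proof -
  let ?g = "\<lambda>y. relab (g (unrelab y))" and ?g' = "\<lambda>y v. relab (g' (unrelab y) (unrelab v))"
  let ?D = "\<lambda>x. \<bar>det (matrix (g' x))\<bar> *\<^sub>R f (g x)"
  have im: "?g ` relab ` S = relab ` g ` S" by (simp add: image_image)
  have "(\<lambda>x. \<bar>det (matrix (?g' x))\<bar> *\<^sub>R f (unrelab (?g x))) absolutely_integrable_on relab ` S \<and>
      integral (relab ` S) (\<lambda>x. \<bar>det (matrix (?g' x))\<bar> *\<^sub>R f (unrelab (?g x))) = integral S ?D
     \<longleftrightarrow> (\<lambda>x. f (unrelab x)) absolutely_integrable_on (?g ` relab ` S) \<and>
      integral (?g ` relab ` S) (\<lambda>x. f (unrelab x)) = integral S ?D"
  proof (rule has_absolute_integral_change_of_variables)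
    show "relab ` S \<in> sets lebesgue" using S by (rule relab_image_sets)
    show "(?g has_derivative ?g' y) (at y within relab ` S)" if "y \<in> relab ` S" for y
      using that relab_has_derivative[OF der_g] by auto
    show "inj_on ?g (relab ` S)"
      using inj by (auto simp: inj_on_def) (metis relab_inverse)
  qed
  moreover have "(\<lambda>x. \<bar>det (matrix (?g' x))\<bar> *\<^sub>R f (unrelab (?g x))) = (\<lambda>x. ?D (unrelab x))"
    by (simp add: det_matrix_relab)
  ultimately have "(\<lambda>x. f (unrelab x)) absolutely_integrable_on (relab ` g ` S) \<and>
      integral (relab ` g ` S) (\<lambda>x. f (unrelab x)) = integral S ?D"
    using relab_integrable[where F = ?D and S = S] ai by (simp add: im)
  then show "f absolutely_integrable_on g ` S" "integral (g ` S) f = integral S ?D"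
    using relab_integrable[where F = f and S = "g ` S"] by auto
qed

text \<open>Without injectivity an inequality remains, because overlapping parts of the image are
  counted several times on the right. This is the form needed for perturbed maps, whose injectivity
  is not known.\<close>

theorem measure_image_finite:
  fixes g :: "real^'n \<Rightarrow> real^'n"
  assumes S: "S \<in> sets lebesgue"
    and der_g: "\<And>x. x \<in> S \<Longrightarrow> (g has_derivative g' x) (at x within S)"
    and ai: "(\<lambda>x. \<bar>det (matrix (g' x))\<bar>) absolutely_integrable_on S"
  shows "g ` S \<in> lmeasurable"
    and "measure lebesgue (g ` S) \<le> integral S (\<lambda>x. \<bar>det (matrix (g' x))\<bar>)"
proof -
  let ?g = "\<lambda>y. relab (g (unrelab y))" and ?g' = "\<lambda>y v. relab (g' (unrelab y) (unrelab v))"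
  let ?D = "\<lambda>x. \<bar>det (matrix (g' x))\<bar>"
  have im: "?g ` relab ` S = relab ` g ` S" by (simp add: image_image)
  have eq: "(\<lambda>x. \<bar>det (matrix (?g' x))\<bar>) = (\<lambda>x. ?D (unrelab x))"
    by (simp add: det_matrix_relab)
  have int: "(\<lambda>x. ?D (unrelab x)) absolutely_integrable_on relab ` S"
    using relab_integrable(1)[where F = ?D and S = S] ai by simp
  have S': "relab ` S \<in> sets lebesgue" using S by (rule relab_image_sets)
  have der: "(?g has_derivative ?g' y) (at y within relab ` S)" if "y \<in> relab ` S" for y
    using that relab_has_derivative[OF der_g] by auto
  have int': "(\<lambda>x. \<bar>det (matrix (?g' x))\<bar>) integrable_on relab ` S"
    unfolding eq using int by (rule set_lebesgue_integral_eq_integral(1))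
  have m: "relab ` g ` S \<in> lmeasurable"
    and le: "measure lebesgue (relab ` g ` S) \<le> integral (relab ` S) (\<lambda>x. ?D (unrelab x))"
    using measurable_differentiable_image[OF S' der int'] measure_differentiable_image[OF S' der int']
    unfolding im eq by auto
  have one: "(\<lambda>x. 1::real) absolutely_integrable_on g ` S"
    using m relab_integrable(1)[where F = "\<lambda>x. 1::real" and S = "g ` S"]
    by (simp add: lmeasurable_iff_integrable_on absolutely_integrable_on_iff_nonneg)
  then show gm: "g ` S \<in> lmeasurable"
    by (simp add: lmeasurable_iff_integrable_on set_lebesgue_integral_eq_integral(1))
  have "measure lebesgue (relab ` g ` S) = measure lebesgue (g ` S)"
    using relab_integrable(2)[OF one] m gm by (simp add: lmeasure_integral)
  then show "measure lebesgue (g ` S) \<le> integral S ?D"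
    using le relab_integrable(2)[OF ai] by simp
qed

section \<open>Determinants\<close>

text \<open>After a rotation that takes \<open>x\<close> to a multiple of a coordinate vector, the
  matrix differs from the identity in a single column, and Cramer's lemma evaluates it.\<close>

lemma det_one_plus_rank_one:
  fixes w x :: "real^'n"
  shows "det (matrix (\<lambda>v. v + (x \<bullet> v) *\<^sub>R w)) = 1 + x \<bullet> w"
proof -
  fix k :: 'n
  obtain R :: "real^'n \<Rightarrow> real^'n" where R: "orthogonal_transformation R" "R x = norm x *\<^sub>R axis k 1"
    using orthogonal_transformation_exists[of x "norm x *\<^sub>R axis k (1::real)"] by auto
  then obtain R' where R': "orthogonal_transformation R'" "\<And>v. R' (R v) = v" "\<And>v. R (R' v) = v"
    by (metis orthogonal_transformation_bij orthogonal_transformation_inv bij_inv_eq_iff)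
  have lin: "linear R" "linear R'"
    using R R' by (auto simp: orthogonal_transformation_def)
  let ?f = "\<lambda>v. v + (x \<bullet> v) *\<^sub>R w" and ?g = "\<lambda>v. v + (norm x * v $ k) *\<^sub>R R w"
  have lf: "linear ?f" "linear ?g"
    by (auto intro!: linearI simp: algebra_simps inner_add_right)
  have xv: "x \<bullet> R' v = norm x * v $ k" for v
  proof -
    have "x \<bullet> R' v = R x \<bullet> R (R' v)"
      using R(1) by (simp add: orthogonal_transformation_def)
    then show ?thesis by (simp add: R R' inner_axis')
  qed
  have "?g = R \<circ> (?f \<circ> R')"
    using R' lin by (auto simp: fun_eq_iff linear_add linear_scale xv)
  then have "matrix ?g = matrix R ** (matrix ?f ** matrix R')"
    using lf lin by (simp add: matrix_compose linear_compose)
  then have "det (matrix ?g) = det (matrix R) * (det (matrix ?f) * det (matrix R'))"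
    by (simp add: det_mul)
  moreover have "det (matrix R) * det (matrix R') = 1"
  proof -
    have "matrix R ** matrix R' = matrix (R \<circ> R')" using lin by (simp add: matrix_compose)
    also have "R \<circ> R' = id" using R' by auto
    finally show ?thesis by (metis det_mul det_I matrix_id_mat_1)
  qed
  ultimately have "det (matrix ?g) = det (matrix ?f)"
    by (simp add: algebra_simps)
  moreover have "matrix ?g = (\<chi> i j. if j = k then (mat 1 *v (axis k 1 + norm x *\<^sub>R R w)) $ i else (mat 1 :: real^'n^'n) $ i $ j)"
    unfolding matrix_vector_mul_lid by (auto simp: matrix_def vec_eq_iff mat_def axis_def)
  then have "det (matrix ?g) = (axis k 1 + norm x *\<^sub>R R w) $ k * det (mat 1 :: real^'n^'n)"
    using cramer_lemma[of k "mat 1" "axis k 1 + norm x *\<^sub>R R w"] by simp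
  moreover have "x \<bullet> w = norm x * R w $ k" using xv[of "R w"] R' by simp
  ultimately show ?thesis by (simp add: axis_def)
qed

text \<open>As \<open>A\<close> maps into the hyperplane orthogonal to \<open>x\<close>, the map on
  the left is the one on the right followed by a rank-one perturbation of the identity. Of
  \<open>X\<close> only the normal component counts; in the application it is the support
  function.\<close>

lemma det_plus_rank_one:
  fixes A :: "real^'n \<Rightarrow> real^'n"
  assumes A: "linear A" "\<And>v. x \<bullet> A v = 0" and x: "norm x = 1"
  shows "det (matrix (\<lambda>v. A v + (x \<bullet> v) *\<^sub>R X)) = (X \<bullet> x) * det (matrix (\<lambda>v. A v + (x \<bullet> v) *\<^sub>R x))"
proof -
  let ?f = "\<lambda>v. A v + (x \<bullet> v) *\<^sub>R x" and ?g = "\<lambda>v. v + (x \<bullet> v) *\<^sub>R (X - x)"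
  have lf: "linear ?f" "linear ?g"
    using A by (auto intro!: linearI simp: algebra_simps inner_add_right linear_add linear_scale)
  have "x \<bullet> x = 1" using x by (simp add: norm_eq_1)
  then have "(\<lambda>v. A v + (x \<bullet> v) *\<^sub>R X) = ?g \<circ> ?f"
    by (auto simp: fun_eq_iff A inner_add_right algebra_simps)
  then have "det (matrix (\<lambda>v. A v + (x \<bullet> v) *\<^sub>R X)) = det (matrix ?g) * det (matrix ?f)"
    using lf by (simp add: matrix_compose det_mul)
  then show ?thesis
    unfolding det_one_plus_rank_one using \<open>x \<bullet> x = 1\<close> by (simp add: inner_diff_right inner_commute)
qed

lemma det_line_has_derivative:
  fixes J E :: "real^'n^'n"
  shows "((\<lambda>t. det (J + t *\<^sub>R E)) has_real_derivative
     (\<Sum>p | p permutes UNIV. of_int (sign p) * (\<Sum>i\<in>UNIV. E $ i $ p i * (\<Prod>j\<in>UNIV - {i}. J $ j $ p j + t * E $ j $ p j)))) (at t)"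
  unfolding det_def has_field_derivative_def
  by (auto intro!: derivative_eq_intros sum.cong simp: sum_distrib_left sum_distrib_right mult_ac)

text \<open>A permutation other than the identity moves at least two indices. Differentiation
  removes one factor of the Leibniz product, so an off-diagonal entry of the identity matrix, a
  zero, is always left.\<close>

lemma det_one_plus_derivative:
  fixes M :: "real^'n^'n"
  shows "((\<lambda>t. det (mat 1 + t *\<^sub>R M)) has_real_derivative trace M) (at 0)"
proof -
  let ?T = "\<lambda>p. of_int (sign p) * (\<Sum>i\<in>UNIV. M $ i $ p i * (\<Prod>j\<in>UNIV - {i}. (mat 1 :: real^'n^'n) $ j $ p j + 0 * M $ j $ p j))"
  have z: "?T p = 0" if p: "p permutes UNIV" "p \<noteq> id" for p :: "'n \<Rightarrow> 'n"
  proof -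
    obtain a where a: "p a \<noteq> a" using p by (auto simp: fun_eq_iff)
    then have b: "p (p a) \<noteq> p a" using p permutes_inj by (metis injD)
    have "(\<Prod>j\<in>UNIV - {i}. (mat 1 :: real^'n^'n) $ j $ p j + 0 * M $ j $ p j) = 0" for i
    proof -
      obtain j where "j \<noteq> i" "p j \<noteq> j" using a b by metis
      then show ?thesis by (intro prod_zero) (auto simp: mat_def intro!: bexI[of _ j])
    qed
    then show ?thesis by (simp only: mult_zero_right sum.neutral_const)
  qed
  have "(\<Sum>p | p permutes (UNIV :: 'n set). ?T p) = (\<Sum>p\<in>{id}. ?T p)"
  proof (rule sum.mono_neutral_right)
    show "\<forall>p\<in>{p. p permutes UNIV} - {id}. ?T p = 0" using z by blast
  qed (auto simp: permutes_id)
  also have "\<dots> = trace M"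
    by (simp add: trace_def mat_def)
  finally show ?thesis
    using det_line_has_derivative[of "mat 1" M 0] by simp
qed

lemma scaleR_matrix_mult_right:
  fixes A B :: "real^'n^'n"
  shows "A ** (t *\<^sub>R B) = t *\<^sub>R (A ** B)"
  by (simp add: matrix_matrix_mult_def vec_eq_iff sum_distrib_left mult_ac)

lemma matrix_inv_inverse:
  fixes J :: "real^'n^'n"
  assumes "det J \<noteq> 0"
  shows "J ** matrix_inv J = mat 1" "matrix_inv J ** J = mat 1"
proof -
  have "\<exists>A'. J ** A' = mat 1 \<and> A' ** J = mat 1"
    using assms by (simp flip: invertible_det_nz add: invertible_def)
  from someI_ex[OF this] show "J ** matrix_inv J = mat 1" "matrix_inv J ** J = mat 1"
    by (auto simp: matrix_inv_def)
qed

text \<open>Jacobi's formula: factoring out \<open>J\<close> reduces the derivative to the one at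
  the identity matrix.\<close>

lemma det_line_derivative_0:
  fixes J E :: "real^'n^'n"
  assumes "det J \<noteq> 0"
  shows "((\<lambda>t. det (J + t *\<^sub>R E)) has_real_derivative det J * trace (matrix_inv J ** E)) (at 0)"
proof -
  have eq: "J + t *\<^sub>R E = J ** (mat 1 + t *\<^sub>R (matrix_inv J ** E))" for t
    by (simp add: matrix_add_ldistrib matrix_mul_assoc matrix_inv_inverse[OF assms] scaleR_matrix_mult_right
        del: scaleR_matrix_mult_right) (simp only: scaleR_matrix_mult_right matrix_mul_assoc matrix_inv_inverse[OF assms] matrix_mul_lid)
  have "(\<lambda>t. det (J + t *\<^sub>R E)) = (\<lambda>t. det J * det (mat 1 + t *\<^sub>R (matrix_inv J ** E)))"
    by (simp only: eq det_mul)
  then show ?thesis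
    using DERIV_cmult[OF det_one_plus_derivative] by simp
qed

text \<open>The constant depends only on the bound for the entries, hence is uniform over all points
  of the ball. It supplies the dominating function when the volume of the perturbed maps is
  differentiated under the integral.\<close>

lemma det_line_lipschitz:
  fixes dummy :: "'n::finite itself"
  obtains C where "\<And>(J :: real^'n^'n) E t. \<lbrakk>\<And>i j. \<bar>J $ i $ j\<bar> \<le> B; \<And>i j. \<bar>E $ i $ j\<bar> \<le> B; \<bar>t\<bar> \<le> 1\<rbrakk>
     \<Longrightarrow> \<bar>det (J + t *\<^sub>R E) - det J\<bar> \<le> C * \<bar>t\<bar>"
proof
  let ?n = "CARD('n)"
  let ?C = "\<Sum>p | p permutes (UNIV :: 'n set). \<Sum>i\<in>(UNIV :: 'n set). B * (2 * B) ^ (?n - 1)"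
  fix J E :: "real^'n^'n" and t :: real
  assume J: "\<And>i j. \<bar>J $ i $ j\<bar> \<le> B" and E: "\<And>i j. \<bar>E $ i $ j\<bar> \<le> B" and t: "\<bar>t\<bar> \<le> 1"
  have B: "B \<ge> 0" using J abs_ge_zero order_trans by blast
  let ?D = "\<lambda>t. \<Sum>p | p permutes UNIV. of_int (sign p) * (\<Sum>i\<in>UNIV. E $ i $ p i * (\<Prod>j\<in>UNIV - {i}. J $ j $ p j + t * E $ j $ p j))"
  have D: "\<bar>?D s\<bar> \<le> ?C" if s: "\<bar>s\<bar> \<le> 1" for s
  proof -
    have e: "\<bar>J $ i $ j + s * E $ i $ j\<bar> \<le> 2 * B" for i j
    proof -
      have "\<bar>s * E $ i $ j\<bar> \<le> 1 * B"
        unfolding abs_mult using s E by (intro mult_mono) auto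
      then show ?thesis using J[of i j] by linarith
    qed
    have pr: "\<bar>\<Prod>j\<in>UNIV - {i}. J $ j $ p j + s * E $ j $ p j\<bar> \<le> (2 * B) ^ (?n - 1)" for i and p :: "'n \<Rightarrow> 'n"
    proof -
      have "\<bar>\<Prod>j\<in>UNIV - {i}. J $ j $ p j + s * E $ j $ p j\<bar> \<le> (\<Prod>j\<in>UNIV - {i}. 2 * B)"
        unfolding abs_prod using e by (intro prod_mono) auto
      then show ?thesis by (simp add: card_Diff_singleton)
    qed
    have pr': "\<bar>of_int (sign p) * (\<Sum>i\<in>UNIV. E $ i $ p i * (\<Prod>j\<in>UNIV - {i}. J $ j $ p j + s * E $ j $ p j))\<bar>
        \<le> (\<Sum>i\<in>(UNIV :: 'n set). B * (2 * B) ^ (?n - 1))" for p :: "'n \<Rightarrow> 'n"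
    proof -
      have "\<bar>of_int (sign p) :: real\<bar> = 1" by (cases p rule: sign_cases) auto
      moreover have "\<bar>\<Sum>i\<in>UNIV. E $ i $ p i * (\<Prod>j\<in>UNIV - {i}. J $ j $ p j + s * E $ j $ p j)\<bar>
        \<le> (\<Sum>i\<in>(UNIV :: 'n set). B * (2 * B) ^ (?n - 1))"
        by (rule order_trans[OF sum_abs], rule sum_mono)
           (use pr E B in \<open>auto simp: abs_mult intro!: mult_mono\<close>)
      ultimately show ?thesis by (simp add: abs_mult)
    qed
    show ?thesis
      by (rule order_trans[OF sum_abs], rule sum_mono) (rule pr')
  qed
  have "norm (det (J + t *\<^sub>R E) - det (J + 0 *\<^sub>R E)) \<le> ?C * norm (t - 0)"
  proof (rule field_differentiable_bound[of "{-1..1}" _ ?D])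
    show "((\<lambda>t. det (J + t *\<^sub>R E)) has_field_derivative ?D z) (at z within {-1..1})" for z
      by (rule has_field_derivative_at_within[OF det_line_has_derivative])
  qed (use t D in auto)
  then show "\<bar>det (J + t *\<^sub>R E) - det J\<bar> \<le> ?C * \<bar>t\<bar>" by simp
qed

text \<open>The differential of the determinant at \<open>J\<close> in the direction
  \<open>E\<close>, written as a polynomial in the entries: no inverse of \<open>J\<close> occurs,
  and continuity and linearity in \<open>E\<close> are immediate.\<close>

definition ddet :: "real^'n^'n \<Rightarrow> real^'n^'n \<Rightarrow> real" where
  "ddet J E = (\<Sum>p | p permutes UNIV. of_int (sign p) * (\<Sum>i\<in>UNIV. E $ i $ p i * (\<Prod>j\<in>UNIV - {i}. J $ j $ p j)))"

lemma det_line_has_derivative_0: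
  "((\<lambda>t. det (J + t *\<^sub>R E)) has_real_derivative ddet J E) (at 0)"
  using det_line_has_derivative[of J E 0] by (simp add: ddet_def)

lemma ddet_eq_trace: "det J \<noteq> 0 \<Longrightarrow> ddet J E = det J * trace (matrix_inv J ** E)"
  using DERIV_unique[OF det_line_has_derivative_0 det_line_derivative_0] by blast

lemma ddet_add: "ddet J (E + F) = ddet J E + ddet J F"
  by (simp add: ddet_def algebra_simps sum.distrib)

lemma ddet_scaleR: "ddet J (c *\<^sub>R E) = c * ddet J E"
  by (simp add: ddet_def algebra_simps sum_distrib_left)

lemma continuous_on_ddet:
  assumes "\<And>i j. continuous_on S (\<lambda>x. J x $ i $ j)" "\<And>i j. continuous_on S (\<lambda>x. E x $ i $ j)"
  shows "continuous_on S (\<lambda>x. ddet (J x) (E x))"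
  unfolding ddet_def by (intro continuous_intros assms)

lemma continuous_on_det:
  fixes J :: "'a::topological_space \<Rightarrow> real^'n^'n"
  assumes "\<And>i j. continuous_on S (\<lambda>x. J x $ i $ j)"
  shows "continuous_on S (\<lambda>x. det (J x))"
  unfolding det_def by (intro continuous_intros assms)

lemma det_matrix_scale:
  fixes L :: "real^'n \<Rightarrow> real^'n"
  assumes "linear L"
  shows "det (matrix (\<lambda>v. c *\<^sub>R L v)) = c ^ CARD('n) * det (matrix L)"
proof -
  have "(\<lambda>v. c *\<^sub>R L v) = ((*\<^sub>R) c) \<circ> L" by auto
  then show ?thesis
    using assms by (simp add: matrix_compose linear_scale_self det_mul)
qed

section \<open>Integration over the sphere\<close>

text \<open>Functions of \<open>y /\<^sub>R norm y\<close> are in general discontinuous at the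
  origin, so this negligible point is removed.\<close>

abbreviation pball :: "(real^'n) set" where "pball \<equiv> ball 0 1 - {0}"

lemma pball_lmeasurable: "pball \<in> lmeasurable"
  by (simp add: fmeasurable.Diff bounded_set_imp_lmeasurable)

lemma continuous_on_sphere_extend:
  assumes "continuous_on (sphere 0 1) F"
  shows "continuous_on (- {0}) (\<lambda>y::real^'n. F (y /\<^sub>R norm y))"
  by (rule continuous_on_compose2[OF assms]) (auto simp: field_simps split: if_splits intro!: continuous_intros)

lemma abs_integrable_pball:
  fixes f :: "real^'n \<Rightarrow> 'a::euclidean_space"
  assumes "continuous_on pball f" "\<And>y. y \<in> pball \<Longrightarrow> norm (f y) \<le> C"
  shows "f absolutely_integrable_on pball"
proof (rule measurable_bounded_by_integrable_imp_absolutely_integrable)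
  show "f \<in> borel_measurable (lebesgue_on pball)"
    using assms(1) pball_lmeasurable
    by (intro continuous_imp_measurable_on_sets_lebesgue) (auto simp: fmeasurable_def)
  show "pball \<in> sets (lebesgue :: (real^'n) measure)"
    using pball_lmeasurable by (auto simp: fmeasurable_def)
  show "(\<lambda>_. C) integrable_on (pball :: (real^'n) set)"
    using pball_lmeasurable by (rule integrable_on_const)
qed (use assms in auto)

lemma sphere_bounded:
  fixes F :: "real^'n \<Rightarrow> 'a::real_normed_vector"
  assumes "continuous_on (sphere 0 1) F"
  obtains C where "\<And>x. x \<in> sphere 0 1 \<Longrightarrow> norm (F x) \<le> C"
  using compact_imp_bounded[OF compact_continuous_image[OF assms compact_sphere]]
  unfolding bounded_iff by (metis imageI)

lemma abs_integrable_sphere: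
  fixes F :: "real^'n \<Rightarrow> 'a::euclidean_space"
  assumes "continuous_on (sphere 0 1) F"
  shows "(\<lambda>y. F (y /\<^sub>R norm y)) absolutely_integrable_on pball"
proof -
  obtain C where "\<And>x. x \<in> sphere 0 1 \<Longrightarrow> norm (F x) \<le> C" using sphere_bounded[OF assms] by blast
  then show ?thesis
    by (intro abs_integrable_pball[of _ C] continuous_on_subset[OF continuous_on_sphere_extend[OF assms]]) auto
qed

text \<open>Passes from the Lebesgue integral in \<open>sph_int\<close> to the integral over the
  punctured ball, the form in which the change of variables and the convergence theorems are
  applied.\<close>

lemma sph_int_eq_pball:
  fixes F :: "real^'n \<Rightarrow> real"
  assumes "continuous_on (sphere 0 1) F"
  shows "sph_int F = real CARD('n) * integral pball (\<lambda>y. F (y /\<^sub>R norm y))"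
proof -
  let ?f = "\<lambda>y. F (y /\<^sub>R norm y)"
  have "(LINT y : ball 0 1 | lborel. ?f y) = (LINT y : pball | lborel. ?f y)"
    unfolding set_lebesgue_integral_def
    by (rule integral_discrete_difference[of "{0}"]) (auto simp: indicator_def)
  also have "\<dots> = integral pball ?f"
  proof -
    have "set_integrable lebesgue pball ?f" using abs_integrable_sphere[OF assms] .
    moreover have "?f \<in> borel_measurable (restrict_space borel pball)"
      using continuous_on_subset[OF continuous_on_sphere_extend[OF assms], of pball]
      by (intro borel_measurable_continuous_on_restrict) auto
    then have "(\<lambda>y. indicator pball y *\<^sub>R ?f y) \<in> borel_measurable lborel"
      by (simp add: borel_measurable_restrict_space_iff mult.commute)
    ultimately have "set_integrable lborel pball ?f"
      by (simp add: set_integrable_def integrable_completion)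
    then show ?thesis by (rule set_borel_integral_eq_integral(2))
  qed
  finally show ?thesis by (simp add: sph_int_def)
qed

lemma sph_int_cong:
  fixes F G :: "real^'n \<Rightarrow> real"
  assumes "\<And>x. norm x = 1 \<Longrightarrow> F x = G x"
  shows "sph_int F = sph_int G"
  unfolding sph_int_def set_lebesgue_integral_def
  by (intro arg_cong2[where f = "(*)"] refl integral_discrete_difference[of "{0}"]) (auto simp: assms)

lemma sph_int_add:
  assumes "continuous_on (sphere 0 1) F" "continuous_on (sphere 0 1) G"
  shows "sph_int (\<lambda>x. F x + G x) = sph_int F + sph_int G"
  using assms by (simp add: sph_int_eq_pball continuous_on_add integral_add distrib_left
      set_lebesgue_integral_eq_integral(1)[OF abs_integrable_sphere])

lemma sph_int_cmul: "sph_int (\<lambda>x. c * F x) = c * sph_int F"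
  by (simp add: sph_int_def mult.left_commute)

lemma sph_int_uminus: "sph_int (\<lambda>x. - F x) = - sph_int F"
  using sph_int_cmul[of "-1" F] by simp

lemma sph_int_diff:
  assumes "continuous_on (sphere 0 1) F" "continuous_on (sphere 0 1) G"
  shows "sph_int (\<lambda>x. F x - G x) = sph_int F - sph_int G"
  using sph_int_add[OF assms(1) continuous_on_minus[OF assms(2)]] by (simp add: sph_int_uminus)

lemma sph_int_sum:
  assumes "finite I" "\<And>i. i \<in> I \<Longrightarrow> continuous_on (sphere 0 1) (F i)"
  shows "sph_int (\<lambda>x. \<Sum>i\<in>I. F i x) = (\<Sum>i\<in>I. sph_int (F i))"
  using assms
proof (induction rule: finite_induct)
  case empty
  then show ?case using sph_int_cmul[of 0 "\<lambda>_. 0"] by simp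
next
  case (insert i I)
  then show ?case by (simp add: sph_int_add continuous_on_sum)
qed

lemma sph_int_mono:
  fixes F G :: "real^'n \<Rightarrow> real"
  assumes "continuous_on (sphere 0 1) F" "continuous_on (sphere 0 1) G"
    and "\<And>x. norm x = 1 \<Longrightarrow> F x \<le> G x"
  shows "sph_int F \<le> sph_int G"
  unfolding sph_int_eq_pball[OF assms(1)] sph_int_eq_pball[OF assms(2)]
  by (intro mult_left_mono integral_le set_lebesgue_integral_eq_integral(1)[OF abs_integrable_sphere] assms) auto

lemma sph_int_tendsto:
  fixes F :: "nat \<Rightarrow> real^'n \<Rightarrow> real"
  assumes F: "\<And>m. continuous_on (sphere 0 1) (F m)" and G: "continuous_on (sphere 0 1) G"
    and lim: "\<And>x. norm x = 1 \<Longrightarrow> (\<lambda>m. F m x) \<longlonglongrightarrow> G x"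
    and bound: "\<And>m x. norm x = 1 \<Longrightarrow> \<bar>F m x\<bar> \<le> C"
  shows "(\<lambda>m. sph_int (F m)) \<longlonglongrightarrow> sph_int G"
proof -
  have "(\<lambda>m. integral pball (\<lambda>y. F m (y /\<^sub>R norm y))) \<longlonglongrightarrow> integral pball (\<lambda>y. G (y /\<^sub>R norm y))"
  proof (rule dominated_convergence(2))
    show "(\<lambda>y. F m (y /\<^sub>R norm y)) integrable_on pball" for m
      by (rule set_lebesgue_integral_eq_integral(1)[OF abs_integrable_sphere[OF F]])
    show "(\<lambda>_. C) integrable_on (pball :: (real^'n) set)"
      using pball_lmeasurable by (rule integrable_on_const)
  qed (use lim bound in auto)
  then show ?thesis
    unfolding sph_int_eq_pball[OF F] sph_int_eq_pball[OF G] by (intro tendsto_intros)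
qed

text \<open>The set where the radial extension is nonzero is negligible, as the integral vanishes,
  and open, by continuity; hence it is empty. The value at \<open>x\<close> is read off at the point
  \<open>x/2\<close> of its ray.\<close>

lemma sph_int_nonneg_eq_0:
  fixes F :: "real^'n \<Rightarrow> real"
  assumes F: "continuous_on (sphere 0 1) F" and nn: "\<And>x. norm x = 1 \<Longrightarrow> F x \<ge> 0"
    and le: "sph_int F \<le> 0" and x: "norm x = 1"
  shows "F x = 0"
proof -
  let ?f = "\<lambda>y. F (y /\<^sub>R norm y)"
  have i: "?f integrable_on pball"
    by (rule set_lebesgue_integral_eq_integral(1)[OF abs_integrable_sphere[OF F]])
  have "integral pball ?f \<ge> 0"
    by (rule integral_nonneg[OF i]) (use nn in auto)
  moreover have "real CARD('n) > 0" by simp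
  ultimately have int0: "integral pball ?f = 0"
    using le unfolding sph_int_eq_pball[OF F] by (meson mult_pos_pos not_le order_le_less)
  have "negligible {y \<in> pball. ?f y \<noteq> 0}"
  proof -
    have ai: "?f absolutely_integrable_on pball" by (rule abs_integrable_sphere[OF F])
    have "integral\<^sup>L lebesgue (\<lambda>y. indicator pball y *\<^sub>R ?f y) = 0"
      using set_lebesgue_integral_eq_integral(2)[OF ai] int0 by (simp add: set_lebesgue_integral_def)
    moreover have "0 \<le> indicator pball y *\<^sub>R ?f y" for y
      by (auto simp: indicator_def intro!: nn)
    ultimately have "AE y in lebesgue. indicator pball y *\<^sub>R ?f y = 0"
      using ai by (subst (asm) integral_nonneg_eq_0_iff_AE) (auto simp: set_integrable_def)
    then have "{y \<in> space lebesgue. \<not> indicator pball y *\<^sub>R ?f y = 0} \<in> null_sets lebesgue"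
      by (simp only: completion.AE_iff_null_sets)
    moreover have "{y \<in> space lebesgue. \<not> indicator pball y *\<^sub>R ?f y = 0} = {y \<in> pball. ?f y \<noteq> 0}"
      by (auto simp: indicator_def)
    ultimately show ?thesis by (simp add: negligible_iff_null_sets)
  qed
  moreover have "open {y \<in> pball. ?f y \<noteq> 0}"
  proof -
    have "open (pball \<inter> ?f -` (- {0}))"
      by (rule continuous_open_preimage)
         (auto intro!: continuous_on_subset[OF continuous_on_sphere_extend[OF F]])
    also have "pball \<inter> ?f -` (- {0}) = {y \<in> pball. ?f y \<noteq> 0}" by auto
    finally show ?thesis .
  qed
  ultimately have "{y \<in> pball. ?f y \<noteq> 0} = {}"
    using open_not_negligible by blast
  moreover have "(1/2) *\<^sub>R x \<in> pball" using x by auto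
  ultimately have "?f ((1/2) *\<^sub>R x) = 0" by blast
  then show ?thesis using x by simp
qed

corollary change_of_variables_finite_real:
  fixes f :: "real^'n \<Rightarrow> real" and g :: "real^'n \<Rightarrow> real^'n"
  assumes S: "S \<in> sets lebesgue"
    and der_g: "\<And>x. x \<in> S \<Longrightarrow> (g has_derivative g' x) (at x within S)"
    and inj: "inj_on g S"
    and ai: "(\<lambda>x. \<bar>det (matrix (g' x))\<bar> * f (g x)) absolutely_integrable_on S"
  shows "f absolutely_integrable_on g ` S"
    and "integral (g ` S) f = integral S (\<lambda>x. \<bar>det (matrix (g' x))\<bar> * f (g x))"
proof -
  let ?f = "\<lambda>x. vec (f x) :: real^1"
  have ai': "(\<lambda>x. \<bar>det (matrix (g' x))\<bar> *\<^sub>R ?f (g x)) absolutely_integrable_on S"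
    using ai by (simp add: absolutely_integrable_on_1_iff)
  note c = change_of_variables_finite[where g' = g' and f = ?f, OF S der_g inj ai']
  show "f absolutely_integrable_on g ` S"
    using c(1) by (simp add: absolutely_integrable_on_1_iff)
  show "integral (g ` S) f = integral S (\<lambda>x. \<bar>det (matrix (g' x))\<bar> * f (g x))"
    using c(2) c(1)[THEN set_lebesgue_integral_eq_integral(1)] ai'[THEN set_lebesgue_integral_eq_integral(1)]
    by (simp add: integral_on_1_eq vec_eq_iff integrable_on_1_iff)
qed

lemma norm_has_derivative:
  "y \<noteq> 0 \<Longrightarrow> (norm has_derivative (\<lambda>v. sgn y \<bullet> v)) (at (y :: 'a::real_inner))"
  using GDERIV_norm[of y] by (simp add: gderiv_def inner_commute)

text \<open>Radial moments without polar coordinates. The map that multiplies \<open>y\<close> by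
  \<open>norm y powr (1/n)\<close> preserves the ball and all directions, and its Jacobian is
  \<open>(1 + 1/n) * norm y\<close>, so the weight \<open>norm y\<close> is absorbed by a change of
  variables.\<close>

lemma integral_pball_norm:
  fixes F :: "real^'n \<Rightarrow> real"
  assumes F: "continuous_on (sphere 0 1) F"
  shows "(\<lambda>y. norm y * F (y /\<^sub>R norm y)) absolutely_integrable_on pball"
    and "integral pball (\<lambda>y. norm y * F (y /\<^sub>R norm y))
      = real CARD('n) / (real CARD('n) + 1) * integral pball (\<lambda>y. F (y /\<^sub>R norm y))"
proof -
  let ?f = "\<lambda>y. F (y /\<^sub>R norm y)"
  obtain C where C: "\<And>x. x \<in> sphere 0 1 \<Longrightarrow> norm (F x) \<le> C" using sphere_bounded[OF F] by blast
  show ai: "(\<lambda>y. norm y * ?f y) absolutely_integrable_on pball"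
  proof (rule abs_integrable_pball[of _ C])
    show "continuous_on pball (\<lambda>y. norm y * ?f y)"
      by (intro continuous_intros continuous_on_subset[OF continuous_on_sphere_extend[OF F]]) auto
    fix y :: "real^'n" assume y: "y \<in> pball"
    then have "norm y * \<bar>?f y\<bar> \<le> 1 * C"
      using C[of "y /\<^sub>R norm y"] by (intro mult_mono) auto
    then show "norm (norm y * ?f y) \<le> C" by (simp add: abs_mult)
  qed
  define s where "s = 1 / real CARD('n)"
  have s: "s > 0" by (simp add: s_def)
  let ?g = "\<lambda>y::real^'n. (norm y powr s) *\<^sub>R y"
  let ?g' = "\<lambda>(y::real^'n) v. (norm y powr s) *\<^sub>R (v + (sgn y \<bullet> v) *\<^sub>R (s *\<^sub>R sgn y))"
  have der: "(?g has_derivative ?g' y) (at y within pball)" if "y \<in> pball" for y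
  proof -
    have y: "y \<noteq> 0" using that by auto
    have "((\<lambda>y. norm y powr s) has_derivative (\<lambda>v. s * norm y powr (s - 1) * (sgn y \<bullet> v))) (at y)"
      using y by (auto intro!: derivative_eq_intros norm_has_derivative simp: powr_diff field_simps)
    then have "(?g has_derivative (\<lambda>v. norm y powr s *\<^sub>R v + (s * norm y powr (s - 1) * (sgn y \<bullet> v)) *\<^sub>R y)) (at y)"
      by (rule has_derivative_scaleR[OF _ has_derivative_ident])
    also have "(\<lambda>v. norm y powr s *\<^sub>R v + (s * norm y powr (s - 1) * (sgn y \<bullet> v)) *\<^sub>R y) = ?g' y"
      using y by (auto simp: fun_eq_iff sgn_div_norm powr_diff field_simps)
    finally show ?thesis by (rule has_derivative_at_withinI)
  qed
  have det: "det (matrix (?g' y)) = (1 + s) * norm y" if "y \<in> pball" for y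
  proof -
    have y: "y \<noteq> 0" using that by auto
    have "linear (\<lambda>v. v + (sgn y \<bullet> v) *\<^sub>R (s *\<^sub>R sgn y))"
      by (auto intro!: linearI simp: algebra_simps inner_add_right)
    then have "det (matrix (?g' y)) = (norm y powr s) ^ CARD('n) * (1 + sgn y \<bullet> (s *\<^sub>R sgn y))"
      by (simp only: det_matrix_scale det_one_plus_rank_one)
    moreover have "(norm y powr s) ^ CARD('n) = norm y"
      using y by (simp add: powr_powr s_def flip: powr_realpow)
    moreover have "sgn y \<bullet> sgn y = 1" using y by (simp add: norm_sgn flip: norm_eq_1)
    ultimately show ?thesis by simp
  qed
  have norm_g: "norm (?g y) = norm y powr (1 + s)" if "y \<noteq> 0" for y
    using that by (simp add: powr_add)
  have inj: "inj_on ?g pball"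
  proof
    fix y z assume yz: "y \<in> pball" "z \<in> pball" "?g y = ?g z"
    then have "norm y powr (1 + s) = norm z powr (1 + s)"
      using norm_g[of y] norm_g[of z] by auto
    then have "norm y = norm z"
      using s by (metis add_pos_pos norm_ge_zero powr_inj powr_less_mono2 linorder_less_linear less_irrefl zero_less_one)
    then show "y = z" using yz by auto
  qed
  have im: "?g ` pball = pball"
  proof
    show "?g ` pball \<subseteq> pball"
    proof safe
      fix y :: "real^'n" assume y: "y \<in> ball 0 1" "y \<noteq> 0"
      then have "norm y powr (1 + s) < 1" using s powr_less_mono2[of "1 + s" "norm y" 1] by auto
      then show "?g y \<in> ball 0 1" using norm_g[of y] y by simp
    qed auto
    show "pball \<subseteq> ?g ` pball"
    proof
      fix z :: "real^'n" assume z: "z \<in> pball"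
      \<comment> \<open>The map sends the radius \<open>r\<close> to \<open>r powr (1 + s)\<close>;
        this exponent undoes it.\<close>
      let ?y = "(norm z powr (- s / (1 + s))) *\<^sub>R z"
      have z0: "norm z > 0" using z by auto
      have "norm ?y = norm z powr (- s / (1 + s) + 1)" using z0 powr_add[of "norm z" "- s / (1 + s)" 1] by simp
      also have "- s / (1 + s) + 1 = 1 / (1 + s)" using s by (simp add: field_simps)
      finally have n: "norm ?y = norm z powr (1 / (1 + s))" .
      have "norm z powr (1 / (1 + s)) < 1" using z s powr_less_mono2[of "1 / (1 + s)" "norm z" 1] by auto
      then have yp: "?y \<in> pball" using n z by auto
      have gy: "?g ?y = z"
      proof -
        have "(norm z powr (1 / (1 + s))) powr s * norm z powr (- s / (1 + s))
            = norm z powr (1 / (1 + s) * s + - s / (1 + s))"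
          by (simp only: powr_powr powr_add)
        also have "1 / (1 + s) * s + - s / (1 + s) = 0" by simp
        finally have e: "(norm z powr (1 / (1 + s))) powr s * norm z powr (- s / (1 + s)) = 1"
          using z0 by simp
        have "?g ?y = ((norm ?y powr s) * (norm z powr (- s / (1 + s)))) *\<^sub>R z"
          by (simp only: scaleR_scaleR)
        also have "\<dots> = z" by (simp only: n e scaleR_one)
        finally show ?thesis .
      qed
      show "z \<in> ?g ` pball" using imageI[OF yp, of ?g] unfolding gy .
    qed
  qed
  have sets: "pball \<in> sets (lebesgue :: (real^'n) measure)"
    using pball_lmeasurable by (auto simp: fmeasurable_def)
  have eq: "\<bar>det (matrix (?g' y))\<bar> * ?f (?g y) = (1 + s) * (norm y * ?f y)" if "y \<in> pball" for y
  proof -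
    have "?g y /\<^sub>R norm (?g y) = y /\<^sub>R norm y" using that by simp
    then show ?thesis using s by (simp only: det[OF that]) simp
  qed
  have "(\<lambda>y. (1 + s) * (norm y * ?f y)) absolutely_integrable_on pball"
    using ai by (rule set_integrable_mult_right)
  then have "(\<lambda>y. \<bar>det (matrix (?g' y))\<bar> * ?f (?g y)) absolutely_integrable_on pball"
    by (rule absolutely_integrable_spike[OF _ negligible_empty]) (use eq in blast)
  from change_of_variables_finite_real(2)[where f = ?f and g' = ?g', OF sets der inj this]
  have "integral pball ?f = integral pball (\<lambda>y. \<bar>det (matrix (?g' y))\<bar> * ?f (?g y))"
    unfolding im .
  also have "\<dots> = integral pball (\<lambda>y. (1 + s) * (norm y * ?f y))"
    by (rule integral_cong) (rule eq)
  finally have "integral pball ?f = (1 + s) * integral pball (\<lambda>y. norm y * ?f y)" by simp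
  then show "integral pball (\<lambda>y. norm y * ?f y) = real CARD('n) / (real CARD('n) + 1) * integral pball ?f"
    by (simp add: s_def field_simps)
qed

section \<open>Integration by parts on the boundary of a convex body\<close>

text \<open>Maps on the sphere are represented by their 0-homogeneous extensions.\<close>

definition C1_hom0 :: "(real^'n \<Rightarrow> real^'m) \<Rightarrow> (real^'n \<Rightarrow> real^'n \<Rightarrow> real^'m) \<Rightarrow> bool" where
  "C1_hom0 w W \<longleftrightarrow> (\<forall>y. y \<noteq> 0 \<longrightarrow> (w has_derivative W y) (at y)) \<and>
     (\<forall>v. continuous_on (- {0}) (\<lambda>y. W y v)) \<and> (\<forall>c y. 0 < c \<longrightarrow> w (c *\<^sub>R y) = w y)"

lemma C1_hom0D:
  assumes "C1_hom0 w W"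
  shows "y \<noteq> 0 \<Longrightarrow> (w has_derivative W y) (at y)" "continuous_on (- {0}) (\<lambda>y. W y v)"
    "0 < c \<Longrightarrow> w (c *\<^sub>R y) = w y" "y \<noteq> 0 \<Longrightarrow> linear (W y)"
  using assms by (auto simp: C1_hom0_def has_derivative_linear)

lemma C1_hom0_continuous:
  assumes "C1_hom0 w W"
  shows "continuous_on (- {0}) w"
  by (intro continuous_at_imp_continuous_on ballI has_derivative_continuous[OF C1_hom0D(1)[OF assms]]) auto

lemma matrix_works_real: "linear f \<Longrightarrow> matrix f *v x = f (x :: real^'n)"
  by (simp add: matrix_works linear_matrix_vector_mul_eq)

lemma C1_hom0_normalize:
  assumes "C1_hom0 w W" "y \<noteq> 0"
  shows "w (y /\<^sub>R norm y) = w y"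
  using C1_hom0D(3)[OF assms(1), of "inverse (norm y)" y] assms(2) by simp

text \<open>Differentiating \<open>w (c *\<^sub>R y) = w y\<close> in \<open>y\<close> shows that
  the derivative is homogeneous of degree -1, so its values on the sphere determine it.\<close>

lemma C1_hom0_derivative_scale:
  assumes w: "C1_hom0 w W" and c: "0 < c" and y: "y \<noteq> 0"
  shows "W (c *\<^sub>R y) v = (1 / c) *\<^sub>R W y v"
proof -
  have "((\<lambda>z. c *\<^sub>R z) has_derivative (\<lambda>v. c *\<^sub>R v)) (at y)"
    by (rule bounded_linear_imp_has_derivative[OF bounded_linear_scaleR_right])
  from has_derivative_compose[OF this C1_hom0D(1)[OF w]] c y
  have "((\<lambda>z. w (c *\<^sub>R z)) has_derivative (\<lambda>v. W (c *\<^sub>R y) (c *\<^sub>R v))) (at y)" by simp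
  moreover have "(\<lambda>z. w (c *\<^sub>R z)) = w" using C1_hom0D(3)[OF w c] by auto
  ultimately have "(\<lambda>v. W (c *\<^sub>R y) (c *\<^sub>R v)) = W y"
    using has_derivative_unique[OF _ C1_hom0D(1)[OF w y]] by simp
  then have "W (c *\<^sub>R y) (c *\<^sub>R ((1/c) *\<^sub>R v)) = W y ((1/c) *\<^sub>R v)" by (metis)
  moreover have "W y ((1/c) *\<^sub>R v) = (1/c) *\<^sub>R W y v"
    using C1_hom0D(4)[OF w y] by (rule linear_scale)
  ultimately show ?thesis using c by simp
qed

lemma C1_hom0_derivative_radial:
  assumes w: "C1_hom0 w W" and y: "y \<noteq> 0"
  shows "W y y = 0"
proof -
  have "((\<lambda>t::real. t *\<^sub>R y) has_derivative (\<lambda>t. t *\<^sub>R y)) (at 1)"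
    by (rule bounded_linear_imp_has_derivative[OF bounded_linear_scaleR_left])
  from has_derivative_compose[OF this C1_hom0D(1)[OF w]] y
  have "((\<lambda>t::real. w (t *\<^sub>R y)) has_derivative (\<lambda>t. W (1 *\<^sub>R y) (t *\<^sub>R y))) (at 1)" by simp
  moreover have "((\<lambda>t::real. w (t *\<^sub>R y)) has_derivative (\<lambda>t. 0)) (at 1)"
  proof (rule has_derivative_transform_within_open[OF has_derivative_const[of "w y"] open_greaterThan[of 0]])
    show "w y = w (t *\<^sub>R y)" if "t \<in> {0<..}" for t :: real
      using C1_hom0D(3)[OF w, of t y] that by simp
  qed auto
  ultimately have "(\<lambda>t. W (1 *\<^sub>R y) (t *\<^sub>R y)) = (\<lambda>t::real. 0)"
    by (rule has_derivative_unique)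
  then have "W (1 *\<^sub>R y) (1 *\<^sub>R y) = 0" by metis
  then show ?thesis by simp
qed

lemma C1_hom0_uminus:
  assumes "C1_hom0 w W"
  shows "C1_hom0 (\<lambda>y. - w y) (\<lambda>y v. - W y v)"
  using assms by (auto simp: C1_hom0_def intro!: has_derivative_minus continuous_on_minus)

text \<open>The field \<open>w\<close> need not be continuous at the origin, but it is bounded by
  its values on the compact sphere, so a factor that vanishes there restores continuity.\<close>

lemma continuous_on_cone:
  fixes w :: "real^'n \<Rightarrow> real^'m"
  assumes w: "C1_hom0 w W" and \<phi>: "continuous_on UNIV \<phi>" "\<phi> 0 = 0"
  shows "continuous_on UNIV (\<lambda>y. \<phi> (norm y) *\<^sub>R w y)"
proof -
  obtain C where C: "\<And>x. x \<in> sphere 0 1 \<Longrightarrow> norm (w x) \<le> C"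
    using sphere_bounded[of w] C1_hom0_continuous[OF w] continuous_on_subset[of "- {0}" w "sphere 0 1"] by force
  have C': "norm (w y) \<le> C" if "y \<noteq> 0" for y
    using C[of "y /\<^sub>R norm y"] C1_hom0_normalize[OF w that] that by simp
  have lim: "((\<lambda>y. \<phi> (norm y) *\<^sub>R w y) \<longlongrightarrow> 0) (at 0)"
  proof (rule tendsto_0_le[where K = C])
    have "isCont \<phi> (norm (0::real^'n))"
      using \<phi>(1) by (simp add: continuous_on_eq_continuous_at)
    moreover have "((\<lambda>y::real^'n. norm y) \<longlongrightarrow> norm (0::real^'n)) (at 0)"
      by (intro tendsto_norm tendsto_ident_at)
    ultimately have "((\<lambda>y::real^'n. \<phi> (norm y)) \<longlongrightarrow> \<phi> (norm (0::real^'n))) (at 0)"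
      by (rule isCont_tendsto_compose)
    then show "((\<lambda>y::real^'n. \<phi> (norm y)) \<longlongrightarrow> 0) (at 0)" using \<phi>(2) by simp
    show "\<forall>\<^sub>F y in at 0. norm (\<phi> (norm y) *\<^sub>R w y) \<le> norm (\<phi> (norm y)) * C"
      using C' by (auto simp: eventually_at_filter intro!: mult_left_mono always_eventually)
  qed
  have "continuous_on (- {0}) (\<lambda>y. \<phi> (norm y) *\<^sub>R w y)"
    by (intro continuous_intros C1_hom0_continuous[OF w] continuous_on_compose2[OF \<phi>(1)]) auto
  then have i1: "isCont (\<lambda>y. \<phi> (norm y) *\<^sub>R w y) y" if "y \<noteq> 0" for y
    using that by (subst (asm) continuous_on_eq_continuous_at) auto
  have i2: "isCont (\<lambda>y. \<phi> (norm y) *\<^sub>R w y) 0"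
    using lim \<phi>(2) by (simp add: isCont_def)
  show ?thesis
  proof (intro continuous_at_imp_continuous_on ballI)
    show "isCont (\<lambda>y. \<phi> (norm y) *\<^sub>R w y) y" for y
      by (cases "y = 0") (simp_all only: i1 i2 not_False_eq_True)
  qed
qed

text \<open>The map \<open>X\<close> stands for the inverse Gauss map, extended with degree 0, and
  \<open>A\<close> for its derivative, which is tangential to the supporting hyperplanes. The
  assumptions are stated abstractly because they are instantiated twice: with the support point of
  the given body, and with \<open>sgn\<close> on the unit ball.\<close>

locale gauss_param =
  fixes K :: "(real^'n) set" and X :: "real^'n \<Rightarrow> real^'n" and A :: "real^'n \<Rightarrow> real^'n \<Rightarrow> real^'n"
  assumes convex: "convex K" and compact: "compact K"
    and X: "C1_hom0 X A"
    and A_orth: "norm x = 1 \<Longrightarrow> x \<bullet> A x v = 0"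
    and h_pos: "norm x = 1 \<Longrightarrow> 0 < x \<bullet> X x"
    and D1_pos: "norm x = 1 \<Longrightarrow> 0 < det (matrix (\<lambda>v. A x v + (x \<bullet> v) *\<^sub>R x))"
    and inj: "inj_on (\<lambda>y. norm y *\<^sub>R X y) (cball 0 1)"
    and im_cball: "(\<lambda>y. norm y *\<^sub>R X y) ` cball 0 1 = K"
    and im_sphere: "(\<lambda>y. norm y *\<^sub>R X y) ` sphere 0 1 = frontier K"
begin

abbreviation T :: "real^'n \<Rightarrow> real^'n" where "T y \<equiv> norm y *\<^sub>R X y"

text \<open>As \<open>T\<close> is homogeneous of degree 1, its derivative is constant along rays,
  and \<open>J x\<close> is the Jacobian matrix of \<open>T\<close> at every point of the open ray
  through the unit vector \<open>x\<close>.\<close>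

definition J :: "real^'n \<Rightarrow> real^'n^'n" where
  "J x = matrix (\<lambda>v. A x v + (x \<bullet> v) *\<^sub>R X x)"

definition d1 :: "real^'n \<Rightarrow> real" where
  "d1 x = det (matrix (\<lambda>v. A x v + (x \<bullet> v) *\<^sub>R x))"

lemma A_linear: "y \<noteq> 0 \<Longrightarrow> linear (A y)"
  by (rule C1_hom0D(4)[OF X])

lemma det_J: "norm x = 1 \<Longrightarrow> det (J x) = (x \<bullet> X x) * d1 x"
  unfolding J_def d1_def using A_orth[of x]
  by (subst det_plus_rank_one) (auto simp: inner_commute intro: A_linear)

lemma det_J_pos: "norm x = 1 \<Longrightarrow> 0 < det (J x)"
  using h_pos[of x] D1_pos[of x] by (simp add: det_J d1_def)

lemma continuous_on_T: "continuous_on UNIV T"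
  using continuous_on_cone[OF X, of "\<lambda>r. r"] by simp

text \<open>The derivative of the field \<open>(norm y - (norm y)\<^sup>2) *\<^sub>R w y\<close> at
  radius \<open>r\<close> and direction \<open>x\<close>. The second coefficient is
  \<open>1 - r\<close> rather than \<open>r - r\<^sup>2\<close> because \<open>W\<close> has degree
  -1.\<close>

definition E :: "(real^'n \<Rightarrow> real^'n) \<Rightarrow> (real^'n \<Rightarrow> real^'n \<Rightarrow> real^'n) \<Rightarrow> real \<Rightarrow> real^'n \<Rightarrow> real^'n^'n" where
  "E w W r x = (1 - 2 * r) *\<^sub>R matrix (\<lambda>v. (x \<bullet> v) *\<^sub>R w x) + (1 - r) *\<^sub>R matrix (W x)"

text \<open>The weight vanishes for norm 0 and norm 1, so that \<^term>\<open>Tt w t\<close> and \<^term>\<open>T\<close> agree on the unit sphere.\<close>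

definition Tt :: "(real^'n \<Rightarrow> real^'n) \<Rightarrow> real \<Rightarrow> real^'n \<Rightarrow> real^'n" where
  "Tt w t y = T y + (t * (norm y - (norm y)\<^sup>2)) *\<^sub>R w y"

definition Tt' :: "(real^'n \<Rightarrow> real^'n) \<Rightarrow> (real^'n \<Rightarrow> real^'n \<Rightarrow> real^'n) \<Rightarrow> real \<Rightarrow> real^'n \<Rightarrow> real^'n \<Rightarrow> real^'n" where
  "Tt' w W t y v = (J (y /\<^sub>R norm y) + t *\<^sub>R E w W (norm y) (y /\<^sub>R norm y)) *v v"

lemma Tt_has_derivative:
  assumes w: "C1_hom0 w W" and y: "y \<noteq> 0"
  shows "(Tt w t has_derivative Tt' w W t y) (at y)"
proof -
  let ?x = "y /\<^sub>R norm y"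
  have r: "norm y > 0" using y by simp
  have x: "sgn y = ?x" "norm ?x = 1" using y by (auto simp: sgn_div_norm)
  have Ay: "A y v = (1 / norm y) *\<^sub>R A ?x v" for v
    using C1_hom0_derivative_scale[OF X, of "norm y" ?x v] y by simp
  have Wy: "W y v = (1 / norm y) *\<^sub>R W ?x v" for v
    using C1_hom0_derivative_scale[OF w, of "norm y" ?x v] y by simp
  have wx: "w ?x = w y" "X ?x = X y"
    using C1_hom0_normalize[OF w y] C1_hom0_normalize[OF X y] by auto
  have lin: "linear (\<lambda>v. A ?x v + (?x \<bullet> v) *\<^sub>R X y)" "linear (\<lambda>v. (?x \<bullet> v) *\<^sub>R w y)" "linear (W ?x)"
    using A_linear[of ?x] C1_hom0D(4)[OF w, of ?x] y
    by (auto intro!: linearI simp: linear_add linear_scale algebra_simps inner_add_right)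
  have "(Tt w t has_derivative (\<lambda>v. norm y *\<^sub>R A y v + (sgn y \<bullet> v) *\<^sub>R X y
      + ((t * (norm y - (norm y)\<^sup>2)) *\<^sub>R W y v + (t * (sgn y \<bullet> v - 2 * (y \<bullet> v))) *\<^sub>R w y))) (at y)"
    unfolding Tt_def
    by (auto intro!: derivative_eq_intros norm_has_derivative C1_hom0D(1)[OF X] C1_hom0D(1)[OF w] y
        simp: algebra_simps)
  also have "(\<lambda>v. norm y *\<^sub>R A y v + (sgn y \<bullet> v) *\<^sub>R X y
      + ((t * (norm y - (norm y)\<^sup>2)) *\<^sub>R W y v + (t * (sgn y \<bullet> v - 2 * (y \<bullet> v))) *\<^sub>R w y)) = Tt' w W t y"
  proof
    fix v
    have n: "(norm y - (norm y)\<^sup>2) * (1 / norm y) = 1 - norm y"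
      using r by (simp add: field_simps power2_eq_square)
    have T': "Tt' w W t y v = A ?x v + (?x \<bullet> v) *\<^sub>R X y + t *\<^sub>R ((1 - 2 * norm y) *\<^sub>R ((?x \<bullet> v) *\<^sub>R w y) + (1 - norm y) *\<^sub>R W ?x v)"
      unfolding Tt'_def J_def E_def wx
      by (simp only: matrix_vector_mult_add_rdistrib scaleR_matrix_vector_assoc[symmetric] matrix_works_real[OF lin(1)] matrix_works_real[OF lin(2)] matrix_works_real[OF lin(3)])
    have a1: "norm y *\<^sub>R A y v = A ?x v" using r by (simp add: Ay)
    have a2: "(t * (norm y - (norm y)\<^sup>2)) *\<^sub>R W y v = (t * (1 - norm y)) *\<^sub>R W ?x v"
      unfolding Wy scaleR_scaleR n[symmetric] by (simp only: mult.assoc)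
    have a3: "y \<bullet> v = norm y * (?x \<bullet> v)" using r by simp
    have alg: "a + b + ((t * (1 - r)) *\<^sub>R W' + (t * (c - 2 * (r * c))) *\<^sub>R w')
        = a + b + t *\<^sub>R ((1 - 2 * r) *\<^sub>R (c *\<^sub>R w') + (1 - r) *\<^sub>R W')" for a b W' w' :: "real^'n" and r c
      by (simp add: algebra_simps)
    show "norm y *\<^sub>R A y v + (sgn y \<bullet> v) *\<^sub>R X y
      + ((t * (norm y - (norm y)\<^sup>2)) *\<^sub>R W y v + (t * (sgn y \<bullet> v - 2 * (y \<bullet> v))) *\<^sub>R w y) = Tt' w W t y v"
      unfolding x(1) a1 a2 a3 T' by (rule alg)
  qed
  finally show ?thesis .
qed

text \<open>If a point of the interior were missed, retracting onto the frontier of \<^term>\<open>K\<close> and applying the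
  inverse of \<^term>\<open>T\<close> would give a retraction of the ball onto the sphere.\<close>

lemma Tt_covers:
  assumes w: "C1_hom0 w W"
  shows "K \<subseteq> Tt w t ` pball \<union> insert 0 (frontier K)"
proof -
  have "interior K \<subseteq> Tt w t ` cball 0 1"
  proof (rule ccontr)
    assume "\<not> interior K \<subseteq> Tt w t ` cball 0 1"
    then obtain p where p: "p \<in> interior K" "p \<notin> Tt w t ` cball 0 1" by blast
    then have ne: "interior K \<noteq> {}" by auto
    have "rel_frontier K retract_of (affine hull K - {p})"
      by (rule rel_frontier_retract_of_punctured_affine_hull)
         (use p ne convex compact in \<open>auto simp: compact_imp_bounded rel_interior_nonempty_interior\<close>)
    then have "frontier K retract_of (- {p})"
      using ne by (simp add: affine_hull_nonempty_interior rel_frontier_nonempty_interior Compl_eq_Diff_UNIV)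
    then obtain \<rho> where \<rho>: "continuous_on (- {p}) \<rho>" "\<rho> \<in> (- {p}) \<rightarrow> frontier K" "\<And>z. z \<in> frontier K \<Longrightarrow> \<rho> z = z"
      by (auto simp: retract_of_def retraction_def)
    obtain S where S: "homeomorphism (cball 0 1) K T S"
      using homeomorphism_compact[OF compact_cball continuous_on_subset[OF continuous_on_T] im_cball inj] by auto
    then have ST: "S (T y) = y" if "y \<in> cball 0 1" for y
      using that unfolding homeomorphism_def by blast
    have Sfr: "S z \<in> sphere 0 1" if "z \<in> frontier K" for z
    proof -
      have "z \<in> T ` sphere 0 1" using that by (simp only: im_sphere)
      then obtain y where "y \<in> sphere 0 1" "z = T y" by (rule imageE)
      then show ?thesis using ST[of y] by (simp del: scaleR_scaleR)
    qed
    have cS: "continuous_on K S" using S unfolding homeomorphism_def by blast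
    have frK: "frontier K \<subseteq> K" using compact by (simp add: compact_imp_closed frontier_subset_closed)
    let ?q = "\<lambda>y. S (\<rho> (Tt w t y))"
    have cont: "continuous_on (cball 0 1) (Tt w t)"
    proof -
      have "continuous_on UNIV (\<lambda>y. (t * (norm y - (norm y)\<^sup>2)) *\<^sub>R w y)"
        using continuous_on_cone[OF w, of "\<lambda>r. t * (r - r\<^sup>2)"] by (simp add: continuous_intros)
      then show ?thesis
        unfolding Tt_def by (intro continuous_on_add continuous_on_subset[OF continuous_on_T]) (auto intro: continuous_on_subset)
    qed
    have "retraction (cball 0 1) (frontier (cball 0 1)) ?q"
      unfolding retraction_def
    proof (intro conjI ballI)
      have c1: "continuous_on (cball 0 1) (\<lambda>y. \<rho> (Tt w t y))"
        by (rule continuous_on_compose2[OF \<rho>(1) cont]) (use p in auto)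
      show "continuous_on (cball 0 1) ?q"
        by (rule continuous_on_compose2[OF cS c1]) (use \<rho>(2) frK p in \<open>auto simp: Pi_iff\<close>)
      show "?q \<in> cball 0 1 \<rightarrow> frontier (cball 0 1)"
        using Sfr \<rho>(2) p by (auto simp: Pi_iff)
      fix y :: "real^'n" assume y: "y \<in> frontier (cball 0 1)"
      then have "Tt w t y = T y" by (simp add: Tt_def)
      moreover have "T y \<in> frontier K" using y im_sphere by auto
      moreover have "S (T y) = y" using y by (intro ST) auto
      ultimately show "?q y = y" using \<rho>(3) by simp
    qed auto
    then show False
      using no_retraction_cball[of 1 "0::real^'n"] by (auto simp: retract_of_def)
  qed
  moreover have "K \<subseteq> interior K \<union> frontier K"
    by (auto simp: frontier_def intro: closure_subset[THEN subsetD])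
  moreover have "Tt w t ` cball 0 1 \<subseteq> Tt w t ` pball \<union> insert 0 (frontier K)"
  proof
    fix z assume "z \<in> Tt w t ` cball 0 1"
    then obtain y where y: "norm y \<le> 1" "z = Tt w t y" by auto
    consider "y = 0" | "norm y = 1" | "y \<in> pball" using y(1) by force
    then show "z \<in> Tt w t ` pball \<union> insert 0 (frontier K)"
    proof cases
      case 2
      then have "z = T y" by (simp add: y Tt_def)
      then show ?thesis using 2 im_sphere by auto
    qed (auto simp: y Tt_def)
  qed
  ultimately show ?thesis by blast
qed

end

lemma continuous_on_matrix:
  fixes M :: "'a::topological_space \<Rightarrow> real^'n^'m"
  assumes "\<And>i j. continuous_on S (\<lambda>x. M x $ i $ j)"
  shows "continuous_on S M"
proof -
  have "continuous_on S (\<lambda>x. \<chi> i j. M x $ i $ j)"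
    by (intro continuous_on_vec_lambda assms)
  then show ?thesis by simp
qed

lemma matrix_component_le_norm:
  fixes M :: "real^'n^'m"
  shows "\<bar>M $ i $ j\<bar> \<le> norm M"
  using component_le_norm_cart[of "M $ i" j] Finite_Cartesian_Product.norm_nth_le[of M i] by simp

lemma continuous_on_coeff2:
  fixes M :: "'a::topological_space \<Rightarrow> real^'n^'m"
  shows "continuous_on S M \<Longrightarrow> continuous_on S (\<lambda>x. M x $ i $ j)"
  by (intro continuous_intros)

lemma continuous_on_polar:
  assumes "continuous_on (sphere 0 1) F"
  shows "continuous_on pball (\<lambda>y::real^'n. F (y /\<^sub>R norm y))"
  by (rule continuous_on_subset[OF continuous_on_sphere_extend[OF assms]]) auto

lemma sphere_not_0: "sphere 0 1 \<subseteq> - {0 :: 'a::real_normed_vector}"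
  by auto

lemma C1_hom0_zero: "C1_hom0 (\<lambda>_. 0) (\<lambda>_ _. 0)"
  by (simp add: C1_hom0_def)

section \<open>Area formula for the Gauss parametrisation and first variation of the volume\<close>

context gauss_param
begin

lemma J_nth: "J x $ i $ j = A x (axis j 1) $ i + x $ j * X x $ i"
  by (simp add: J_def matrix_def inner_axis)

lemma continuous_on_J: "continuous_on (sphere 0 1) J"
  unfolding J_nth by (rule continuous_on_matrix, unfold J_nth)
   (intro continuous_intros continuous_on_subset[OF C1_hom0D(2)[OF X] sphere_not_0]
     continuous_on_subset[OF C1_hom0_continuous[OF X] sphere_not_0])

lemma continuous_on_det_J: "continuous_on (sphere 0 1) (\<lambda>x. det (J x))"
  by (intro continuous_on_det continuous_on_coeff2 continuous_on_J)

lemma continuous_on_d1: "continuous_on (sphere 0 1) d1"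
  unfolding d1_def
  by (rule continuous_on_det, simp add: matrix_def inner_axis)
    (intro continuous_intros continuous_on_subset[OF C1_hom0D(2)[OF X] sphere_not_0])

lemma continuous_on_rank_one:
  assumes w: "C1_hom0 w W"
  shows "continuous_on (sphere 0 1) (\<lambda>x. matrix (\<lambda>v. (x \<bullet> v) *\<^sub>R w x))"
  by (rule continuous_on_matrix, simp add: matrix_def inner_axis)
    (intro continuous_intros continuous_on_subset[OF C1_hom0_continuous[OF w] sphere_not_0])

lemma continuous_on_matrix_derivative:
  assumes w: "C1_hom0 w W"
  shows "continuous_on (sphere 0 1) (\<lambda>x. matrix (W x))"
  by (rule continuous_on_matrix, simp add: matrix_def)
    (intro continuous_intros continuous_on_subset[OF C1_hom0D(2)[OF w] sphere_not_0])

lemma continuous_on_E: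
  assumes w: "C1_hom0 w W"
  shows "continuous_on pball (\<lambda>y. E w W (norm y) (y /\<^sub>R norm y))"
  unfolding E_def
  by (intro continuous_intros continuous_on_polar[OF continuous_on_rank_one[OF w]]
     continuous_on_polar[OF continuous_on_matrix_derivative[OF w]])

text \<open>The bound holds up to the origin: the matrices depend on the direction, which ranges
  over a compact sphere, and the radial coefficients \<open>1 - 2 * r\<close> and
  \<open>1 - r\<close> stay in [-1, 1].\<close>

lemma JE_bounded:
  assumes w: "C1_hom0 w W"
  obtains B where "\<And>y i j. y \<in> pball \<Longrightarrow> \<bar>J (y /\<^sub>R norm y) $ i $ j\<bar> \<le> B"
    "\<And>y i j. y \<in> pball \<Longrightarrow> \<bar>E w W (norm y) (y /\<^sub>R norm y) $ i $ j\<bar> \<le> B"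
proof -
  let ?M1 = "\<lambda>x. matrix (\<lambda>v. (x \<bullet> v) *\<^sub>R w x)" and ?M2 = "\<lambda>x. matrix (W x)"
  obtain C0 where C0: "\<And>x. x \<in> sphere 0 1 \<Longrightarrow> norm (J x) \<le> C0"
    using sphere_bounded[OF continuous_on_J] by blast
  obtain C1 where C1: "\<And>x. x \<in> sphere 0 1 \<Longrightarrow> norm (?M1 x) \<le> C1"
    using sphere_bounded[OF continuous_on_rank_one[OF w]] by blast
  obtain C2 where C2: "\<And>x. x \<in> sphere 0 1 \<Longrightarrow> norm (?M2 x) \<le> C2"
    using sphere_bounded[OF continuous_on_matrix_derivative[OF w]] by blast
  show ?thesis
  proof
    fix y :: "real^'n" and i j assume y: "y \<in> pball"
    let ?x = "y /\<^sub>R norm y"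
    have x: "?x \<in> sphere 0 1" using y by simp
    show "\<bar>J ?x $ i $ j\<bar> \<le> max C0 (C1 + C2)"
      using C0[OF x] matrix_component_le_norm[of "J ?x" i j] by linarith
    have "norm (E w W (norm y) ?x) \<le> \<bar>1 - 2 * norm y\<bar> * norm (?M1 ?x) + \<bar>1 - norm y\<bar> * norm (?M2 ?x)"
      unfolding E_def by (rule order_trans[OF norm_triangle_ineq]) simp
    also have "\<dots> \<le> 1 * C1 + 1 * C2"
    proof -
      have "norm y < 1" using y by simp
      then have "\<bar>1 - 2 * norm y\<bar> \<le> 1" "\<bar>1 - norm y\<bar> \<le> 1" by (auto simp: abs_le_iff)
      then show ?thesis using C1[OF x] C2[OF x] by (intro add_mono mult_mono) auto
    qed
    finally show "\<bar>E w W (norm y) ?x $ i $ j\<bar> \<le> max C0 (C1 + C2)"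
      using matrix_component_le_norm[of "E w W (norm y) ?x" i j] by linarith
  qed
qed

abbreviation dt :: "(real^'n \<Rightarrow> real^'n) \<Rightarrow> (real^'n \<Rightarrow> real^'n \<Rightarrow> real^'n) \<Rightarrow> real \<Rightarrow> real^'n \<Rightarrow> real" where
  "dt w W t y \<equiv> det (J (y /\<^sub>R norm y) + t *\<^sub>R E w W (norm y) (y /\<^sub>R norm y))"

lemma det_Tt': "det (matrix (Tt' w W t y)) = dt w W t y"
proof -
  have "Tt' w W t y = (*v) (J (y /\<^sub>R norm y) + t *\<^sub>R E w W (norm y) (y /\<^sub>R norm y))"
    by (rule ext) (simp add: Tt'_def)
  then show ?thesis by simp
qed

lemma dt_lipschitz:
  assumes w: "C1_hom0 w W"
  obtains C where "\<And>y t. y \<in> pball \<Longrightarrow> \<bar>t\<bar> \<le> 1 \<Longrightarrow> \<bar>dt w W t y - det (J (y /\<^sub>R norm y))\<bar> \<le> C * \<bar>t\<bar>"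
proof -
  obtain B where B: "\<And>y i j. y \<in> pball \<Longrightarrow> \<bar>J (y /\<^sub>R norm y) $ i $ j\<bar> \<le> B"
    "\<And>y i j. y \<in> pball \<Longrightarrow> \<bar>E w W (norm y) (y /\<^sub>R norm y) $ i $ j\<bar> \<le> B"
    using JE_bounded[OF w] by blast
  obtain C where C: "\<And>(J :: real^'n^'n) E t. \<lbrakk>\<And>i j. \<bar>J $ i $ j\<bar> \<le> B; \<And>i j. \<bar>E $ i $ j\<bar> \<le> B; \<bar>t\<bar> \<le> 1\<rbrakk>
     \<Longrightarrow> \<bar>det (J + t *\<^sub>R E) - det J\<bar> \<le> C * \<bar>t\<bar>"
    using det_line_lipschitz by blast
  show ?thesis by (rule that[of C], rule C) (use B in auto)
qed

lemma dt_integrable: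
  assumes w: "C1_hom0 w W" and t: "\<bar>t\<bar> \<le> 1"
  shows "(\<lambda>y. \<bar>dt w W t y\<bar>) absolutely_integrable_on pball"
proof -
  obtain C where C: "\<And>y t. y \<in> pball \<Longrightarrow> \<bar>t\<bar> \<le> 1 \<Longrightarrow> \<bar>dt w W t y - det (J (y /\<^sub>R norm y))\<bar> \<le> C * \<bar>t\<bar>"
    using dt_lipschitz[OF w] by blast
  obtain D where D: "\<And>x. x \<in> sphere 0 1 \<Longrightarrow> norm (det (J x)) \<le> D"
    using sphere_bounded[OF continuous_on_det_J] by blast
  show ?thesis
  proof (rule abs_integrable_pball[of _ "D + C * \<bar>t\<bar>"])
    show "continuous_on pball (\<lambda>y. \<bar>dt w W t y\<bar>)"
      by (intro continuous_intros continuous_on_det continuous_on_coeff2 continuous_on_E[OF w]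
          continuous_on_polar[OF continuous_on_J])
    fix y :: "real^'n" assume y: "y \<in> pball"
    then show "norm \<bar>dt w W t y\<bar> \<le> D + C * \<bar>t\<bar>"
      using C[OF y t] D[of "y /\<^sub>R norm y"] by simp
  qed
qed

lemma pball_sets: "pball \<in> sets (lebesgue :: (real^'n) measure)"
  using pball_lmeasurable by (auto simp: fmeasurable_def)

lemma negligible_exceptional: "negligible (insert 0 (frontier K))"
  by (simp add: negligible_convex_frontier convex)

text \<open>The perturbed map covers \<open>K\<close> up to the origin and the frontier, both
  negligible. As it may fold, the determinant appears with its absolute value and only an inequality
  results.\<close>

lemma measure_K_le:
  assumes w: "C1_hom0 w W" and t: "\<bar>t\<bar> \<le> 1"
  shows "measure lebesgue K \<le> integral pball (\<lambda>y. \<bar>dt w W t y\<bar>)"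
proof -
  have der: "(Tt w t has_derivative Tt' w W t y) (at y within pball)" if "y \<in> pball" for y
    using Tt_has_derivative[OF w] that by (auto intro: has_derivative_at_withinI)
  have ai: "(\<lambda>y. \<bar>det (matrix (Tt' w W t y))\<bar>) absolutely_integrable_on pball"
    unfolding det_Tt' by (rule dt_integrable[OF w t])
  note m = measure_image_finite[OF pball_sets der ai]
  let ?N = "insert 0 (frontier K)"
  have N: "?N \<in> lmeasurable" using negligible_exceptional
    by (simp add: negligible_imp_measurable)
  have "measure lebesgue K \<le> measure lebesgue (Tt w t ` pball \<union> ?N)"
    by (rule measure_mono_fmeasurable[OF Tt_covers[OF w] _ fmeasurable.Un[OF m(1) N]])
       (use compact in \<open>simp add: lmeasurable_compact fmeasurableD\<close>)
  also have "\<dots> \<le> measure lebesgue (Tt w t ` pball) + measure lebesgue ?N"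
    by (rule measure_Un_le) (use m(1) N in auto)
  also have "measure lebesgue ?N = 0"
    using negligible_exceptional by (rule negligible_imp_measure0)
  finally show ?thesis using m(2) unfolding det_Tt' by simp
qed

text \<open>The unperturbed map is injective with positive Jacobian, so the change of variables is
  exact. Derivative and covering are obtained from the perturbed family with the zero field.\<close>

lemma area_formula:
  fixes f :: "real^'n \<Rightarrow> real^'k"
  assumes f: "continuous_on K f"
  shows "integral K f = integral pball (\<lambda>y. det (J (y /\<^sub>R norm y)) *\<^sub>R f (T y))"
proof -
  let ?g' = "Tt' (\<lambda>_. 0) (\<lambda>_ _. 0) 0"
  have T0: "Tt (\<lambda>_. 0) 0 = T" by (simp add: Tt_def fun_eq_iff)
  have det: "\<bar>det (matrix (?g' y))\<bar> = det (J (y /\<^sub>R norm y))" if "y \<in> pball" for y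
    using det_J_pos[of "y /\<^sub>R norm y"] that by (simp add: det_Tt')
  have der: "(T has_derivative ?g' y) (at y within pball)" if "y \<in> pball" for y
    using Tt_has_derivative[OF C1_hom0_zero, of y 0] that unfolding T0
    by (auto intro: has_derivative_at_withinI)
  have TK: "T y \<in> K" if "y \<in> cball 0 1" for y using that im_cball by blast
  obtain D where D: "\<And>x. x \<in> sphere 0 1 \<Longrightarrow> norm (det (J x)) \<le> D"
    using sphere_bounded[OF continuous_on_det_J] by blast
  obtain F where F: "\<And>z. z \<in> K \<Longrightarrow> norm (f z) \<le> F"
    using compact_imp_bounded[OF compact_continuous_image[OF f compact]] unfolding bounded_iff by (metis imageI)
  have "(\<lambda>y. det (J (y /\<^sub>R norm y)) *\<^sub>R f (T y)) absolutely_integrable_on pball"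
  proof (rule abs_integrable_pball[of _ "D * F"])
    show "continuous_on pball (\<lambda>y. det (J (y /\<^sub>R norm y)) *\<^sub>R f (T y))"
      by (intro continuous_on_scaleR continuous_on_polar[OF continuous_on_det_J]
          continuous_on_compose2[OF f continuous_on_subset[OF continuous_on_T]])
        (use TK in auto)
    fix y :: "real^'n" assume y: "y \<in> pball"
    then have d: "norm (det (J (y /\<^sub>R norm y))) \<le> D" and e: "norm (f (T y)) \<le> F"
      using D[of "y /\<^sub>R norm y"] F[OF TK[of y]] by auto
    show "norm (det (J (y /\<^sub>R norm y)) *\<^sub>R f (T y)) \<le> D * F"
      using mult_mono[OF d e order_trans[OF norm_ge_zero d] norm_ge_zero] by simp
  qed
  then have ai: "(\<lambda>y. \<bar>det (matrix (?g' y))\<bar> *\<^sub>R f (T y)) absolutely_integrable_on pball"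
    by (rule absolutely_integrable_spike[OF _ negligible_empty]) (use det in auto)
  have inj': "inj_on T pball" by (rule inj_on_subset[OF inj]) auto
  have "integral K f = integral (T ` pball) f"
  proof (rule integral_spike_set)
    have "K - T ` pball \<subseteq> insert 0 (frontier K)"
      using Tt_covers[OF C1_hom0_zero, of 0] unfolding T0 by blast
    then show "negligible {x \<in> K - T ` pball. f x \<noteq> 0}"
      by (intro negligible_subset[OF negligible_exceptional]) auto
    have "T ` pball - K = {}" using TK by auto
    then have e: "{x \<in> T ` pball - K. f x \<noteq> 0} = {}" by blast
    show "negligible {x \<in> T ` pball - K. f x \<noteq> 0}" unfolding e by (rule negligible_empty)
  qed
  also have "\<dots> = integral pball (\<lambda>y. \<bar>det (matrix (?g' y))\<bar> *\<^sub>R f (T y))"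
    by (rule change_of_variables_finite(2)[OF pball_sets der inj' ai])
  also have "\<dots> = integral pball (\<lambda>y. det (J (y /\<^sub>R norm y)) *\<^sub>R f (T y))"
    by (rule integral_cong) (simp only: det)
  finally show ?thesis .
qed

lemma measure_K_eq: "measure lebesgue K = integral pball (\<lambda>y. det (J (y /\<^sub>R norm y)))"
proof -
  have "integral K (\<lambda>x. vec 1 :: real^1) = integral pball (\<lambda>y. det (J (y /\<^sub>R norm y)) *\<^sub>R vec 1)"
    by (rule area_formula) (rule continuous_on_const)
  moreover have "(\<lambda>y. det (J (y /\<^sub>R norm y)) *\<^sub>R vec 1 :: real^1) = (\<lambda>y. vec (det (J (y /\<^sub>R norm y))))"
    by (simp add: vec_eq_iff fun_eq_iff)
  moreover have "(\<lambda>y. det (J (y /\<^sub>R norm y))) integrable_on pball"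
    by (rule set_lebesgue_integral_eq_integral(1)[OF abs_integrable_sphere[OF continuous_on_det_J]])
  moreover have "(\<lambda>x. 1::real) integrable_on K"
    using compact by (simp add: integrable_on_const lmeasurable_compact)
  ultimately have "integral K (\<lambda>x. 1::real) = integral pball (\<lambda>y. det (J (y /\<^sub>R norm y)))"
    by (simp add: integral_on_1_eq vec_eq_iff integrable_on_1_iff)
  then show ?thesis using compact by (simp add: lmeasure_integral lmeasurable_compact)
qed

lemma integral_K_ident:
  "integral K (\<lambda>z. z) = integral pball (\<lambda>y. det (J (y /\<^sub>R norm y)) *\<^sub>R T y)"
  by (rule area_formula) (rule continuous_on_id)

text \<open>The volume of \<^term>\<open>K\<close> is at most the integral of the Jacobian of \<^term>\<open>Tt w t\<close>, with equality at
  \<^term>\<open>t = (0::real)\<close>; this replaces integration by parts.\<close>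

lemma first_variation_nonneg:
  assumes w: "C1_hom0 w W"
  shows "0 \<le> integral pball (\<lambda>y. ddet (J (y /\<^sub>R norm y)) (E w W (norm y) (y /\<^sub>R norm y)))"
proof -
  let ?J = "\<lambda>y. J (y /\<^sub>R norm y)" and ?E = "\<lambda>y. E w W (norm y) (y /\<^sub>R norm y)"
  let ?t = "\<lambda>m. inverse (real (Suc m))"
  let ?G = "\<lambda>m y. (\<bar>dt w W (?t m) y\<bar> - \<bar>det (?J y)\<bar>) / ?t m"
  obtain C where C: "\<And>y t. y \<in> pball \<Longrightarrow> \<bar>t\<bar> \<le> 1 \<Longrightarrow> \<bar>dt w W t y - det (?J y)\<bar> \<le> C * \<bar>t\<bar>"
    using dt_lipschitz[OF w] by blast
  have t1: "\<bar>?t m\<bar> \<le> 1" for m by (simp add: inverse_le_1_iff)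
  have dJ: "(\<lambda>y. \<bar>det (?J y)\<bar>) integrable_on pball"
    by (rule set_lebesgue_integral_eq_integral(1)[OF abs_integrable_sphere[of "\<lambda>x. \<bar>det (J x)\<bar>"]])
       (intro continuous_intros continuous_on_det_J)
  have dE: "(\<lambda>y. \<bar>dt w W (?t m) y\<bar>) integrable_on pball" for m
    by (rule set_lebesgue_integral_eq_integral(1)[OF dt_integrable[OF w t1]])
  have pos: "det (?J y) > 0" if "y \<in> pball" for y
    using det_J_pos[of "y /\<^sub>R norm y"] that by simp
  have intG: "?G m integrable_on pball" for m
    using integrable_diff[OF dE dJ] by (rule integrable_on_divide)
  have ge: "0 \<le> integral pball (?G m)" for m
  proof -
    have "measure lebesgue K = integral pball (\<lambda>y. \<bar>det (?J y)\<bar>)"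
      unfolding measure_K_eq by (rule integral_cong) (use pos in \<open>simp add: abs_of_pos\<close>)
    then have "0 \<le> (integral pball (\<lambda>y. \<bar>dt w W (?t m) y\<bar>) - integral pball (\<lambda>y. \<bar>det (?J y)\<bar>)) / ?t m"
      using measure_K_le[OF w t1, of m] by simp
    also have "\<dots> = integral pball (?G m)"
      by (simp add: integral_diff[OF dE dJ] del: of_nat_Suc)
    finally show ?thesis .
  qed
  have "(\<lambda>m. integral pball (?G m)) \<longlonglongrightarrow> integral pball (\<lambda>y. ddet (?J y) (?E y))"
  proof (rule dominated_convergence(2)[OF intG])
    show "(\<lambda>_. C) integrable_on (pball :: (real^'n) set)"
      using pball_lmeasurable by (rule integrable_on_const)
    show "norm (?G m y) \<le> C" if y: "y \<in> pball" for m y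
    proof -
      have "\<bar>\<bar>dt w W (?t m) y\<bar> - \<bar>det (?J y)\<bar>\<bar> \<le> C * ?t m"
        using C[OF y t1, of m] by (intro order_trans[OF abs_triangle_ineq3]) simp
      moreover have t: "?t m > 0" by simp
      ultimately show ?thesis
        by (simp only: real_norm_def abs_divide abs_of_pos[OF t] pos_divide_le_eq[OF t])
    qed
    show "(\<lambda>m. ?G m y) \<longlonglongrightarrow> ddet (?J y) (?E y)" if y: "y \<in> pball" for y
    proof -
      let ?f = "\<lambda>t. det (?J y + t *\<^sub>R ?E y)"
      have D: "(?f has_real_derivative ddet (?J y) (?E y)) (at 0)"
        by (rule det_line_has_derivative_0)
      have "isCont ?f 0" using D by (rule DERIV_isCont)
      then have "(?f \<longlongrightarrow> ?f 0) (nhds 0)"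
        unfolding isCont_def by (subst (asm) tendsto_at_iff_tendsto_nhds)
      then have "\<forall>\<^sub>F t in nhds 0. ?f t > 0"
        by (rule order_tendstoD(1)) (use pos[OF y] in simp)
      then have ev: "\<forall>\<^sub>F t in nhds 0. \<bar>?f t\<bar> = ?f t"
        by eventually_elim simp
      have "((\<lambda>t. \<bar>?f t\<bar>) has_real_derivative ddet (?J y) (?E y)) (at 0)"
        using D DERIV_cong_ev[OF refl ev refl] by blast
      then have lim: "((\<lambda>h. (\<bar>?f (0 + h)\<bar> - \<bar>?f 0\<bar>) / h) \<longlongrightarrow> ddet (?J y) (?E y)) (at 0)"
        by (simp add: DERIV_def)
      have "filterlim ?t (at 0) sequentially"
        using LIMSEQ_inverse_real_of_nat by (simp add: filterlim_at del: of_nat_Suc)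
      from filterlim_compose[OF lim this] show ?thesis by (simp del: of_nat_Suc)
    qed
  qed
  then show ?thesis by (rule LIMSEQ_le_const) (use ge in auto)
qed

lemma E_uminus: "E (\<lambda>y. - w y) (\<lambda>y v. - W y v) r x = - E w W r x"
proof -
  have "matrix (\<lambda>v. (x \<bullet> v) *\<^sub>R (- w x)) = - matrix (\<lambda>v. (x \<bullet> v) *\<^sub>R w x)"
    "matrix (\<lambda>v. - W x v) = - matrix (W x)"
    by (simp_all add: matrix_def vec_eq_iff)
  then show ?thesis unfolding E_def by simp
qed

lemma ddet_uminus: "ddet M (- F) = - ddet M F"
  using ddet_scaleR[of M "-1" F] by simp

text \<open>The first variation is odd in \<open>w\<close> and nonnegative for \<open>w\<close> as
  well as for its negative.\<close>

lemma first_variation_zero: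
  assumes w: "C1_hom0 w W"
  shows "integral pball (\<lambda>y. ddet (J (y /\<^sub>R norm y)) (E w W (norm y) (y /\<^sub>R norm y))) = 0"
  using first_variation_nonneg[OF w] first_variation_nonneg[OF C1_hom0_uminus[OF w]]
  unfolding E_uminus ddet_uminus by simp

lemma trace_rank_one: "trace (M ** matrix (\<lambda>v. (x \<bullet> v) *\<^sub>R u)) = x \<bullet> (M *v u)" for M :: "real^'n^'n"
proof -
  have "trace (M ** matrix (\<lambda>v. (x \<bullet> v) *\<^sub>R u)) = (\<Sum>i\<in>UNIV. \<Sum>k\<in>UNIV. M $ i $ k * (x $ i * u $ k))"
    by (simp add: trace_def matrix_matrix_mult_def matrix_def inner_axis)
  also have "\<dots> = x \<bullet> (M *v u)"
    by (simp add: inner_vec_def matrix_vector_mult_def sum_distrib_left mult_ac)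
  finally show ?thesis .
qed

lemma J_mult: "norm x = 1 \<Longrightarrow> J x *v v = A x v + (x \<bullet> v) *\<^sub>R X x"
proof -
  assume "norm x = 1"
  then have "linear (A x)" by (intro A_linear) auto
  then show ?thesis unfolding J_def
    by (subst matrix_works_real) (auto intro!: linearI simp: linear_add linear_scale algebra_simps inner_add_right)
qed

text \<open>Solving \<open>J x *v u' = u\<close> and pairing with \<open>x\<close> removes the
  tangential part \<open>A\<close>, which gives the normal component of \<open>u'\<close> as
  \<open>(x \<bullet> u) / (x \<bullet> X x)\<close>. The denominator cancels against the factor
  \<open>x \<bullet> X x\<close> of \<open>det (J x)\<close>.\<close>

lemma ddet_rank_one:
  assumes x: "norm x = 1"
  shows "ddet (J x) (matrix (\<lambda>v. (x \<bullet> v) *\<^sub>R u)) = d1 x * (x \<bullet> u)"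
proof -
  let ?v = "matrix_inv (J x) *v u"
  have nz: "det (J x) \<noteq> 0" using det_J_pos[OF x] by simp
  have "J x *v ?v = u"
    by (simp add: matrix_vector_mul_assoc matrix_inv_inverse[OF nz])
  then have "x \<bullet> u = x \<bullet> (A x ?v + (x \<bullet> ?v) *\<^sub>R X x)"
    by (simp add: J_mult[OF x])
  then have "x \<bullet> u = (x \<bullet> ?v) * (x \<bullet> X x)"
    by (simp add: inner_add_right A_orth[OF x])
  then show ?thesis
    by (simp add: ddet_eq_trace[OF nz] trace_rank_one det_J[OF x])
qed

text \<open>Inserting \<open>E\<close>, the vanishing first variation is the integral of (1 - 2r) a
  + (1 - r) b, where a and b depend on the direction only. Each factor r contributes n/(n+1), and
  the resulting linear relation is b = (n - 1) a for the integrals.\<close>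

theorem divergence_identity:
  assumes w: "C1_hom0 w W"
  shows "sph_int (\<lambda>x. ddet (J x) (matrix (W x))) = (real CARD('n) - 1) * sph_int (\<lambda>x. d1 x * (x \<bullet> w x))"
proof -
  let ?a = "\<lambda>x. d1 x * (x \<bullet> w x)" and ?b = "\<lambda>x. ddet (J x) (matrix (W x))"
  let ?n = "real CARD('n)"
  have ca: "continuous_on (sphere 0 1) ?a"
    by (intro continuous_intros continuous_on_d1 continuous_on_subset[OF C1_hom0_continuous[OF w] sphere_not_0])
  have cb: "continuous_on (sphere 0 1) ?b"
    by (intro continuous_on_ddet continuous_on_coeff2 continuous_on_J continuous_on_matrix_derivative[OF w])
  let ?a' = "\<lambda>y. ?a (y /\<^sub>R norm y)" and ?b' = "\<lambda>y. ?b (y /\<^sub>R norm y)"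
  note ia = set_lebesgue_integral_eq_integral(1)[OF abs_integrable_sphere[OF ca]]
  note ib = set_lebesgue_integral_eq_integral(1)[OF abs_integrable_sphere[OF cb]]
  note na = set_lebesgue_integral_eq_integral(1)[OF integral_pball_norm(1)[OF ca]]
  note nb = set_lebesgue_integral_eq_integral(1)[OF integral_pball_norm(1)[OF cb]]
  have eq: "ddet (J (y /\<^sub>R norm y)) (E w W (norm y) (y /\<^sub>R norm y))
      = ((?a' y + ?b' y) - (norm y * ?b' y)) - 2 * (norm y * ?a' y)" if "y \<in> pball" for y
  proof -
    have x: "norm (y /\<^sub>R norm y) = 1" using that by simp
    show ?thesis unfolding E_def ddet_add ddet_scaleR ddet_rank_one[OF x] by (simp add: algebra_simps)
  qed
  have "0 = integral pball (\<lambda>y. ddet (J (y /\<^sub>R norm y)) (E w W (norm y) (y /\<^sub>R norm y)))"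
    by (rule first_variation_zero[OF w, symmetric])
  also have "\<dots> = integral pball (\<lambda>y. ((?a' y + ?b' y) - (norm y * ?b' y)) - 2 * (norm y * ?a' y))"
    by (rule integral_cong) (rule eq)
  also have "\<dots> = integral pball ?a' + integral pball ?b' - integral pball (\<lambda>y. norm y * ?b' y)
      - 2 * integral pball (\<lambda>y. norm y * ?a' y)"
    by (intro integral_unique has_integral_diff has_integral_add has_integral_mult_right
        integrable_integral ia ib na nb)
  also have "\<dots> = integral pball ?a' + integral pball ?b' - ?n / (?n + 1) * integral pball ?b'
      - 2 * (?n / (?n + 1) * integral pball ?a')"
    by (simp only: integral_pball_norm(2)[OF ca] integral_pball_norm(2)[OF cb])
  finally have e: "0 = integral pball ?a' + integral pball ?b' - ?n / (?n + 1) * integral pball ?b'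
      - 2 * (?n / (?n + 1) * integral pball ?a')" .
  have "b = (n - 1) * a" if e: "0 = a + b - n / (n + 1) * b - 2 * (n / (n + 1) * a)" and n: "n > 0" for a b n :: real
  proof -
    obtain k where k: "n / (n + 1) = k" "k * (n + 1) = n" using n by simp
    have "0 = (n + 1) * (a + b - k * b - 2 * (k * a))" using e unfolding k(1) by simp
    also have "\<dots> = (n + 1) * a + (n + 1) * b - (k * (n + 1)) * b - 2 * ((k * (n + 1)) * a)"
      by (simp add: algebra_simps)
    also have "\<dots> = (n + 1) * a + (n + 1) * b - n * b - 2 * (n * a)" by (simp only: k(2))
    finally show ?thesis by (simp add: algebra_simps)
  qed
  from this[OF e] have "integral pball ?b' = (?n - 1) * integral pball ?a'" by simp
  then show ?thesis
    unfolding sph_int_eq_pball[OF ca] sph_int_eq_pball[OF cb] by (simp add: mult.left_commute)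
qed

text \<open>The position vector \<open>T y\<close> carries one power of the radius; its radial
  moment n/(n+1) together with the factor n in \<open>sph_int\<close> leaves the factor n +
  1.\<close>

lemma centroid_identity:
  "integral K (\<lambda>z. z) $ k * (real CARD('n) + 1) = sph_int (\<lambda>x. det (J x) * X x $ k)"
proof -
  let ?F = "\<lambda>x. det (J x) * X x $ k"
  have cF: "continuous_on (sphere 0 1) ?F"
    by (intro continuous_intros continuous_on_det_J continuous_on_subset[OF C1_hom0_continuous[OF X] sphere_not_0])
  let ?g = "\<lambda>y. det (J (y /\<^sub>R norm y)) *\<^sub>R T y"
  have "?g integrable_on pball"
  proof -
    have "continuous_on (sphere 0 1) (\<lambda>x. det (J x) *\<^sub>R X x)"
      by (intro continuous_intros continuous_on_det_J continuous_on_subset[OF C1_hom0_continuous[OF X] sphere_not_0])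
    then obtain D where D: "\<And>x. x \<in> sphere 0 1 \<Longrightarrow> norm (det (J x) *\<^sub>R X x) \<le> D"
      using sphere_bounded by blast
    have "?g absolutely_integrable_on pball"
    proof (rule abs_integrable_pball[of _ D])
      show "continuous_on pball ?g"
        by (intro continuous_on_scaleR continuous_on_polar[OF continuous_on_det_J] continuous_on_subset[OF continuous_on_T]) auto
      fix y :: "real^'n" assume y: "y \<in> pball"
      have "norm (?g y) = norm y * norm (det (J (y /\<^sub>R norm y)) *\<^sub>R X (y /\<^sub>R norm y))"
        using C1_hom0_normalize[OF X, of y] y by (simp add: abs_mult mult_ac)
      also have "\<dots> \<le> 1 * D" using y D[of "y /\<^sub>R norm y"] by (intro mult_mono) auto
      finally show "norm (?g y) \<le> D" by simp
    qed
    then show ?thesis by (rule set_lebesgue_integral_eq_integral(1))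
  qed
  then have "integral pball ?g $ k = integral pball (\<lambda>y. ?g y $ k)"
    by (rule integral_linear[OF _ bounded_linear_vec_nth[of k], unfolded o_def, symmetric])
  also have "\<dots> = integral pball (\<lambda>y. norm y * ?F (y /\<^sub>R norm y))"
    by (rule integral_cong) (use C1_hom0_normalize[OF X] in auto)
  also have "\<dots> = real CARD('n) / (real CARD('n) + 1) * integral pball (\<lambda>y. ?F (y /\<^sub>R norm y))"
    by (rule integral_pball_norm(2)[OF cF])
  finally show ?thesis
    unfolding integral_K_ident sph_int_eq_pball[OF cF] by (simp add: field_simps)
qed

end

section \<open>Support functions and boundary charts\<close>

text \<open>Cramer's rule writes the solution as a quotient of determinants, hence of polynomials in
  the entries.\<close>

lemma continuous_on_matrix_inv_mult:
  fixes M :: "'a::topological_space \<Rightarrow> real^'n^'n"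
  assumes M: "\<And>i j. continuous_on S (\<lambda>x. M x $ i $ j)" and b: "\<And>i. continuous_on S (\<lambda>x. b x $ i)"
    and nz: "\<And>x. x \<in> S \<Longrightarrow> det (M x) \<noteq> 0"
  shows "continuous_on S (\<lambda>x. matrix_inv (M x) *v b x)"
proof -
  have eq: "matrix_inv (M x) *v b x = (\<chi> k. det (\<chi> i j. if j = k then b x $ i else M x $ i $ j) / det (M x))"
    if "x \<in> S" for x
  proof -
    have "M x *v (matrix_inv (M x) *v b x) = b x"
      by (simp add: matrix_vector_mul_assoc matrix_inv_inverse[OF nz[OF that]])
    then show ?thesis using cramer[OF nz[OF that]] by blast
  qed
  have "continuous_on S (\<lambda>x. \<chi> k. det (\<chi> i j. if j = k then b x $ i else M x $ i $ j) / det (M x))"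
  proof (intro continuous_on_vec_lambda continuous_on_divide ballI nz)
    show "continuous_on S (\<lambda>x. det (\<chi> i j. if j = k then b x $ i else M x $ i $ j))" for k
    proof (rule continuous_on_det)
      show "continuous_on S (\<lambda>x. (\<chi> i j. if j = k then b x $ i else M x $ i $ j) $ i $ j)" for i j
        by (cases "j = k") (simp_all add: M b)
    qed
    show "continuous_on S (\<lambda>x. det (M x))"
      by (rule continuous_on_det) (rule M)
  qed
  then show ?thesis using eq by (simp cong: continuous_on_cong)
qed

lemma supp_ge:
  assumes "compact K" "y \<in> K"
  shows "x \<bullet> y \<le> supp K x"
  unfolding supp_def
  by (rule cSup_upper) (use assms in \<open>auto intro!: bounded_imp_bdd_above compact_imp_bounded compact_continuous_image continuous_intros\<close>)

lemma supp_attained: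
  assumes "compact K" "K \<noteq> {}"
  obtains y where "y \<in> K" "supp K x = x \<bullet> y"
proof -
  obtain y where y: "y \<in> K" "\<And>q. q \<in> K \<Longrightarrow> x \<bullet> q \<le> x \<bullet> y"
    using continuous_attains_sup[OF assms, of "\<lambda>q. x \<bullet> q"]
    by (auto simp: continuous_on_inner continuous_on_const continuous_on_id)
  have "supp K x = x \<bullet> y"
    unfolding supp_def by (rule cSup_eq_maximum) (use y in auto)
  then show ?thesis using y that by blast
qed

lemma supp_hom:
  assumes "compact K" "K \<noteq> {}" "0 \<le> c"
  shows "supp K (c *\<^sub>R x) = c * supp K x"
proof (rule antisym)
  obtain y where y: "y \<in> K" "supp K (c *\<^sub>R x) = (c *\<^sub>R x) \<bullet> y" using supp_attained[OF assms(1,2)] .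
  then show "supp K (c *\<^sub>R x) \<le> c * supp K x"
    using supp_ge[OF assms(1) y(1), of x] assms(3) by (simp add: mult_left_mono)
  obtain z where z: "z \<in> K" "supp K x = x \<bullet> z" using supp_attained[OF assms(1,2)] .
  then show "c * supp K x \<le> supp K (c *\<^sub>R x)"
    using supp_ge[OF assms(1) z(1), of "c *\<^sub>R x"] by simp
qed

lemma supp_pos:
  assumes "compact K" "0 \<in> interior K" "x \<noteq> 0"
  shows "0 < supp K x"
proof -
  obtain e where e: "e > 0" "cball 0 e \<subseteq> K"
    using assms(2) by (auto simp: mem_interior_cball)
  have "e *\<^sub>R sgn x \<in> K" using e assms(3) by (intro subsetD[OF e(2)]) (simp add: norm_sgn)
  then have "x \<bullet> (e *\<^sub>R sgn x) \<le> supp K x" by (rule supp_ge[OF assms(1)])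
  moreover have "x \<bullet> (e *\<^sub>R sgn x) > 0"
    using e assms(3) by (simp add: sgn_div_norm)
  ultimately show ?thesis by linarith
qed

lemma mem_convex_body_iff:
  assumes "compact K" "convex K" "K \<noteq> {}"
  shows "q \<in> K \<longleftrightarrow> (\<forall>x. norm x = 1 \<longrightarrow> x \<bullet> q \<le> supp K x)"
proof
  assume r: "\<forall>x. norm x = 1 \<longrightarrow> x \<bullet> q \<le> supp K x"
  show "q \<in> K"
  proof (rule ccontr)
    assume q: "q \<notin> K"
      obtain a b where ab: "a \<bullet> q < b" "\<forall>y\<in>K. b < a \<bullet> y"
        using separating_hyperplane_closed_point[OF assms(2) compact_imp_closed[OF assms(1)] q] by blast
      obtain y0 where "y0 \<in> K" using assms(3) by blast
      then have a0: "a \<noteq> 0" using ab by fastforce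
      \<comment> \<open>The separation places \<open>K\<close> on the side where \<open>a\<close> is
        larger, so the outward direction is the opposite one.\<close>
      let ?x = "- sgn a"
      have "norm ?x = 1" using a0 by (simp add: norm_sgn)
      obtain y where y: "y \<in> K" "supp K ?x = ?x \<bullet> y" using supp_attained[OF assms(1,3)] .
      have "?x \<bullet> q \<le> ?x \<bullet> y" using r[rule_format, OF \<open>norm ?x = 1\<close>] y(2) by simp
      then have "(a \<bullet> y) / norm a \<le> (a \<bullet> q) / norm a" by (simp add: sgn_div_norm divide_inverse mult.commute)
      then have "a \<bullet> y \<le> a \<bullet> q" using a0 by (simp add: divide_le_cancel)
      then show False using ab y by force
  qed
qed (use supp_ge[OF assms(1)] in blast)

lemma has_derivative_along_line:
  assumes "(g has_derivative (\<lambda>v. a \<bullet> v)) (at (p::'a::real_inner))"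
  shows "((\<lambda>t. g (p + t *\<^sub>R v)) has_real_derivative (a \<bullet> v)) (at 0)"
proof -
  have "((\<lambda>t. p + t *\<^sub>R v) has_derivative (\<lambda>t. t *\<^sub>R v)) (at 0)"
    by (auto intro!: derivative_eq_intros)
  moreover have "(g has_derivative (\<lambda>v. a \<bullet> v)) (at (p + 0 *\<^sub>R v))" using assms by simp
  ultimately have "((\<lambda>t. g (p + t *\<^sub>R v)) has_derivative (\<lambda>t. a \<bullet> (t *\<^sub>R v))) (at 0)"
    by (rule has_derivative_compose)
  then show ?thesis by (simp add: has_field_derivative_def mult.commute[of _ "a \<bullet> v"] mult_commute_abs)
qed

lemma eventually_in_open_line:
  fixes p :: "'a::real_normed_vector"
  assumes "open U" "p \<in> U"
  obtains d where "d > 0" "\<And>t. \<bar>t\<bar> < d \<Longrightarrow> p + t *\<^sub>R v \<in> U"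
proof -
  have "isCont (\<lambda>t::real. p + t *\<^sub>R v) 0" by (intro continuous_intros)
  then have "((\<lambda>t::real. p + t *\<^sub>R v) \<longlongrightarrow> p + 0 *\<^sub>R v) (nhds 0)"
    unfolding isCont_def by (subst (asm) tendsto_at_iff_tendsto_nhds)
  then have "\<forall>\<^sub>F t in nhds 0. p + t *\<^sub>R v \<in> U"
    by (rule topological_tendstoD) (use assms in auto)
  then show ?thesis using that by (auto simp: eventually_nhds_metric dist_real_def)
qed

text \<open>The curvature condition is kept apart: a chart is used at all of its points, whereas
  nonzero curvature is demanded only at the point around which the chart is inverted.\<close>

definition boundary_chart :: "(real^'n) set \<Rightarrow> (real^'n) set \<Rightarrow> (real^'n \<Rightarrow> real) \<Rightarrow> (real^'n \<Rightarrow> real^'n)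
    \<Rightarrow> (real^'n \<Rightarrow> real^'n \<Rightarrow> real^'n) \<Rightarrow> bool" where
  "boundary_chart K U g G H \<longleftrightarrow> open U \<and> C2_with U g G H \<and> (\<forall>y\<in>U. G y \<noteq> 0) \<and> K \<inter> U = {y\<in>U. g y \<le> 0}"

text \<open>Otherwise \<open>g\<close> would increase from 0 along the segment from \<open>p\<close>
  to \<open>q\<close>, which by convexity stays in \<open>K\<close>, where \<open>g\<close> is at
  most 0.\<close>

lemma chart_supporting:
  assumes ch: "boundary_chart K U g G H" and K: "convex K" and p: "p \<in> U" "g p = 0" and q: "q \<in> K"
  shows "G p \<bullet> q \<le> G p \<bullet> p"
proof (rule ccontr)
  assume "\<not> G p \<bullet> q \<le> G p \<bullet> p"
  then have pos: "0 < G p \<bullet> (q - p)" by (simp add: inner_diff_right)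
  have pK: "p \<in> K" using ch p by (auto simp: boundary_chart_def)
  have "(g has_derivative (\<lambda>v. G p \<bullet> v)) (at p)" using ch p by (auto simp: boundary_chart_def C2_with_def)
  from has_derivative_along_line[OF this, of "q - p"]
  obtain d where d: "d > 0" "\<And>h. 0 < h \<Longrightarrow> h < d \<Longrightarrow> g p < g (p + h *\<^sub>R (q - p))"
    using has_real_derivative_pos_inc_right[of "\<lambda>t. g (p + t *\<^sub>R (q - p))" "G p \<bullet> (q - p)" 0 UNIV] pos by auto
  obtain e where e: "e > 0" "\<And>t. \<bar>t\<bar> < e \<Longrightarrow> p + t *\<^sub>R (q - p) \<in> U"
    using eventually_in_open_line[of U p "q - p"] ch p by (auto simp: boundary_chart_def)
  define t where "t = min (min d e) 1 / 2"
  have t: "0 < t" "t < d" "t < e" "t \<le> 1" using d e by (auto simp: t_def)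
  have "p + t *\<^sub>R (q - p) = (1 - t) *\<^sub>R p + t *\<^sub>R q" by (simp add: algebra_simps)
  also have "\<dots> \<in> K" using K pK q t by (auto intro: convexD)
  finally have "p + t *\<^sub>R (q - p) \<in> K \<inter> U" using e(2)[of t] t by auto
  then have "g (p + t *\<^sub>R (q - p)) \<le> 0" using ch by (auto simp: boundary_chart_def)
  then show False using d(2)[OF t(1,2)] p by simp
qed

text \<open>First-order conditions for maximising \<open>x\<close> over \<open>K\<close>. Every
  direction in which \<open>g\<close> decreases, and every direction at all if
  \<open>g p < 0\<close>, initially stays in \<open>K\<close> and so cannot increase
  \<open>x\<close>; hence \<open>p\<close> lies on the level set and \<open>x\<close> is a positive
  multiple of the gradient.\<close>

lemma chart_maximizer:
  assumes ch: "boundary_chart K U g G H" and p: "p \<in> U" "p \<in> K"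
    and x: "x \<noteq> 0" and max: "\<And>q. q \<in> K \<Longrightarrow> x \<bullet> q \<le> x \<bullet> p"
  shows "g p = 0" and "sgn (G p) = sgn x"
proof -
  have op: "open U" and der: "(g has_derivative (\<lambda>v. G p \<bullet> v)) (at p)" and G0: "G p \<noteq> 0"
    using ch p by (auto simp: boundary_chart_def C2_with_def)
  have KU: "y \<in> K" if "y \<in> U" "g y \<le> 0" for y
    using ch that by (auto simp: boundary_chart_def)
  have gp: "g p \<le> 0" using ch p by (auto simp: boundary_chart_def)
  have dir: "x \<bullet> v \<le> 0" if v: "g p < 0 \<or> G p \<bullet> v < 0" for v
  proof -
    obtain e where e: "e > 0" "\<And>t. \<bar>t\<bar> < e \<Longrightarrow> p + t *\<^sub>R v \<in> U"
      using eventually_in_open_line[OF op p(1), of v] by blast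
    have "\<exists>d>0. \<forall>h. 0 < h \<and> h < d \<longrightarrow> g (p + h *\<^sub>R v) \<le> 0"
    proof (cases "g p < 0")
      case True
      have "isCont (\<lambda>t. g (p + t *\<^sub>R v)) 0"
        using has_derivative_along_line[OF der] by (rule DERIV_isCont)
      then have "((\<lambda>t. g (p + t *\<^sub>R v)) \<longlongrightarrow> g p) (at 0)" by (simp add: isCont_def)
      then have "\<forall>\<^sub>F t in at 0. g (p + t *\<^sub>R v) < 0" using True by (rule order_tendstoD)
      then obtain d where "d > 0" "\<forall>t. t \<noteq> 0 \<and> dist t 0 < d \<longrightarrow> g (p + t *\<^sub>R v) < 0"
        by (auto simp: eventually_at)
      then show ?thesis by (intro exI[of _ d]) (auto simp: dist_real_def intro: less_imp_le)
    next
      case False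
      then obtain d where "d > 0" "\<And>h. 0 < h \<Longrightarrow> h < d \<Longrightarrow> g p > g (p + h *\<^sub>R v)"
        using has_real_derivative_neg_dec_right[OF has_derivative_along_line[OF der, of v]] v by auto
      then show ?thesis using gp by (intro exI[of _ d]) force
    qed
    then obtain d where d: "d > 0" "\<And>h. 0 < h \<Longrightarrow> h < d \<Longrightarrow> g (p + h *\<^sub>R v) \<le> 0" by blast
    define t where "t = min d e / 2"
    have t: "0 < t" "t < d" "t < e" using d e by (auto simp: t_def)
    have "p + t *\<^sub>R v \<in> K" using KU[OF e(2)[of t] d(2)] t by auto
    then have "x \<bullet> (p + t *\<^sub>R v) \<le> x \<bullet> p" by (rule max)
    then have "t * (x \<bullet> v) \<le> 0" by (simp add: inner_add_right)
    then show ?thesis using t by (simp add: mult_le_0_iff)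
  qed
  show "g p = 0"
  proof (rule ccontr)
    assume "g p \<noteq> 0"
    then have "x \<bullet> x \<le> 0" using dir[of x] gp by auto
    then show False using x by (metis antisym inner_eq_zero_iff inner_ge_zero)
  qed
  \<comment> \<open>Here \<open>u\<close> is the part of \<open>x\<close> orthogonal to the
    gradient. It is only tangent to \<open>K\<close>, so it is tilted inwards by a small multiple
    \<open>e\<close> of the gradient, and \<open>e\<close> tends to 0.\<close>
  define k where "k = (x \<bullet> G p) / (G p \<bullet> G p)"
  define u where "u = x - k *\<^sub>R G p"
  have Gu: "G p \<bullet> u = 0" using G0 by (simp add: u_def k_def inner_diff_right inner_commute)
  have xu: "x \<bullet> u = u \<bullet> u"
  proof -
    have "x = u + k *\<^sub>R G p" by (simp add: u_def)
    then show ?thesis using Gu by (metis add.right_neutral inner_add_left inner_scaleR_left mult_zero_right)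
  qed
  have "u \<bullet> u - e * (x \<bullet> G p) \<le> 0" if "e > 0" for e
    using dir[of "u - e *\<^sub>R G p"] that G0 by (simp add: inner_diff_right Gu xu)
  then have "u \<bullet> u \<le> 0 + e" if "e > 0" for e
  proof -
    let ?e = "e / (1 + \<bar>x \<bullet> G p\<bar>)"
    have "?e > 0" using that by (simp add: add_pos_nonneg)
    then have "u \<bullet> u \<le> ?e * (x \<bullet> G p)" using \<open>\<And>e. e > 0 \<Longrightarrow> u \<bullet> u - e * (x \<bullet> G p) \<le> 0\<close>[of ?e] by simp
    also have "\<dots> \<le> ?e * (1 + \<bar>x \<bullet> G p\<bar>)" using \<open>?e > 0\<close> by (intro mult_left_mono) auto
    also have "\<dots> = e" by simp
    finally show ?thesis by simp
  qed
  then have "u \<bullet> u \<le> 0" by (rule field_le_epsilon)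
  then have "u = 0" by (metis antisym inner_eq_zero_iff inner_ge_zero)
  then have xk: "x = k *\<^sub>R G p" by (simp add: u_def)
  have "x \<bullet> (- G p) \<le> 0" using G0 by (intro dir) simp
  then have "k \<ge> 0" by (simp add: k_def divide_nonneg_nonneg)
  then have "k > 0" using xk x by (cases "k = 0") auto
  then show "sgn (G p) = sgn x" by (simp add: xk sgn_scaleR)
qed

lemma sgn_has_derivative:
  fixes y :: "'a::real_inner"
  assumes "y \<noteq> 0"
  shows "(sgn has_derivative (\<lambda>v. (v - (sgn y \<bullet> v) *\<^sub>R sgn y) /\<^sub>R norm y)) (at y)"
proof -
  have "((\<lambda>y. inverse (norm y)) has_derivative (\<lambda>v. - (inverse (norm y) * (sgn y \<bullet> v) * inverse (norm y)))) (at y)"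
    by (rule Deriv.has_derivative_inverse[OF _ norm_has_derivative[OF assms]]) (use assms in simp)
  from has_derivative_scaleR[OF this has_derivative_ident]
  have "((\<lambda>y. inverse (norm y) *\<^sub>R y) has_derivative
      (\<lambda>v. inverse (norm y) *\<^sub>R v + (- (inverse (norm y) * (sgn y \<bullet> v) * inverse (norm y))) *\<^sub>R y)) (at y)" .
  moreover have "(\<lambda>y. inverse (norm y) *\<^sub>R y) = (sgn :: 'a \<Rightarrow> 'a)" by (simp add: sgn_div_norm fun_eq_iff)
  moreover have "(\<lambda>v. inverse (norm y) *\<^sub>R v + (- (inverse (norm y) * (sgn y \<bullet> v) * inverse (norm y))) *\<^sub>R y)
      = (\<lambda>v. (v - (sgn y \<bullet> v) *\<^sub>R sgn y) /\<^sub>R norm y)"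
    by (simp add: fun_eq_iff sgn_div_norm algebra_simps)
  ultimately show ?thesis by simp
qed

lemma sgn_inner_self: "y \<noteq> 0 \<Longrightarrow> sgn y \<bullet> sgn (y :: 'a::real_inner) = 1"
  by (simp add: norm_sgn flip: norm_eq_1)

text \<open>The curvature is the determinant of the second fundamental form, completed by 1 on the
  normal; if it is nonzero, a tangent vector annihilated by the form must vanish.\<close>

lemma gauss_curv_injective:
  assumes H: "linear (H p)" and curv: "gauss_curv G H p \<noteq> 0"
    and v: "G p \<bullet> v = 0" "tproj (sgn (G p)) (H p v) = 0"
  shows "v = 0"
proof -
  let ?\<nu> = "sgn (G p)"
  let ?M = "(\<chi> i j. (H p (tproj ?\<nu> (axis i 1)) \<bullet> tproj ?\<nu> (axis j 1)) / norm (G p) + ?\<nu> $ i * ?\<nu> $ j) :: real^'a^'a"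
  have detM: "det ?M \<noteq> 0"
    using curv by (simp add: gauss_curv_def Let_def sgn_div_norm)
  have lt: "linear (tproj ?\<nu>)"
    by (auto intro!: linearI simp: tproj_def algebra_simps inner_add_left)
  have \<nu>v: "?\<nu> \<bullet> v = 0" using v(1) by (simp add: sgn_div_norm)
  then have tv: "tproj ?\<nu> v = v" by (simp add: tproj_def inner_commute)
  \<comment> \<open>The matrix carries the argument of \<open>H p\<close> in its row index, so
    applying the form to \<open>v\<close> amounts to multiplying by the transpose.\<close>
  have "transpose ?M *v v = 0"
  proof -
    have "(transpose ?M *v v) $ j = 0" for j
    proof -
      let ?L = "\<lambda>u. H p (tproj ?\<nu> u) \<bullet> tproj ?\<nu> (axis j 1) / norm (G p) + (?\<nu> \<bullet> u) * ?\<nu> $ j"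
      have "linear ?L"
        using H lt by (auto intro!: linearI simp: linear_add linear_scale inner_add_left inner_add_right
            add_divide_distrib algebra_simps)
      have "(transpose ?M *v v) $ j = (\<Sum>i\<in>UNIV. ?L (axis i 1) * v $ i)"
        by (simp add: matrix_vector_mult_def transpose_def inner_axis)
      also have "\<dots> = ?L (\<Sum>i\<in>UNIV. v $ i *\<^sub>R axis i 1)"
        unfolding linear_sum[OF \<open>linear ?L\<close>] linear_scale[OF \<open>linear ?L\<close>]
        by (rule sum.cong) (simp_all add: mult.commute)
      also have "(\<Sum>i\<in>UNIV. v $ i *\<^sub>R axis i 1) = v"
        using basis_expansion[of v] by (simp add: scalar_mult_eq_scaleR)
      also have "?L v = H p v \<bullet> tproj ?\<nu> (axis j 1) / norm (G p)"
        by (simp add: tv \<nu>v)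
      also have "H p v \<bullet> tproj ?\<nu> (axis j 1) = tproj ?\<nu> (H p v) \<bullet> axis j 1"
        by (simp add: tproj_def inner_diff_left inner_diff_right inner_commute)
      finally show ?thesis using v(2) by simp
    qed
    then show ?thesis by (simp add: vec_eq_iff)
  qed
  moreover have nz: "det (transpose ?M) \<noteq> 0" using detM by simp
  have "v = matrix_inv (transpose ?M) *v (transpose ?M *v v)"
    by (simp only: matrix_vector_mul_assoc matrix_inv_inverse(2)[OF nz] matrix_vector_mul_lid)
  ultimately show ?thesis by simp
qed

text \<open>The Gauss map of the level sets of \<open>g\<close> alone loses a dimension. Scaling the
  normal by \<open>1 + g\<close> keeps the level as a radius, and the result is a map between open
  sets whose derivative at \<open>p\<close> is injective by the curvature condition. Its local
  inverse, restricted to the unit sphere, parametrises the boundary by the outer normal.\<close>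

lemma chart_inverse:
  fixes G :: "real^'n \<Rightarrow> real^'n"
  assumes ch: "boundary_chart K U g G H" and p: "p \<in> U" "g p = 0" and curv: "gauss_curv G H p \<noteq> 0"
  obtains U' V \<theta> \<theta>' where "open U'" "U' \<subseteq> U" "p \<in> U'" "open V" "sgn (G p) \<in> V"
    "inj_on (\<lambda>y. (1 + g y) *\<^sub>R sgn (G y)) U'" "\<theta> ` V \<subseteq> U'" "\<theta> (sgn (G p)) = p"
    "\<And>x. x \<in> V \<Longrightarrow> (1 + g (\<theta> x)) *\<^sub>R sgn (G (\<theta> x)) = x"
    "\<And>x. x \<in> V \<Longrightarrow> (\<theta> has_derivative \<theta>' x) (at x)"
    "\<And>b. continuous_on V b \<Longrightarrow> continuous_on V (\<lambda>x. \<theta>' x (b x))"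
proof -
  let ?F = "\<lambda>y. (1 + g y) *\<^sub>R sgn (G y)"
  let ?S = "\<lambda>y v. (H y v - (sgn (G y) \<bullet> H y v) *\<^sub>R sgn (G y)) /\<^sub>R norm (G y)"
  let ?F' = "\<lambda>y v. (1 + g y) *\<^sub>R ?S y v + (G y \<bullet> v) *\<^sub>R sgn (G y)"
  have op: "open U" and G0: "\<And>y. y \<in> U \<Longrightarrow> G y \<noteq> 0"
    and dg: "\<And>y. y \<in> U \<Longrightarrow> (g has_derivative (\<lambda>v. G y \<bullet> v)) (at y)"
    and dG: "\<And>y. y \<in> U \<Longrightarrow> (G has_derivative H y) (at y)"
    and cH: "\<And>v. continuous_on U (\<lambda>y. H y v)"
    using ch by (auto simp: boundary_chart_def C2_with_def)
  have dF: "(?F has_derivative ?F' y) (at y)" if y: "y \<in> U" for y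
  proof -
    have "((\<lambda>y. 1 + g y) has_derivative (\<lambda>v. G y \<bullet> v)) (at y)"
      using has_derivative_add[OF has_derivative_const dg[OF y], of 1] by simp
    from has_derivative_scaleR[OF this has_derivative_compose[OF dG[OF y] sgn_has_derivative[OF G0[OF y]]]]
    show ?thesis .
  qed
  have bl: "bounded_linear (?F' y)" if "y \<in> U" for y
    using dF[OF that] by (rule has_derivative_bounded_linear)
  have cg: "continuous_on U g" and cG: "continuous_on U G"
    by (auto intro!: continuous_at_imp_continuous_on has_derivative_continuous dg dG)
  have csG: "continuous_on U (\<lambda>y. sgn (G y))"
    unfolding sgn_div_norm by (intro continuous_intros cG) (use G0 in auto)
  have cF': "continuous_on U (\<lambda>y. ?F' y v)" for v
    by (intro continuous_intros cg cG csG cH) (use G0 in auto)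
  define f' where "f' y = Blinfun (?F' y)" for y
  have f': "blinfun_apply (f' y) = ?F' y" if "y \<in> U" for y
    unfolding f'_def by (rule bounded_linear_Blinfun_apply[OF bl[OF that]])
  have cf': "continuous_on U f'"
  proof (rule continuous_on_blinfun_componentwise)
    show "continuous_on U (\<lambda>y. blinfun_apply (f' y) i)" for i
      using cF'[of i] by (simp add: f' cong: continuous_on_cong)
  qed
  have sG: "sgn (G p) \<bullet> sgn (G p) = 1" using sgn_inner_self[OF G0[OF p(1)]] .
  have inj: "inj (?F' p)"
  proof (subst linear_injective_0)
    show "linear (?F' p)" using bl[OF p(1)] by (rule bounded_linear.linear)
    show "\<forall>v. ?F' p v = 0 \<longrightarrow> v = 0"
    proof (intro allI impI)
      fix v assume z: "?F' p v = 0"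
      \<comment> \<open>The derivative of the unit normal is tangential, so pairing with the normal
        isolates the radial term; what remains is the second fundamental form applied to a tangent
        vector.\<close>
      have "sgn (G p) \<bullet> ?F' p v = G p \<bullet> v"
        by (simp add: inner_add_right inner_diff_right sG)
      then have Gv: "G p \<bullet> v = 0" using z by simp
      then have "?S p v = 0" using z p(2) by simp
      then have "tproj (sgn (G p)) (H p v) = 0"
        using G0[OF p(1)] by (simp add: tproj_def inner_commute)
      moreover have "linear (H p)" using dG[OF p(1)] by (rule has_derivative_linear)
      ultimately show "v = 0" using gauss_curv_injective[OF _ curv Gv] by blast
    qed
  qed
  obtain L where L: "linear L" "L \<circ> ?F' p = id"
    using linear_injective_left_inverse[OF bounded_linear.linear[OF bl[OF p(1)]] inj] by blast
  have inv: "Blinfun L o\<^sub>L f' p = id_blinfun"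
  proof (rule blinfun_eqI)
    fix v
    have "bounded_linear L" using L(1) by (simp add: linear_conv_bounded_linear)
    then show "blinfun_apply (Blinfun L o\<^sub>L f' p) v = blinfun_apply id_blinfun v"
      using L(2) by (simp add: bounded_linear_Blinfun_apply f'[OF p(1)] o_def fun_eq_iff)
  qed
  have der': "(?F has_derivative blinfun_apply (f' y)) (at y)" if "y \<in> U" for y
    using dF[OF that] f'[OF that] by simp
  show ?thesis
  proof (rule inverse_function_theorem[OF op _ cf' p(1) inv])
    show "(?F has_derivative blinfun_apply (f' y)) (at y)" if "y \<in> U" for y
      using that by (rule der')
  next
  fix U' V \<theta> \<theta>'
  assume IFT: "open U'" "U' \<subseteq> U" "p \<in> U'" "open V" "?F p \<in> V" "homeomorphism U' V ?F \<theta>"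
    and d\<theta>: "\<And>y. y \<in> V \<Longrightarrow> (\<theta> has_derivative (\<theta>' y)) (at y)"
    and \<theta>': "\<And>y. y \<in> V \<Longrightarrow> \<theta>' y = inv (blinfun_apply (f' (\<theta> y)))"
    and bij: "\<And>y. y \<in> V \<Longrightarrow> bij (blinfun_apply (f' (\<theta> y)))"
  have hF: "\<theta> ` V = U'" "\<And>y. y \<in> U' \<Longrightarrow> \<theta> (?F y) = y" "\<And>x. x \<in> V \<Longrightarrow> ?F (\<theta> x) = x" "continuous_on V \<theta>"
    using IFT(6) by (auto simp: homeomorphism_def)
  have Fp: "?F p = sgn (G p)" by (simp add: p)
  show thesis
  proof (rule that[of U' V \<theta> \<theta>'])
    show "inj_on ?F U'" using hF(2) by (rule inj_on_inverseI)
    show "\<theta> ` V \<subseteq> U'" using hF(1) by simp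
    show "\<theta> (sgn (G p)) = p" using hF(2)[OF IFT(3)] Fp by simp
    show "sgn (G p) \<in> V" using IFT(5) Fp by simp
    fix b :: "real^'n \<Rightarrow> real^'n" assume b: "continuous_on V b"
    let ?M = "\<lambda>x. matrix (?F' (\<theta> x))"
    have \<theta>U: "\<theta> x \<in> U" if "x \<in> V" for x using hF(1) IFT(2) that by blast
    have lin: "linear (?F' (\<theta> x))" if "x \<in> V" for x
      using bl[OF \<theta>U[OF that]] by (rule bounded_linear.linear)
    have bijF: "bij (?F' (\<theta> x))" if "x \<in> V" for x
      using bij[OF that] f'[OF \<theta>U[OF that]] by simp
    have nz: "det (?M x) \<noteq> 0" if "x \<in> V" for x
      using bijF[OF that] det_nz_iff_inj[OF lin[OF that]] by (simp add: bij_is_inj)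
    have eq: "\<theta>' x (b x) = matrix_inv (?M x) *v b x" if x: "x \<in> V" for x
    proof -
      have "?F' (\<theta> x) (\<theta>' x (b x)) = b x"
        unfolding \<theta>'[OF x] f'[OF \<theta>U[OF x]] by (rule surj_f_inv_f) (rule bij_is_surj[OF bijF[OF x]])
      then have "?M x *v \<theta>' x (b x) = b x" by (simp only: matrix_works_real[OF lin[OF x]])
      then have "matrix_inv (?M x) *v b x = matrix_inv (?M x) *v (?M x *v \<theta>' x (b x))" by simp
      also have "\<dots> = \<theta>' x (b x)"
        by (simp only: matrix_vector_mul_assoc matrix_inv_inverse(2)[OF nz[OF x]] matrix_vector_mul_lid)
      finally show ?thesis by simp
    qed
    have "continuous_on V (\<lambda>x. matrix_inv (?M x) *v b x)"
    proof (rule continuous_on_matrix_inv_mult)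
      show "continuous_on V (\<lambda>x. ?M x $ i $ j)" for i j
      proof -
        have "continuous_on V (\<lambda>x. ?F' (\<theta> x) (axis j 1))"
          by (rule continuous_on_compose2[OF cF' hF(4)]) (use \<theta>U in blast)
        from continuous_on_component[OF this, of i] show ?thesis unfolding matrix_def by simp
      qed
      show "continuous_on V (\<lambda>x. b x $ i)" for i using b by (rule continuous_on_component)
    qed (rule nz)
    then show "continuous_on V (\<lambda>x. \<theta>' x (b x))"
      using eq by (simp cong: continuous_on_cong)
  qed (use IFT d\<theta> hF in auto)
  qed
qed

section \<open>Homogeneous functions and the spherical Hessian\<close>

text \<open>The mean value theorem, applied along \<open>u\<close> to the increment of
  \<open>f\<close> in the direction \<open>v\<close>, turns the second difference into a difference
  of gradients. Only differentiability of the gradient at the single point \<open>x\<close> is then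
  used.\<close>

lemma second_difference_tendsto:
  fixes f :: "'a::real_inner \<Rightarrow> real"
  assumes r: "r > 0" and f: "\<And>y. dist y x < r \<Longrightarrow> (f has_derivative (\<lambda>v. G y \<bullet> v)) (at y)"
    and G: "(G has_derivative B) (at x)" and e: "e > 0"
  shows "\<exists>d>0. \<forall>t. 0 < t \<and> t < d \<longrightarrow>
    \<bar>f (x + t *\<^sub>R u + t *\<^sub>R v) - f (x + t *\<^sub>R u) - f (x + t *\<^sub>R v) + f x - t\<^sup>2 * (B v \<bullet> u)\<bar> \<le> e * t\<^sup>2"
proof -
  define M where "M = norm u + norm v + 1"
  have M: "M > 0" "norm u \<le> M" "norm u + norm v \<le> M" by (auto simp: M_def add_nonneg_pos)
  \<comment> \<open>Two errors of size \<open>e' * (t * M)\<close>, each paired with a vector of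
    length at most \<open>t * M\<close>, add up to \<open>e * t\<^sup>2\<close>.\<close>
  define e' where "e' = e / (2 * M\<^sup>2)"
  have e': "e' > 0" using e M by (simp add: e'_def)
  obtain d0 where d0: "d0 > 0" "\<And>y. norm (y - x) < d0 \<Longrightarrow> norm (G y - G x - B (y - x)) \<le> e' * norm (y - x)"
    using G e' unfolding has_derivative_at_alt by blast
  have lB: "linear B" using G by (rule has_derivative_linear)
  define d where "d = min d0 r / M"
  have d: "d > 0" using d0 r M by (simp add: d_def)
  have "\<bar>f (x + t *\<^sub>R u + t *\<^sub>R v) - f (x + t *\<^sub>R u) - f (x + t *\<^sub>R v) + f x - t\<^sup>2 * (B v \<bullet> u)\<bar> \<le> e * t\<^sup>2"
    if t: "0 < t" "t < d" for t
  proof -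
    have tM: "t * M < d0" "t * M < r" using t M by (auto simp: d_def field_simps)
    have bnd: "norm (s *\<^sub>R (t *\<^sub>R u) + c *\<^sub>R (t *\<^sub>R v)) \<le> t * M" if "0 \<le> s" "s \<le> 1" "0 \<le> c" "c \<le> 1" for s c
    proof -
      have "norm (s *\<^sub>R (t *\<^sub>R u) + c *\<^sub>R (t *\<^sub>R v)) \<le> s * (t * norm u) + c * (t * norm v)"
        by (rule order_trans[OF norm_triangle_ineq]) (use that t in simp)
      also have "\<dots> \<le> 1 * (t * norm u) + 1 * (t * norm v)"
        using that t by (intro add_mono mult_right_mono) auto
      also have "\<dots> = t * (norm u + norm v)" by (simp add: distrib_left)
      also have "\<dots> \<le> t * M" using M t by (intro mult_left_mono) auto
      finally show ?thesis .
    qed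
    let ?p = "\<lambda>s c. x + (s *\<^sub>R (t *\<^sub>R u) + c *\<^sub>R (t *\<^sub>R v))"
    let ?\<phi> = "\<lambda>s. f (?p s 1) - f (?p s 0)"
    have der: "((\<lambda>s. f (?p s c)) has_real_derivative (G (?p s c) \<bullet> (t *\<^sub>R u))) (at s)"
      if "0 \<le> s" "s \<le> 1" "0 \<le> c" "c \<le> 1" for s c
    proof -
      have "((\<lambda>s. ?p s c) has_derivative (\<lambda>h. h *\<^sub>R (t *\<^sub>R u))) (at s)"
        by (auto intro!: derivative_eq_intros)
      moreover have "(f has_derivative (\<lambda>v. G (?p s c) \<bullet> v)) (at (?p s c))"
        by (rule f) (use bnd[OF that] tM in \<open>simp add: dist_norm\<close>)
      ultimately have "((\<lambda>s. f (?p s c)) has_derivative (\<lambda>h. G (?p s c) \<bullet> (h *\<^sub>R (t *\<^sub>R u)))) (at s)"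
        by (rule has_derivative_compose)
      then show ?thesis by (simp add: has_field_derivative_def mult_ac mult_commute_abs)
    qed
    have "\<exists>z::real. z > 0 \<and> z < 1 \<and> ?\<phi> 1 - ?\<phi> 0 = (1 - 0) * (G (?p z 1) \<bullet> (t *\<^sub>R u) - G (?p z 0) \<bullet> (t *\<^sub>R u))"
    proof (rule MVT2)
      fix s :: real assume "0 \<le> s" "s \<le> 1"
      then show "(?\<phi> has_real_derivative (G (?p s 1) \<bullet> (t *\<^sub>R u) - G (?p s 0) \<bullet> (t *\<^sub>R u))) (at s)"
        by (intro DERIV_diff der) auto
    qed simp
    then obtain z where z: "0 < z" "z < 1"
      and eq0: "?\<phi> 1 - ?\<phi> 0 = (1 - 0) * (G (?p z 1) \<bullet> (t *\<^sub>R u) - G (?p z 0) \<bullet> (t *\<^sub>R u))"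
      by blast
    have eq: "?\<phi> 1 - ?\<phi> 0 = (G (?p z 1) - G (?p z 0)) \<bullet> (t *\<^sub>R u)"
      unfolding eq0 inner_diff_left by simp
    have R: "norm (G (?p z c) - G x - B (?p z c - x)) \<le> e' * (t * M)" if "0 \<le> c" "c \<le> 1" for c
    proof -
      have n: "norm (?p z c - x) \<le> t * M" using bnd[of z c] z that by simp
      have "norm (G (?p z c) - G x - B (?p z c - x)) \<le> e' * norm (?p z c - x)"
        by (rule d0(2)) (use n tM in linarith)
      also have "\<dots> \<le> e' * (t * M)" using n e' by (intro mult_left_mono) auto
      finally show ?thesis .
    qed
    have pq: "G (?p z 1) - G (?p z 0) - t *\<^sub>R B v = (G (?p z 1) - G x - B (?p z 1 - x)) - (G (?p z 0) - G x - B (?p z 0 - x))"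
      using lB by (simp add: linear_add linear_scale)
    have "norm (G (?p z 1) - G (?p z 0) - t *\<^sub>R B v) \<le> e' * (t * M) + e' * (t * M)"
      unfolding pq by (rule order_trans[OF norm_triangle_ineq4 add_mono[OF R R]]) auto
    then have n1: "norm (G (?p z 1) - G (?p z 0) - t *\<^sub>R B v) \<le> 2 * e' * (t * M)" by (simp only: mult_2 distrib_right)
    have n2: "norm (t *\<^sub>R u) \<le> t * M" using t M by simp
    have "norm (G (?p z 1) - G (?p z 0) - t *\<^sub>R B v) * norm (t *\<^sub>R u) \<le> (2 * e' * (t * M)) * (t * M)"
      by (rule mult_mono[OF n1 n2]) (use t M e' in auto)
    then have "\<bar>(G (?p z 1) - G (?p z 0) - t *\<^sub>R B v) \<bullet> (t *\<^sub>R u)\<bar> \<le> (2 * e' * (t * M)) * (t * M)"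
      using Cauchy_Schwarz_ineq2 order_trans by blast
    also have "\<dots> = e * t\<^sup>2" using M by (simp add: e'_def power2_eq_square field_simps)
    finally have le: "\<bar>(G (?p z 1) - G (?p z 0) - t *\<^sub>R B v) \<bullet> (t *\<^sub>R u)\<bar> \<le> e * t\<^sup>2" .
    have "(a - t *\<^sub>R b) \<bullet> (t *\<^sub>R u) = a \<bullet> (t *\<^sub>R u) - t\<^sup>2 * (b \<bullet> u)" for a b
      by (simp add: inner_diff_left power2_eq_square algebra_simps)
    then have "\<bar>?\<phi> 1 - ?\<phi> 0 - t\<^sup>2 * (B v \<bullet> u)\<bar> \<le> e * t\<^sup>2"
      using le unfolding eq by (simp only:)
    moreover have "?\<phi> 1 - ?\<phi> 0 = f (x + t *\<^sub>R u + t *\<^sub>R v) - f (x + t *\<^sub>R u) - f (x + t *\<^sub>R v) + f x"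
      by (simp add: add.assoc)
    ultimately show ?thesis by simp
  qed
  then show ?thesis using d by blast
qed

text \<open>The second difference is symmetric in \<open>u\<close> and \<open>v\<close>, while its
  two expansions have the two sides as leading coefficients.\<close>

lemma second_derivative_symmetric:
  fixes f :: "'a::real_inner \<Rightarrow> real"
  assumes op: "open S" "x \<in> S" and f: "\<And>y. y \<in> S \<Longrightarrow> (f has_derivative (\<lambda>v. G y \<bullet> v)) (at y)"
    and G: "(G has_derivative B) (at x)"
  shows "B u \<bullet> v = B v \<bullet> u"
proof -
  obtain r where r: "r > 0" "\<And>y. dist y x < r \<Longrightarrow> y \<in> S"
    using op by (auto simp: open_dist)
  have "\<bar>B u \<bullet> v - B v \<bullet> u\<bar> \<le> 0 + e" if e: "e > 0" for e
  proof -
    have e2: "e / 2 > 0" using e by simp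
    obtain d1 where d1: "d1 > 0" "\<And>t. 0 < t \<Longrightarrow> t < d1 \<Longrightarrow>
      \<bar>f (x + t *\<^sub>R u + t *\<^sub>R v) - f (x + t *\<^sub>R u) - f (x + t *\<^sub>R v) + f x - t\<^sup>2 * (B v \<bullet> u)\<bar> \<le> e / 2 * t\<^sup>2"
      using second_difference_tendsto[OF r(1) f G e2, of u v] r(2) by blast
    obtain d2 where d2: "d2 > 0" "\<And>t. 0 < t \<Longrightarrow> t < d2 \<Longrightarrow>
      \<bar>f (x + t *\<^sub>R v + t *\<^sub>R u) - f (x + t *\<^sub>R v) - f (x + t *\<^sub>R u) + f x - t\<^sup>2 * (B u \<bullet> v)\<bar> \<le> e / 2 * t\<^sup>2"
      using second_difference_tendsto[OF r(1) f G e2, of v u] r(2) by blast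
    define t where "t = min d1 d2 / 2"
    have t: "0 < t" "t < d1" "t < d2" using d1 d2 by (auto simp: t_def)
    have "f (x + t *\<^sub>R v + t *\<^sub>R u) = f (x + t *\<^sub>R u + t *\<^sub>R v)" by (simp add: add_ac)
    then have "\<bar>t\<^sup>2 * (B u \<bullet> v) - t\<^sup>2 * (B v \<bullet> u)\<bar> \<le> e * t\<^sup>2"
      using d1(2)[OF t(1,2)] d2(2)[OF t(1,3)] unfolding abs_le_iff by linarith
    then have "t\<^sup>2 * \<bar>B u \<bullet> v - B v \<bullet> u\<bar> \<le> t\<^sup>2 * e"
      by (simp add: abs_mult flip: right_diff_distrib) (simp only: mult.commute)
    then show ?thesis using t by simp
  qed
  then have "\<bar>B u \<bullet> v - B v \<bullet> u\<bar> \<le> 0" by (rule field_le_epsilon)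
  then show ?thesis by simp
qed

text \<open>Degree 1 is the natural extension of support functions and of linear functions: the
  Euclidean Hessian \<open>B\<close> then is the operator D^2 of the restriction to the sphere,
  without correction terms.\<close>

definition C2_hom1 :: "(real^'n \<Rightarrow> real) \<Rightarrow> (real^'n \<Rightarrow> real^'n) \<Rightarrow> (real^'n \<Rightarrow> real^'n \<Rightarrow> real^'n) \<Rightarrow> bool" where
  "C2_hom1 W G B \<longleftrightarrow> C2_with (- {0}) W G B \<and> (\<forall>c y. 0 < c \<longrightarrow> W (c *\<^sub>R y) = c * W y)"

lemma C2_hom1_gradient:
  assumes W: "C2_hom1 W G B"
  shows "C1_hom0 G B"
proof -
  have dW: "(W has_derivative (\<lambda>v. G y \<bullet> v)) (at y)" if "y \<noteq> 0" for y
    using W that by (auto simp: C2_hom1_def C2_with_def)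
  have hom: "G (c *\<^sub>R y) = G y" if c: "c > 0" and y: "y \<noteq> 0" for c y
  proof -
    have "((\<lambda>z. c *\<^sub>R z) has_derivative (\<lambda>v. c *\<^sub>R v)) (at y)"
      by (rule bounded_linear_imp_has_derivative[OF bounded_linear_scaleR_right])
    from has_derivative_compose[OF this dW] c y
    have "((\<lambda>z. W (c *\<^sub>R z)) has_derivative (\<lambda>v. G (c *\<^sub>R y) \<bullet> (c *\<^sub>R v))) (at y)" by simp
    moreover have "(\<lambda>z. W (c *\<^sub>R z)) = (\<lambda>z. c * W z)" using W c by (auto simp: C2_hom1_def)
    moreover have "((\<lambda>z. c * W z) has_derivative (\<lambda>v. c * (G y \<bullet> v))) (at y)"
      by (rule has_derivative_mult_right[OF dW[OF y]])
    ultimately have "(\<lambda>v. G (c *\<^sub>R y) \<bullet> (c *\<^sub>R v)) = (\<lambda>v. c * (G y \<bullet> v))"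
      using has_derivative_unique by metis
    then have "G (c *\<^sub>R y) \<bullet> v = G y \<bullet> v" for v using c by (auto dest: fun_cong[of _ _ v])
    then show ?thesis by (metis vector_eq_ldot inner_commute)
  qed
  have "G (c *\<^sub>R y) = G y" if "c > 0" for c y
    using hom[OF that] by (cases "y = 0") auto
  then show ?thesis using W by (auto simp: C1_hom0_def C2_hom1_def C2_with_def)
qed

lemma C2_hom1_euler:
  assumes W: "C2_hom1 W G B" and y: "y \<noteq> 0"
  shows "G y \<bullet> y = W y"
proof -
  have "(W has_derivative (\<lambda>v. G y \<bullet> v)) (at y)"
    using W y by (auto simp: C2_hom1_def C2_with_def)
  from has_derivative_along_line[OF this, of y]
  have "((\<lambda>t. W (y + t *\<^sub>R y)) has_real_derivative (G y \<bullet> y)) (at 0)" .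
  moreover have "((\<lambda>t. W (y + t *\<^sub>R y)) has_real_derivative W y) (at 0)"
  proof (rule has_field_derivative_transform_within_open[where S = "{-1<..}"])
    show "((\<lambda>t. (1 + t) * W y) has_real_derivative W y) (at 0)"
      by (auto intro!: derivative_eq_intros)
    show "(1 + t) * W y = W (y + t *\<^sub>R y)" if "t \<in> {-1<..}" for t
    proof -
      have "W ((1 + t) *\<^sub>R y) = (1 + t) * W y" using W that by (auto simp: C2_hom1_def)
      then show ?thesis by (simp add: scaleR_left_distrib)
    qed
  qed auto
  ultimately show ?thesis by (rule DERIV_unique)
qed

lemma C2_hom1_symmetric:
  assumes W: "C2_hom1 W G B" and y: "y \<noteq> 0"
  shows "B y u \<bullet> v = B y v \<bullet> u"
  by (rule second_derivative_symmetric[of "- {0}" y W G]) (use W y in \<open>auto simp: C2_hom1_def C2_with_def\<close>)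

text \<open>The gradient has degree 0, so its derivative annihilates the radial direction; by
  symmetry its range is orthogonal to that direction.\<close>

lemma C2_hom1_orth:
  assumes W: "C2_hom1 W G B" and y: "y \<noteq> 0"
  shows "y \<bullet> B y v = 0"
  using C2_hom1_symmetric[OF W y, of v y] C1_hom0_derivative_radial[OF C2_hom1_gradient[OF W] y]
  by (simp add: inner_commute)

text \<open>The great circle \<open>c\<close> with speed \<open>norm u\<close> has acceleration
  \<open>- (norm u)\<^sup>2\<close> times \<open>c\<close>, and Euler's relation turns the pairing
  of the gradient with \<open>c\<close> into the value of \<open>W\<close>. Only the values of
  \<open>w\<close> on the sphere matter.\<close>

lemma sph_Q_hom1:
  assumes W: "C2_hom1 W G B" and x: "norm x = 1" and u: "x \<bullet> u = 0"
    and w: "\<And>y. norm y = 1 \<Longrightarrow> w y = W y"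
  shows "sph_Q w x u = B x u \<bullet> u - (norm u)\<^sup>2 * W x"
proof -
  let ?n = "norm u"
  let ?c = "\<lambda>t. cos (t * ?n) *\<^sub>R x + sin (t * ?n) *\<^sub>R (u /\<^sub>R ?n)"
  let ?c' = "\<lambda>t. (- ?n * sin (t * ?n)) *\<^sub>R x + cos (t * ?n) *\<^sub>R u"
  have xx: "x \<bullet> x = 1" using x by (simp add: norm_eq_1)
  \<comment> \<open>For \<open>u = 0\<close> the normalised direction is 0, since the inverse of 0
    is 0, and the curve is constant; this explains the case distinctions.\<close>
  have nc: "norm (?c t) = 1" for t
  proof (cases "u = 0")
    case False
    let ?e = "u /\<^sub>R ?n"
    have ee: "?e \<bullet> ?e = 1" using False by (subst norm_eq_1[symmetric]) simp
    have xe: "x \<bullet> ?e = 0" using u by simp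
    have "(a *\<^sub>R x + b *\<^sub>R e) \<bullet> (a *\<^sub>R x + b *\<^sub>R e) = a\<^sup>2 + b\<^sup>2"
      if "e \<bullet> e = 1" "x \<bullet> e = 0" for a b e
      using that xx by (simp add: inner_add_left inner_add_right inner_commute[of e x] power2_eq_square)
    from this[OF ee xe] have "?c t \<bullet> ?c t = 1" by simp
    then show ?thesis by (simp only: norm_eq_1)
  qed (simp add: x)
  have c0: "?c t \<noteq> 0" for t using nc[of t] by auto
  have dc: "(?c has_vector_derivative ?c' t) (at t)" for t
    by (cases "u = 0") (auto intro!: derivative_eq_intros simp: has_vector_derivative_def algebra_simps)
  have dc': "(?c' has_vector_derivative (- (?n\<^sup>2) *\<^sub>R ?c t)) (at t)" for t
    by (cases "u = 0") (auto intro!: derivative_eq_intros simp: has_vector_derivative_def algebra_simps power2_eq_square)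
  have dG: "(W has_derivative (\<lambda>v. G y \<bullet> v)) (at y)" "(G has_derivative B y) (at y)" if "y \<noteq> 0" for y
    using W that by (auto simp: C2_hom1_def C2_with_def)
  have d1: "((\<lambda>t. W (?c t)) has_real_derivative (G (?c t) \<bullet> ?c' t)) (at t)" for t
    using has_derivative_compose[OF dc[of t, unfolded has_vector_derivative_def] dG(1)[OF c0]]
    by (simp add: has_field_derivative_def mult_commute_abs mult.commute)
  have d2: "((\<lambda>t. G (?c t)) has_derivative (\<lambda>h. B (?c t) (h *\<^sub>R ?c' t))) (at t)" for t
    using has_derivative_compose[OF dc[of t, unfolded has_vector_derivative_def] dG(2)[OF c0]] .
  have "((\<lambda>t. G (?c t) \<bullet> ?c' t) has_derivative
      (\<lambda>h. G (?c t) \<bullet> (h *\<^sub>R (- (?n\<^sup>2) *\<^sub>R ?c t)) + B (?c t) (h *\<^sub>R ?c' t) \<bullet> ?c' t)) (at t)" for t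
    by (rule has_derivative_inner[OF d2 dc'[unfolded has_vector_derivative_def]])
  moreover have "(\<lambda>h. G (?c t) \<bullet> (h *\<^sub>R (- (?n\<^sup>2) *\<^sub>R ?c t)) + B (?c t) (h *\<^sub>R ?c' t) \<bullet> ?c' t)
      = (*) (B (?c t) (?c' t) \<bullet> ?c' t - ?n\<^sup>2 * (G (?c t) \<bullet> ?c t))" for t
  proof -
    have "g \<bullet> (h *\<^sub>R (- k *\<^sub>R c)) + L (h *\<^sub>R d) \<bullet> d = (L d \<bullet> d - k * (g \<bullet> c)) * h"
      if "linear L" for g c d :: "real^'a" and k h and L :: "real^'a \<Rightarrow> real^'a"
      using that by (simp add: linear_scale algebra_simps)
    from this[OF has_derivative_linear[OF dG(2)[OF c0]]] show ?thesis by (rule ext)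
  qed
  ultimately have d3: "((\<lambda>t. G (?c t) \<bullet> ?c' t) has_real_derivative
      (B (?c t) (?c' t) \<bullet> ?c' t - ?n\<^sup>2 * (G (?c t) \<bullet> ?c t))) (at t)" for t
    by (simp only: has_field_derivative_def)
  have "sph_Q w x u = deriv (deriv (\<lambda>t. W (?c t))) 0"
    unfolding sph_Q_def using w[OF nc] by simp
  also have "deriv (\<lambda>t. W (?c t)) = (\<lambda>t. G (?c t) \<bullet> ?c' t)"
    using DERIV_imp_deriv[OF d1] by (rule ext)
  also have "deriv (\<lambda>t. G (?c t) \<bullet> ?c' t) 0 = B (?c 0) (?c' 0) \<bullet> ?c' 0 - ?n\<^sup>2 * (G (?c 0) \<bullet> ?c 0)"
    by (rule DERIV_imp_deriv[OF d3])
  also have "\<dots> = B x u \<bullet> u - ?n\<^sup>2 * W x"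
  proof -
    have "x \<noteq> 0" using x by auto
    then show ?thesis using C2_hom1_euler[OF W] by simp
  qed
  finally show ?thesis .
qed

text \<open>Polarisation gives the spherical Hessian as \<open>B\<close> minus \<open>W\<close>
  times the metric, and the zeroth-order term of D^2 cancels this correction. Off the tangent space
  both sides vanish because \<open>B x x = 0\<close>.\<close>

lemma Dmat_hom1:
  assumes W: "C2_hom1 W G B" and x: "norm x = 1"
    and w: "\<And>y. norm y = 1 \<Longrightarrow> w y = W y"
  shows "Dmat w x = matrix (B x)"
proof -
  have x0: "x \<noteq> 0" using x by auto
  have xx: "x \<bullet> x = 1" using x by (simp add: norm_eq_1)
  have lB: "linear (B x)" using C1_hom0D(4)[OF C2_hom1_gradient[OF W] x0] .
  have Bx: "B x x = 0" by (rule C1_hom0_derivative_radial[OF C2_hom1_gradient[OF W] x0])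
  note sym = C2_hom1_symmetric[OF W x0]
  have tx: "x \<bullet> tproj x v = 0" for v by (simp add: tproj_def inner_diff_right xx inner_commute)
  have Bt: "B x (tproj x v) = B x v" for v
    using lB Bx by (simp add: tproj_def linear_diff linear_scale)
  have hess: "sph_hess w x u v = B x u \<bullet> v - (u \<bullet> v) * W x" if u: "x \<bullet> u = 0" and v: "x \<bullet> v = 0" for u v
  proof -
    have "sph_hess w x u v = ((B x (u + v) \<bullet> (u + v) - (norm (u + v))\<^sup>2 * W x) - (B x (u - v) \<bullet> (u - v) - (norm (u - v))\<^sup>2 * W x)) / 4"
      unfolding sph_hess_def
      by (simp only: sph_Q_hom1[OF W x _ w] inner_add_right inner_diff_right u v add_0 diff_0_right)
    also have "B x (u + v) \<bullet> (u + v) - B x (u - v) \<bullet> (u - v) = 4 * (B x u \<bullet> v)" 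
      using lB sym[of v u] by (simp add: linear_add linear_diff inner_add_left inner_add_right inner_diff_left inner_diff_right)
    then have "(B x (u + v) \<bullet> (u + v) - (norm (u + v))\<^sup>2 * W x) - (B x (u - v) \<bullet> (u - v) - (norm (u - v))\<^sup>2 * W x)
        = 4 * (B x u \<bullet> v) - 4 * (u \<bullet> v) * W x"
      by (simp add: power2_norm_eq_inner inner_add_left inner_add_right inner_diff_left inner_diff_right inner_commute[of v u] algebra_simps)
    finally show ?thesis by simp
  qed
  have "Dmat w x $ i $ j = matrix (B x) $ i $ j" for i j
  proof -
    let ?a = "tproj x (axis i 1)" and ?b = "tproj x (axis j 1)"
    have "Dmat w x $ i $ j = B x ?a \<bullet> ?b"
      unfolding Dmat_def by (simp add: hess[OF tx tx] w[OF x] mult.commute)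
    also have "\<dots> = B x ?b \<bullet> axis i 1"
      by (simp only: Bt sym[of "axis i 1" ?b])
    also have "\<dots> = matrix (B x) $ i $ j"
      by (simp add: Bt matrix_def inner_axis)
    finally show ?thesis .
  qed
  then show ?thesis by (simp add: vec_eq_iff)
qed

section \<open>Regularity of the support function\<close>

lemma maximizer_frontier:
  assumes p: "p \<in> K" and x: "x \<noteq> 0" and max: "\<And>q. q \<in> K \<Longrightarrow> x \<bullet> q \<le> x \<bullet> (p :: real^'n)"
  shows "p \<in> frontier K"
proof -
  have "p \<notin> interior K"
  proof
    assume "p \<in> interior K"
    then obtain e where e: "e > 0" "cball p e \<subseteq> K" by (auto simp: mem_interior_cball)
    have "p + e *\<^sub>R sgn x \<in> K" using e x by (intro subsetD[OF e(2)]) (simp add: dist_norm norm_sgn)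
    then have "x \<bullet> (p + e *\<^sub>R sgn x) \<le> x \<bullet> p" by (rule max)
    then have "e * (x \<bullet> sgn x) \<le> 0" by (simp add: inner_add_right)
    moreover have "x \<bullet> sgn x > 0" using x by (simp add: sgn_div_norm)
    ultimately show False using e by (simp add: mult_le_0_iff)
  qed
  then show ?thesis using p closure_subset by (auto simp: frontier_def)
qed

lemma Kplus2_chart:
  assumes "Kplus2 K" "p \<in> frontier K"
  obtains U g G H where "p \<in> U" "boundary_chart K U g G H" "gauss_curv G H p \<noteq> 0"
proof -
  obtain U g G H where *: "open U" "p \<in> U" "C2_with U g G H" "\<forall>y\<in>U. G y \<noteq> 0" "K \<inter> U = {y\<in>U. g y \<le> 0}"
      "gauss_curv G H p > 0"
    using assms unfolding Kplus2_def by blast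
  then have "boundary_chart K U g G H" by (simp add: boundary_chart_def)
  then show ?thesis using * that[of U g G H] by simp
qed

text \<open>Strict convexity. If \<open>p'\<close> were another maximiser, all points of the segment
  would be, so near \<open>p\<close> they would share the level 0 and the unit normal and would not
  be separated by the injective chart map.\<close>

lemma Kplus2_unique_maximizer:
  assumes K: "Kplus2 K" and x: "x \<noteq> 0"
    and p: "p \<in> K" "\<And>q. q \<in> K \<Longrightarrow> x \<bullet> q \<le> x \<bullet> p"
    and p': "p' \<in> K" "x \<bullet> p' = x \<bullet> p"
  shows "p' = p"
proof -
  obtain U g G H where ch: "p \<in> U" "boundary_chart K U g G H" "gauss_curv G H p \<noteq> 0"
    using Kplus2_chart[OF K maximizer_frontier[OF p(1) x p(2)]] .
  note m = chart_maximizer[OF ch(2,1) p(1) x p(2)]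
  obtain U' where U': "open U'" "U' \<subseteq> U" "p \<in> U'" and inj: "inj_on (\<lambda>y. (1 + g y) *\<^sub>R sgn (G y)) U'"
    by (rule chart_inverse[OF ch(2,1) m(1) ch(3)])
  obtain d where d: "d > 0" "\<And>t. \<bar>t\<bar> < d \<Longrightarrow> p + t *\<^sub>R (p' - p) \<in> U'"
    using eventually_in_open_line[OF U'(1,3), of "p' - p"] by blast
  define t where "t = min d 1 / 2"
  have t: "0 < t" "t < d" "t \<le> 1" using d by (auto simp: t_def)
  let ?q = "p + t *\<^sub>R (p' - p)"
  have "?q = (1 - t) *\<^sub>R p + t *\<^sub>R p'" by (simp add: algebra_simps)
  also have "\<dots> \<in> K" using K p p' t by (auto simp: Kplus2_def intro!: convexD)
  finally have qK: "?q \<in> K" .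
  have qU: "?q \<in> U'" using d(2)[of t] t by simp
  have xq: "x \<bullet> ?q = x \<bullet> p" using p' by (simp add: inner_add_right inner_diff_right)
  have "\<And>q. q \<in> K \<Longrightarrow> x \<bullet> q \<le> x \<bullet> ?q" using p(2) xq by simp
  note m' = chart_maximizer[OF ch(2) subsetD[OF U'(2) qU] qK x this]
  have "(1 + g ?q) *\<^sub>R sgn (G ?q) = (1 + g p) *\<^sub>R sgn (G p)" by (simp only: m m')
  then have "?q = p" using inj qU U'(3) unfolding inj_on_def by blast
  then show ?thesis using t by simp
qed

text \<open>Expanding the argument in coordinates upgrades continuity for each fixed vector to
  continuity with a varying base point and a varying vector.\<close>

lemma continuous_on_linear_family:
  fixes L :: "'a::topological_space \<Rightarrow> real^'n \<Rightarrow> 'b::real_normed_vector"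
  assumes c: "\<And>v. continuous_on V (\<lambda>x. L x v)" and lin: "\<And>x. x \<in> V \<Longrightarrow> linear (L x)"
    and s: "continuous_on N s" "s ` N \<subseteq> V" and b: "continuous_on N b"
  shows "continuous_on N (\<lambda>y. L (s y) (b y))"
proof -
  have "continuous_on N (\<lambda>y. \<Sum>i\<in>UNIV. b y $ i *\<^sub>R L (s y) (axis i 1))"
    by (intro continuous_intros b continuous_on_compose2[OF c s])
  moreover have "(\<Sum>i\<in>UNIV. b y $ i *\<^sub>R L (s y) (axis i 1)) = L (s y) (b y)" if "y \<in> N" for y
  proof -
    have l: "linear (L (s y))" using lin s that by blast
    have "(\<Sum>i\<in>UNIV. b y $ i *\<^sub>R L (s y) (axis i 1)) = L (s y) (\<Sum>i\<in>UNIV. b y $ i *\<^sub>R axis i 1)"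
      by (simp only: linear_sum[OF l] linear_scale[OF l])
    also have "(\<Sum>i\<in>UNIV. b y $ i *\<^sub>R axis i 1) = b y"
      using basis_expansion[of "b y"] by (simp add: scalar_mult_eq_scaleR)
    finally show ?thesis .
  qed
  ultimately show ?thesis by (rule continuous_on_eq)
qed

text \<open>For a body with positive curvature and \<open>y\<close> nonzero the choice is unique:
  the boundary point with outer normal \<open>y\<close>, which turns out to be the gradient of the
  support function.\<close>

definition support_pt :: "(real^'n) set \<Rightarrow> real^'n \<Rightarrow> real^'n" where
  "support_pt K y = (SOME p. p \<in> K \<and> y \<bullet> p = supp K y)"

lemma support_pt:
  assumes "compact K" "K \<noteq> {}"
  shows "support_pt K y \<in> K" "y \<bullet> support_pt K y = supp K y"
proof -
  have "\<exists>p. p \<in> K \<and> y \<bullet> p = supp K y" using supp_attained[OF assms, of y] by metis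
  from someI_ex[OF this] show "support_pt K y \<in> K" "y \<bullet> support_pt K y = supp K y"
    by (auto simp: support_pt_def)
qed

lemma Kplus2_basic:
  assumes "Kplus2 K"
  shows "compact K" "convex K" "K \<noteq> {}" "0 \<in> interior K"
  using assms interior_subset by (auto simp: Kplus2_def)

lemma support_pt_unique:
  assumes K: "Kplus2 K" and y: "y \<noteq> 0" and p: "p \<in> K" "supp K y \<le> y \<bullet> p"
  shows "support_pt K y = p"
proof -
  note b = Kplus2_basic[OF K]
  have e: "y \<bullet> p = supp K y" using supp_ge[OF b(1) p(1), of y] p(2) by simp
  show ?thesis
    by (rule Kplus2_unique_maximizer[OF K y p(1)])
      (use supp_ge[OF b(1)] e support_pt[OF b(1,3)] in auto)
qed

text \<open>Near \<open>y0\<close> the support point is the inverse chart map composed with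
  \<open>sgn\<close>. Taking norms in the chart equation forces \<open>g = 0\<close>, so the chart
  point lies on the boundary with normal \<open>sgn y\<close>; by convexity it is a maximiser, and
  maximisers are unique.\<close>

lemma support_pt_local:
  assumes K: "Kplus2 K" and y0: "y0 \<noteq> 0"
  obtains N A where "open N" "y0 \<in> N" "N \<subseteq> - {0}" "\<And>y. y \<in> N \<Longrightarrow> (support_pt K has_derivative A y) (at y)"
    "\<And>v. continuous_on N (\<lambda>y. A y v)"
proof -
  note b = Kplus2_basic[OF K]
  let ?X = "support_pt K"
  define p where "p = ?X y0"
  have p: "p \<in> K" "\<And>q. q \<in> K \<Longrightarrow> y0 \<bullet> q \<le> y0 \<bullet> p"
    using support_pt[OF b(1,3)] supp_ge[OF b(1)] by (auto simp: p_def)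
  obtain U g G H where ch: "p \<in> U" "boundary_chart K U g G H" "gauss_curv G H p \<noteq> 0"
    using Kplus2_chart[OF K maximizer_frontier[OF p(1) y0 p(2)]] .
  note m = chart_maximizer[OF ch(2,1) p(1) y0 p(2)]
  have G0: "\<And>y. y \<in> U \<Longrightarrow> G y \<noteq> 0" and KU: "K \<inter> U = {y\<in>U. g y \<le> 0}"
    and dg: "\<And>y. y \<in> U \<Longrightarrow> (g has_derivative (\<lambda>v. G y \<bullet> v)) (at y)"
    using ch(2) by (auto simp: boundary_chart_def C2_with_def)
  have cg: "continuous_on U g"
    by (auto intro!: continuous_at_imp_continuous_on has_derivative_continuous dg)
  show thesis
  proof (rule chart_inverse[OF ch(2,1) m(1) ch(3)])
    fix U' V \<theta> \<theta>'
    assume U': "open U'" "U' \<subseteq> U" "p \<in> U'" and V: "open V" "sgn (G p) \<in> V"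
      and \<theta>: "\<theta> ` V \<subseteq> U'" "\<theta> (sgn (G p)) = p" "\<And>x. x \<in> V \<Longrightarrow> (1 + g (\<theta> x)) *\<^sub>R sgn (G (\<theta> x)) = x"
      and d\<theta>: "\<And>x. x \<in> V \<Longrightarrow> (\<theta> has_derivative \<theta>' x) (at x)"
      and c\<theta>': "\<And>b. continuous_on V b \<Longrightarrow> continuous_on V (\<lambda>x. \<theta>' x (b x))"
    have \<theta>U: "\<theta> x \<in> U" if "x \<in> V" for x using \<theta>(1) U'(2) that by blast
    have c\<theta>: "continuous_on V \<theta>"
      by (auto intro!: continuous_at_imp_continuous_on has_derivative_continuous d\<theta>)
    have cgt: "continuous_on V (\<lambda>x. g (\<theta> x))"
      by (rule continuous_on_compose2[OF cg c\<theta>]) (use \<theta>U in blast)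
    \<comment> \<open>The restriction keeps the radius \<open>1 + g\<close> positive and so excludes
      points whose gradient is opposite to the given direction.\<close>
    define W where "W = V \<inter> (\<lambda>x. g (\<theta> x)) -` {-1<..}"
    have opW: "open W" unfolding W_def by (rule continuous_open_preimage[OF cgt V(1) open_greaterThan])
    have csgn: "continuous_on (- {0}) (sgn :: real^'a \<Rightarrow> real^'a)"
      unfolding sgn_div_norm by (intro continuous_intros) auto
    define N where "N = - {0} \<inter> sgn -` W"
    have opN: "open N" unfolding N_def by (rule continuous_open_preimage[OF csgn _ opW]) auto
    have y0N: "y0 \<in> N"
      using y0 V(2) m \<theta>(2) by (simp add: N_def W_def)
    have XN: "?X y = \<theta> (sgn y)" if y: "y \<in> N" for y
    proof -
      let ?x = "sgn y"
      have y0': "y \<noteq> 0" and xV: "?x \<in> V" and gx: "g (\<theta> ?x) > -1" using y by (auto simp: N_def W_def)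
      have eq: "(1 + g (\<theta> ?x)) *\<^sub>R sgn (G (\<theta> ?x)) = ?x" by (rule \<theta>(3)[OF xV])
      have "norm ((1 + g (\<theta> ?x)) *\<^sub>R sgn (G (\<theta> ?x))) = 1 + g (\<theta> ?x)"
        using gx G0[OF \<theta>U[OF xV]] by (simp add: norm_sgn)
      then have g0: "g (\<theta> ?x) = 0" using y0' unfolding eq by (simp add: norm_sgn)
      then have sx: "sgn (G (\<theta> ?x)) = sgn y" using eq by simp
      have "\<theta> ?x \<in> {y \<in> U. g y \<le> 0}" using \<theta>U[OF xV] g0 by simp
      then have \<theta>K: "\<theta> ?x \<in> K" unfolding KU[symmetric] by (rule IntD1)
      have "y \<bullet> q \<le> y \<bullet> \<theta> ?x" if q: "q \<in> K" for q
      proof -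
        have "G (\<theta> ?x) \<bullet> q \<le> G (\<theta> ?x) \<bullet> \<theta> ?x"
          by (rule chart_supporting[OF ch(2) b(2) \<theta>U[OF xV] g0 q])
        then have "sgn (G (\<theta> ?x)) \<bullet> q \<le> sgn (G (\<theta> ?x)) \<bullet> \<theta> ?x"
          by (simp add: sgn_div_norm mult_left_mono)
        then have "norm y * (sgn y \<bullet> q) \<le> norm y * (sgn y \<bullet> \<theta> ?x)"
          unfolding sx by (intro mult_left_mono) auto
        moreover have "norm y * (sgn y \<bullet> z) = y \<bullet> z" for z
          using y0' by (simp add: sgn_div_norm)
        ultimately show ?thesis by simp
      qed
      then have "supp K y \<le> y \<bullet> \<theta> ?x" using support_pt[OF b(1,3), of y] by metis
      then show ?thesis by (rule support_pt_unique[OF K y0' \<theta>K])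
    qed
    let ?b = "\<lambda>y v. (v - (sgn y \<bullet> v) *\<^sub>R sgn y) /\<^sub>R norm y"
    have NV: "sgn y \<in> V" "y \<noteq> 0" if "y \<in> N" for y using that by (auto simp: N_def W_def)
    show thesis
    proof (rule that[of N "\<lambda>y v. \<theta>' (sgn y) (?b y v)"])
      show "open N" "y0 \<in> N" "N \<subseteq> - {0}" using opN y0N by (auto simp: N_def)
      fix y assume y: "y \<in> N"
      have "((\<lambda>y. \<theta> (sgn y)) has_derivative (\<lambda>v. \<theta>' (sgn y) (?b y v))) (at y)"
        by (rule has_derivative_compose[OF sgn_has_derivative[OF NV(2)[OF y]] d\<theta>[OF NV(1)[OF y]]])
      then show "(?X has_derivative (\<lambda>v. \<theta>' (sgn y) (?b y v))) (at y)"
        by (rule has_derivative_transform_within_open[OF _ opN y]) (simp add: XN)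
    next
      fix v
      have csN: "continuous_on N sgn" by (rule continuous_on_subset[OF csgn]) (auto simp: N_def)
      have lin: "linear (\<theta>' x)" if "x \<in> V" for x using d\<theta>[OF that] by (rule has_derivative_linear)
      show "continuous_on N (\<lambda>y. \<theta>' (sgn y) (?b y v))"
      proof (rule continuous_on_linear_family[where V = V and L = \<theta>' and s = sgn and b = "\<lambda>y. ?b y v"])
        show "continuous_on V (\<lambda>x. \<theta>' x v)" for v by (rule c\<theta>') (rule continuous_on_const)
        show "continuous_on N (\<lambda>y. ?b y v)"
          by (intro continuous_intros csN) (use NV in auto)
      qed (use lin csN NV in auto)
    qed
  qed
qed

text \<open>The local formulas depend on the chart; the Frechet derivative does not, and this glues
  them.\<close>

definition support_hess :: "(real^'n) set \<Rightarrow> real^'n \<Rightarrow> real^'n \<Rightarrow> real^'n" where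
  "support_hess K y = frechet_derivative (support_pt K) (at y)"

lemma support_pt_C1:
  assumes K: "Kplus2 K"
  shows "y \<noteq> 0 \<Longrightarrow> (support_pt K has_derivative support_hess K y) (at y)"
    and "continuous_on (- {0}) (\<lambda>y. support_hess K y v)"
proof -
  show "(support_pt K has_derivative support_hess K y) (at y)" if y: "y \<noteq> 0" for y
    by (rule support_pt_local[OF K y]) (metis support_hess_def frechet_derivative_at)
  show "continuous_on (- {0}) (\<lambda>y. support_hess K y v)"
  proof (intro continuous_at_imp_continuous_on ballI)
    fix y :: "real^'a" assume "y \<in> - {0}"
    then have y: "y \<noteq> 0" by simp
    show "isCont (\<lambda>y. support_hess K y v) y"
    proof (rule support_pt_local[OF K y])
      fix N A assume N: "open N" "y \<in> N" "N \<subseteq> - {0}"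
        and d: "\<And>y. y \<in> N \<Longrightarrow> (support_pt K has_derivative A y) (at y)" and c: "\<And>v. continuous_on N (\<lambda>y. A y v)"
      have "support_hess K z v = A z v" if "z \<in> N" for z
        using frechet_derivative_at[OF d[OF that]] by (simp add: support_hess_def)
      then have "continuous_on N (\<lambda>y. support_hess K y v)"
        using c[of v] by (simp cong: continuous_on_cong)
      then show ?thesis using N by (simp add: continuous_on_eq_continuous_at)
    qed
  qed
qed

text \<open>Comparing maximisers gives the two-sided bound X(y).(z - y) <= h(z) - h(y) <= X(z).(z -
  y), so continuity of the support point already yields differentiability of h with gradient
  X.\<close>

lemma supp_C2:
  assumes K: "Kplus2 K"
  shows "C2_hom1 (supp K) (support_pt K) (support_hess K)"
proof -
  note b = Kplus2_basic[OF K]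
  let ?X = "support_pt K"
  have "(supp K has_derivative (\<lambda>v. ?X y \<bullet> v)) (at y)" if y: "y \<noteq> 0" for y
    unfolding has_derivative_at_alt
  proof (intro conjI allI impI)
    show "bounded_linear (\<lambda>v. ?X y \<bullet> v)" by (rule bounded_linear_inner_right)
    fix e :: real assume e: "e > 0"
    have "isCont ?X y" using support_pt_C1(1)[OF K y] by (rule has_derivative_continuous)
    then obtain d where d: "d > 0" "\<And>z. dist z y < d \<Longrightarrow> dist (?X z) (?X y) < e"
      using e unfolding continuous_at_eps_delta by blast
    have "norm (supp K z - supp K y - ?X y \<bullet> (z - y)) \<le> e * norm (z - y)" if z: "norm (z - y) < d" for z
    proof -
      have 1: "supp K y = y \<bullet> ?X y" "supp K z = z \<bullet> ?X z"
        using support_pt(2)[OF b(1,3)] by simp_all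
      have 2: "z \<bullet> ?X y \<le> z \<bullet> ?X z" "y \<bullet> ?X z \<le> y \<bullet> ?X y"
        using supp_ge[OF b(1) support_pt(1)[OF b(1,3)]] 1 by metis+
      have "supp K z - supp K y - ?X y \<bullet> (z - y) \<le> (?X z - ?X y) \<bullet> (z - y)"
        using 2 unfolding 1 by (simp add: inner_diff_left inner_diff_right inner_commute)
      also have "\<dots> \<le> norm (?X z - ?X y) * norm (z - y)" by (rule norm_cauchy_schwarz)
      also have "\<dots> \<le> e * norm (z - y)"
        using d(2)[of z] z by (intro mult_right_mono) (auto simp: dist_norm)
      finally show ?thesis
        using 2 unfolding 1 by (simp add: inner_diff_left inner_diff_right inner_commute)
    qed
    then show "\<exists>d>0. \<forall>z. norm (z - y) < d \<longrightarrow> norm (supp K z - supp K y - ?X y \<bullet> (z - y)) \<le> e * norm (z - y)"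
      using d(1) by blast
  qed
  then show ?thesis
    using support_pt_C1[OF K] supp_hom[OF b(1,3)] by (auto simp: C2_hom1_def C2_with_def)
qed

text \<open>The support point is a monotone map, (X(z) - X(y)).(z - y) >= 0, by adding the two
  maximality inequalities; its derivative is therefore positive semidefinite.\<close>

lemma support_hess_psd:
  assumes K: "Kplus2 K" and y: "y \<noteq> 0"
  shows "0 \<le> support_hess K y v \<bullet> v"
proof (rule ccontr)
  note b = Kplus2_basic[OF K]
  let ?X = "support_pt K"
  assume "\<not> 0 \<le> support_hess K y v \<bullet> v"
  then have neg: "support_hess K y v \<bullet> v < 0" by simp
  have lin: "linear (support_hess K y)" using support_pt_C1(1)[OF K y] by (rule has_derivative_linear)
  have "((\<lambda>t. y + t *\<^sub>R v) has_derivative (\<lambda>t. t *\<^sub>R v)) (at 0)"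
    by (auto intro!: derivative_eq_intros)
  moreover have "(?X has_derivative support_hess K y) (at (y + 0 *\<^sub>R v))"
    using support_pt_C1(1)[OF K y] by simp
  ultimately have "((\<lambda>t. ?X (y + t *\<^sub>R v)) has_derivative (\<lambda>t. support_hess K y (t *\<^sub>R v))) (at 0)"
    by (rule has_derivative_compose)
  then have "((\<lambda>t. ?X (y + t *\<^sub>R v) \<bullet> v) has_derivative (\<lambda>t. support_hess K y (t *\<^sub>R v) \<bullet> v)) (at 0)"
    by (rule has_derivative_inner_left)
  then have "((\<lambda>t. ?X (y + t *\<^sub>R v) \<bullet> v) has_real_derivative (support_hess K y v \<bullet> v)) (at 0)"
    using lin by (simp add: has_field_derivative_def linear_scale mult_commute_abs)
  from has_real_derivative_neg_dec_right[OF this neg]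
  obtain d where d: "d > 0" "\<And>h. 0 < h \<Longrightarrow> h < d \<Longrightarrow> ?X y \<bullet> v > ?X (y + h *\<^sub>R v) \<bullet> v" by auto
  define t where "t = d / 2"
  have t: "0 < t" "t < d" using d by (auto simp: t_def)
  let ?z = "y + t *\<^sub>R v"
  have 2: "?z \<bullet> ?X y \<le> ?z \<bullet> ?X ?z" "y \<bullet> ?X ?z \<le> y \<bullet> ?X y"
    using supp_ge[OF b(1) support_pt(1)[OF b(1,3)]] support_pt(2)[OF b(1,3)] by metis+
  then have "t * (?X y \<bullet> v) \<le> t * (?X ?z \<bullet> v)"
    unfolding inner_add_left inner_scaleR_left inner_commute[of _ v] by linarith
  then show False using t d(2)[OF t] by simp
qed

text \<open>A boundary point has only one outer unit normal, the normalised gradient of any chart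
  around it.\<close>

lemma support_pt_injective:
  assumes K: "Kplus2 K" and x: "norm x = 1" "norm x' = 1" and eq: "support_pt K x = support_pt K x'"
  shows "x = x'"
proof -
  note b = Kplus2_basic[OF K]
  let ?p = "support_pt K x"
  have x0: "x \<noteq> 0" "x' \<noteq> 0" using x by auto
  have m1: "\<And>q. q \<in> K \<Longrightarrow> x \<bullet> q \<le> x \<bullet> ?p"
    using support_pt(2)[OF b(1,3), of x] supp_ge[OF b(1), of _ x] by simp
  have m2: "\<And>q. q \<in> K \<Longrightarrow> x' \<bullet> q \<le> x' \<bullet> ?p"
    using support_pt(2)[OF b(1,3), of x'] supp_ge[OF b(1), of _ x'] eq by simp
  have pK: "?p \<in> K" by (rule support_pt[OF b(1,3)])
  obtain U g G H where ch: "?p \<in> U" "boundary_chart K U g G H" "gauss_curv G H ?p \<noteq> 0"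
    using Kplus2_chart[OF K maximizer_frontier[OF pK x0(1) m1]] .
  have "sgn x = sgn x'"
    using chart_maximizer(2)[OF ch(2,1) pK x0(1) m1] chart_maximizer(2)[OF ch(2,1) pK x0(2) m2] by simp
  then show ?thesis using x by (simp add: sgn_div_norm)
qed

text \<open>The point of \<open>K\<close> with gauge \<open>r\<close>, lying on the ray through the
  boundary point with normal \<open>x\<close>, is the image of \<open>r *\<^sub>R x\<close>. Thus
  \<open>T\<close> is a set of polar coordinates adapted to \<open>K\<close>, with directions
  labelled by normals.\<close>

lemma support_pt_bijection:
  assumes K: "Kplus2 K"
  defines "T \<equiv> \<lambda>y. norm y *\<^sub>R support_pt K y"
  shows "inj_on T (cball 0 1)" "T ` cball 0 1 = K" "T ` sphere 0 1 = frontier K"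
proof -
  note b = Kplus2_basic[OF K]
  let ?X = "support_pt K"
  have C1: "C1_hom0 ?X (support_hess K)" by (rule C2_hom1_gradient[OF supp_C2[OF K]])
  have XK: "?X y \<in> K" and Xs: "y \<bullet> ?X y = supp K y" for y using support_pt[OF b(1,3)] by auto
  have pos: "supp K y > 0" if "y \<noteq> 0" for y by (rule supp_pos[OF b(1,4) that])
  have Tpol: "T y = norm y *\<^sub>R ?X (sgn y)" for y
    using C1_hom0_normalize[OF C1, of y] by (cases "y = 0") (auto simp: T_def sgn_div_norm)
  \<comment> \<open>Pairing the common image point with \<open>z\<close> gives
    \<open>norm z * supp K z\<close> on one side and at most \<open>norm y * supp K z\<close> on the
    other.\<close>
  have le: "norm z \<le> norm y" if "T y = T z" "z \<noteq> 0" for y z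
  proof -
    have "norm z * supp K z = z \<bullet> T z" by (simp add: T_def Xs)
    also have "\<dots> = norm y * (z \<bullet> ?X y)" by (simp add: that(1)[symmetric]) (simp add: T_def)
    also have "\<dots> \<le> norm y * supp K z" by (intro mult_left_mono supp_ge[OF b(1) XK]) auto
    finally show ?thesis using pos[OF that(2)] by simp
  qed
  show inj: "inj_on T (cball 0 1)"
  proof
    fix y z assume eq: "T y = T z"
    show "y = z"
    proof (cases "y = 0 \<or> z = 0")
      case True
      then show ?thesis using le[OF eq] le[OF eq[symmetric]] by (metis norm_le_zero_iff norm_zero)
    next
      case False
      then have n: "norm y = norm z" using le[OF eq] le[OF eq[symmetric]] by auto
      then have Xe: "?X (sgn y) = ?X (sgn z)" using eq False unfolding Tpol[of y] Tpol[of z] by simp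
      have "norm (sgn y) = 1" "norm (sgn z) = 1" using False by (simp_all add: norm_sgn)
      then have "sgn y = sgn z" by (rule support_pt_injective[OF K _ _ Xe])
      then have "norm y *\<^sub>R sgn y = norm z *\<^sub>R sgn z" using n by simp
      then show ?thesis using False by (simp add: sgn_div_norm)
    qed
  qed
  have "q \<in> T ` cball 0 1" if q: "q \<in> K" for q
  proof -
    have ne: "sphere 0 1 \<noteq> ({} :: (real^'a) set)" by simp
    have cs: "continuous_on (sphere 0 1) (supp K)"
    proof (intro continuous_at_imp_continuous_on ballI)
      fix z :: "real^'a" assume "z \<in> sphere 0 1"
      then have "z \<noteq> 0" by auto
      then show "isCont (supp K) z" using supp_C2[OF K]
        by (auto simp: C2_hom1_def C2_with_def intro: has_derivative_continuous)
    qed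
    \<comment> \<open>The maximal value is the Minkowski gauge of \<open>q\<close>, and the
      maximiser is an outer normal at the boundary point obtained by dividing \<open>q\<close> by
      its gauge.\<close>
    obtain x where x: "x \<in> sphere 0 1" and mx: "\<And>z. z \<in> sphere 0 1 \<Longrightarrow> (z \<bullet> q) / supp K z \<le> (x \<bullet> q) / supp K x"
    proof -
      have "continuous_on (sphere 0 1) (\<lambda>z. (z \<bullet> q) / supp K z)"
      proof (intro continuous_intros cs ballI)
        fix z :: "real^'a" assume "z \<in> sphere 0 1"
        then have "z \<noteq> 0" by auto
        then show "supp K z \<noteq> 0" using pos[of z] by simp
      qed
      from continuous_attains_sup[OF compact_sphere ne this] show ?thesis using that by blast
    qed
    have x0: "x \<noteq> 0" using x by auto
    define r where "r = (x \<bullet> q) / supp K x"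
    have r1: "r \<le> 1" using supp_ge[OF b(1) q, of x] pos[OF x0] by (simp add: r_def divide_le_eq)
    show ?thesis
    proof (cases "q = 0")
      case True
      then have "q = T 0" by (simp add: T_def)
      then show ?thesis by auto
    next
      case False
      have "0 < (sgn q \<bullet> q) / supp K (sgn q)"
      proof (rule divide_pos_pos)
        show "0 < sgn q \<bullet> q" using False by (simp add: sgn_div_norm)
        show "0 < supp K (sgn q)" using False by (intro pos) (simp add: sgn_zero_iff)
      qed
      also have "\<dots> \<le> r" unfolding r_def by (rule mx) (use False in \<open>simp add: norm_sgn\<close>)
      finally have r0: "r > 0" .
      have "z \<bullet> (q /\<^sub>R r) \<le> supp K z" if z: "norm z = 1" for z
      proof -
        have z0: "z \<noteq> 0" using z by auto
        have "(z \<bullet> q) / supp K z \<le> r" unfolding r_def by (rule mx) (use z in simp)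
        then have "z \<bullet> q \<le> r * supp K z" using pos_divide_le_eq[OF pos[OF z0]] by blast
        then have "z \<bullet> q \<le> supp K z * r" by (simp add: mult.commute)
        then have "(z \<bullet> q) / r \<le> supp K z" using pos_divide_le_eq[OF r0] by blast
        then show ?thesis by (simp add: divide_inverse mult.commute)
      qed
      then have "q /\<^sub>R r \<in> K" using mem_convex_body_iff[OF b(1-3)] by blast
      moreover have "supp K x \<le> x \<bullet> (q /\<^sub>R r)"
      proof -
        have "x \<bullet> q = r * supp K x" using pos[OF x0] by (simp add: r_def)
        then show ?thesis using r0 by (simp add: mult.assoc[symmetric])
      qed
      ultimately have Xq: "?X x = q /\<^sub>R r" by (rule support_pt_unique[OF K x0])
      have s1: "sgn (r *\<^sub>R x) = x" using r0 x by (simp add: sgn_scaleR sgn_div_norm)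
      have s2: "norm (r *\<^sub>R x) = r" using r0 x by simp
      have "T (r *\<^sub>R x) = r *\<^sub>R (q /\<^sub>R r)"
        unfolding Tpol[of "r *\<^sub>R x"] s1 s2 Xq ..
      then have "T (r *\<^sub>R x) = q" using r0 by simp
      moreover have "r *\<^sub>R x \<in> cball 0 1" using r0 r1 x by simp
      ultimately show ?thesis by blast
    qed
  qed
  moreover have "T y \<in> K" if "y \<in> cball 0 1" for y
  proof -
    have "(1 - norm y) *\<^sub>R 0 + norm y *\<^sub>R ?X y \<in> K"
      by (rule convexD[OF b(2)]) (use that XK[of y] subsetD[OF interior_subset b(4)] in auto)
    then show ?thesis by (simp add: T_def)
  qed
  ultimately show im: "T ` cball 0 1 = K" by blast
  show "T ` sphere 0 1 = frontier K"
  proof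
    show "T ` sphere 0 1 \<subseteq> frontier K"
    proof
      fix p assume "p \<in> T ` sphere 0 1"
      then obtain x where x: "norm x = 1" "p = ?X x" by (auto simp: T_def)
      then have "x \<noteq> 0" by auto
      then show "p \<in> frontier K"
        unfolding x(2) by (rule maximizer_frontier[OF XK]) (simp add: Xs supp_ge[OF b(1)])
    qed
    show "frontier K \<subseteq> T ` sphere 0 1"
    proof
      fix p assume p: "p \<in> frontier K"
      then have "p \<in> K" using b(1) by (meson compact_imp_closed frontier_subset_closed subsetD)
      then obtain y where y: "norm y \<le> 1" "p = T y" using im by auto
      have "continuous_on UNIV T"
        unfolding T_def using continuous_on_cone[OF C1, of "\<lambda>r. r"] by simp
      \<comment> \<open>Invariance of domain keeps the image of the open ball in the interior, so
        frontier points can only come from the sphere.\<close>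
      then have "open (T ` ball 0 1)"
        by (intro invariance_of_domain inj_on_subset[OF inj]) (auto intro: continuous_on_subset)
      moreover have "T ` ball 0 1 \<subseteq> K" using im ball_subset_cball by blast
      ultimately have "T ` ball 0 1 \<subseteq> interior K" by (simp add: interior_maximal)
      moreover have "p \<notin> interior K" using p by (simp add: frontier_def)
      ultimately have "y \<notin> ball 0 1" using y(2) by blast
      then show "p \<in> T ` sphere 0 1" using y by (intro image_eqI[of _ T y]) auto
    qed
  qed
qed

lemma Dmat1_supp:
  assumes K: "Kplus2 K" and x: "norm x = 1"
  shows "Dmat1 (supp K) x = matrix (\<lambda>v. support_hess K x v + (x \<bullet> v) *\<^sub>R x)"
  unfolding Dmat1_def Dmat_hom1[OF supp_C2[OF K] x refl]
  by (simp add: matrix_def vec_eq_iff inner_axis mult.commute)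

lemma Kplus2_gauss_param:
  assumes K: "Kplus2 K" and pos: "\<And>x. norm x = 1 \<Longrightarrow> tdet (supp K) x > 0"
  shows "gauss_param K (support_pt K) (support_hess K)"
proof
  note b = Kplus2_basic[OF K]
  note C2 = supp_C2[OF K]
  show "convex K" "compact K" using b by auto
  show "C1_hom0 (support_pt K) (support_hess K)" by (rule C2_hom1_gradient[OF C2])
  fix x :: "real^'a" assume x: "norm x = 1"
  then have x0: "x \<noteq> 0" by auto
  show "x \<bullet> support_hess K x v = 0" for v by (rule C2_hom1_orth[OF C2 x0])
  show "0 < x \<bullet> support_pt K x" using support_pt(2)[OF b(1,3)] supp_pos[OF b(1,4) x0] by simp
  show "0 < det (matrix (\<lambda>v. support_hess K x v + (x \<bullet> v) *\<^sub>R x))"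
    using pos[OF x] by (simp add: tdet_def Dmat1_supp[OF K x])
qed (rule support_pt_bijection[OF K])+

section \<open>Calculus of homogeneous functions, their products and their quotients\<close>

definition C2_hom0 :: "(real^'n \<Rightarrow> real) \<Rightarrow> (real^'n \<Rightarrow> real^'n) \<Rightarrow> (real^'n \<Rightarrow> real^'n \<Rightarrow> real^'n) \<Rightarrow> bool" where
  "C2_hom0 z G B \<longleftrightarrow> C2_with (- {0}) z G B \<and> (\<forall>c y. 0 < c \<longrightarrow> z (c *\<^sub>R y) = z y)"

text \<open>One of the two arguments of the weak form needs a single derivative only. This class
  admits the coordinates of the support point, which are not known to be C^2.\<close>

definition C1_grad :: "(real^'n \<Rightarrow> real) \<Rightarrow> (real^'n \<Rightarrow> real^'n) \<Rightarrow> bool" where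
  "C1_grad f F \<longleftrightarrow> (\<forall>y. y \<noteq> 0 \<longrightarrow> (f has_derivative (\<lambda>v. F y \<bullet> v)) (at y)) \<and> continuous_on (- {0}) F
     \<and> (\<forall>c y. 0 < c \<longrightarrow> f (c *\<^sub>R y) = f y)"

lemma has_derivative_innerI:
  assumes "(f has_derivative f') (at y)" "\<And>v. f' v = a \<bullet> v"
  shows "(f has_derivative (\<bullet>) a) (at y)"
proof -
  have "f' = (\<bullet>) a" using assms(2) by (rule ext)
  then show ?thesis using assms(1) by simp
qed

lemma C2_withD:
  assumes "C2_with U f G H"
  shows "y \<in> U \<Longrightarrow> (f has_derivative (\<lambda>v. G y \<bullet> v)) (at y)"
    "y \<in> U \<Longrightarrow> (G has_derivative H y) (at y)" "continuous_on U (\<lambda>x. H x v)"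
    "y \<in> U \<Longrightarrow> linear (H y)"
  using assms by (auto simp: C2_with_def has_derivative_linear)

lemma C2_with_continuous:
  assumes "C2_with U f G H"
  shows "continuous_on U f" "continuous_on U G"
  using C2_withD[OF assms] by (auto intro!: continuous_at_imp_continuous_on has_derivative_continuous)

lemma C2_hom1D: "C2_hom1 W G B \<Longrightarrow> C2_with (- {0}) W G B" by (simp add: C2_hom1_def)
lemma C2_hom0D: "C2_hom0 W G B \<Longrightarrow> C2_with (- {0}) W G B" by (simp add: C2_hom0_def)

lemma C2_hom1_linear: "C2_hom1 (\<lambda>y. y \<bullet> v) (\<lambda>_. v) (\<lambda>_ _. 0)"
proof -
  have "((\<lambda>y. y \<bullet> v) has_derivative (\<lambda>u. v \<bullet> u)) (at y)" for y
    by (simp add: inner_commute[of _ v] bounded_linear_imp_has_derivative bounded_linear_inner_right)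
  then show ?thesis by (simp add: C2_hom1_def C2_with_def)
qed

lemma C2_hom1_diff:
  assumes f: "C2_hom1 f G B" and f': "C2_hom1 f' G' B'"
  shows "C2_hom1 (\<lambda>y. f y - f' y) (\<lambda>y. G y - G' y) (\<lambda>y v. B y v - B' y v)"
  unfolding C2_hom1_def C2_with_def
proof (intro conjI ballI allI impI)
  note d = C2_withD[OF C2_hom1D[OF f]] and d' = C2_withD[OF C2_hom1D[OF f']]
  show "((\<lambda>y. f y - f' y) has_derivative (\<bullet>) (G y - G' y)) (at y)" if "y \<in> - {0}" for y
    by (rule has_derivative_innerI[OF has_derivative_diff[OF d(1)[OF that] d'(1)[OF that]]])
       (simp add: inner_diff_left)
  show "((\<lambda>y. G y - G' y) has_derivative (\<lambda>v. B y v - B' y v)) (at y)" if "y \<in> - {0}" for y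
    by (rule has_derivative_diff[OF d(2)[OF that] d'(2)[OF that]])
  show "continuous_on (- {0}) (\<lambda>y. B y v - B' y v)" for v
    by (rule continuous_on_diff[OF d(3) d'(3)])
qed (use f f' in \<open>simp add: C2_hom1_def right_diff_distrib\<close>)

lemma C2_hom1_cmul:
  assumes f: "C2_hom1 f G B"
  shows "C2_hom1 (\<lambda>y. c * f y) (\<lambda>y. c *\<^sub>R G y) (\<lambda>y v. c *\<^sub>R B y v)"
  unfolding C2_hom1_def C2_with_def
proof (intro conjI ballI allI impI)
  note d = C2_withD[OF C2_hom1D[OF f]]
  show "((\<lambda>y. c * f y) has_derivative (\<bullet>) (c *\<^sub>R G y)) (at y)" if "y \<in> - {0}" for y
    by (rule has_derivative_innerI[OF has_derivative_mult_right[OF d(1)[OF that]]]) simp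
  show "((\<lambda>y. c *\<^sub>R G y) has_derivative (\<lambda>v. c *\<^sub>R B y v)) (at y)" if "y \<in> - {0}" for y
    by (rule has_derivative_scaleR_right[OF d(2)[OF that]])
  show "continuous_on (- {0}) (\<lambda>y. c *\<^sub>R B y v)" for v
    by (rule continuous_on_scaleR[OF continuous_on_const d(3)])
qed (use f in \<open>simp add: C2_hom1_def\<close>)

text \<open>The second derivative stays existential: later arguments use the explicit gradient, but
  of the Hessian only that it exists and is continuous.\<close>

lemma C2_hom0_mult_hom1:
  assumes z: "C2_hom0 z G B" and h: "C2_hom1 h X A"
  shows "\<exists>B'. C2_hom1 (\<lambda>y. z y * h y) (\<lambda>y. z y *\<^sub>R X y + h y *\<^sub>R G y) B'"
proof -
  note dz = C2_withD[OF C2_hom0D[OF z]] C2_with_continuous[OF C2_hom0D[OF z]]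
  note dh = C2_withD[OF C2_hom1D[OF h]] C2_with_continuous[OF C2_hom1D[OF h]]
  let ?B = "\<lambda>y v. (z y *\<^sub>R A y v + (G y \<bullet> v) *\<^sub>R X y) + (h y *\<^sub>R B y v + (X y \<bullet> v) *\<^sub>R G y)"
  have "C2_hom1 (\<lambda>y. z y * h y) (\<lambda>y. z y *\<^sub>R X y + h y *\<^sub>R G y) ?B"
    unfolding C2_hom1_def C2_with_def
  proof (intro conjI ballI allI impI)
    fix y :: "real^'a" assume y: "y \<in> - {0}"
    have "((\<lambda>y. z y * h y) has_derivative (\<lambda>v. z y * (X y \<bullet> v) + (G y \<bullet> v) * h y)) (at y)"
      by (rule has_derivative_mult[OF dz(1)[OF y] dh(1)[OF y]])
    then show "((\<lambda>y. z y * h y) has_derivative (\<bullet>) (z y *\<^sub>R X y + h y *\<^sub>R G y)) (at y)"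
      by (rule has_derivative_innerI) (simp add: inner_add_left)
    show "((\<lambda>y. z y *\<^sub>R X y + h y *\<^sub>R G y) has_derivative ?B y) (at y)"
      by (rule has_derivative_add[OF has_derivative_scaleR[OF dz(1)[OF y] dh(2)[OF y]]
          has_derivative_scaleR[OF dh(1)[OF y] dz(2)[OF y]]])
  next
    show "continuous_on (- {0}) (\<lambda>y. ?B y v)" for v
      by (intro continuous_intros dz dh)
  qed (use z h in \<open>auto simp: C2_hom0_def C2_hom1_def\<close>)
  then show ?thesis by blast
qed

lemma C2_hom1_divide:
  assumes f: "C2_hom1 f G B" and h: "C2_hom1 h X A" and nz: "\<And>y. y \<noteq> 0 \<Longrightarrow> h y \<noteq> 0"
  shows "\<exists>B'. C2_hom0 (\<lambda>y. f y / h y) (\<lambda>y. inverse (h y) *\<^sub>R (G y - (f y / h y) *\<^sub>R X y)) B'"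
proof -
  note df = C2_withD[OF C2_hom1D[OF f]] C2_with_continuous[OF C2_hom1D[OF f]]
  note dh = C2_withD[OF C2_hom1D[OF h]] C2_with_continuous[OF C2_hom1D[OF h]]
  let ?g = "\<lambda>y. inverse (h y) *\<^sub>R (G y - (f y / h y) *\<^sub>R X y)"
  let ?B = "\<lambda>y v. inverse (h y) *\<^sub>R (B y v - ((f y / h y) *\<^sub>R A y v + (?g y \<bullet> v) *\<^sub>R X y))
      + (- (inverse (h y) * (X y \<bullet> v) * inverse (h y))) *\<^sub>R (G y - (f y / h y) *\<^sub>R X y)"
  have d1: "((\<lambda>y. f y / h y) has_derivative (\<bullet>) (?g y)) (at y)" if y: "y \<in> - {0}" for y
  proof -
    have "((\<lambda>y. f y / h y) has_derivative (\<lambda>v. - f y * (inverse (h y) * (X y \<bullet> v) * inverse (h y)) + (G y \<bullet> v) / h y)) (at y)"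
      by (rule has_derivative_divide[OF df(1)[OF y] dh(1)[OF y]]) (use nz y in auto)
    then show ?thesis
      by (rule has_derivative_innerI) (simp add: inner_diff_left right_diff_distrib divide_inverse mult_ac)
  qed
  have "C2_hom0 (\<lambda>y. f y / h y) ?g ?B"
    unfolding C2_hom0_def C2_with_def
  proof (intro conjI ballI allI impI)
    fix y :: "real^'a" assume y: "y \<in> - {0}"
    show "((\<lambda>y. f y / h y) has_derivative (\<bullet>) (?g y)) (at y)" by (rule d1[OF y])
    have "((\<lambda>y. inverse (h y)) has_derivative (\<lambda>v. - (inverse (h y) * (X y \<bullet> v) * inverse (h y)))) (at y)"
      by (rule Deriv.has_derivative_inverse[OF _ dh(1)[OF y]]) (use nz y in auto)
    moreover have "((\<lambda>y. G y - (f y / h y) *\<^sub>R X y) has_derivative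
        (\<lambda>v. B y v - ((f y / h y) *\<^sub>R A y v + (?g y \<bullet> v) *\<^sub>R X y))) (at y)"
      by (rule has_derivative_diff[OF df(2)[OF y] has_derivative_scaleR[OF d1[OF y] dh(2)[OF y]]])
    ultimately show "(?g has_derivative ?B y) (at y)"
      by (rule has_derivative_scaleR)
  next
    show "continuous_on (- {0}) (\<lambda>y. ?B y v)" for v
      by (intro continuous_intros df dh) (use nz in auto)
  qed (use f h in \<open>auto simp: C2_hom1_def\<close>)
  then show ?thesis by blast
qed

text \<open>Composition with \<open>sgn\<close> replaces a function given near the sphere by its
  extension of degree 0; on the sphere the new gradient is the tangential part of the old
  one.\<close>

lemma C2_on_normalize:
  assumes U: "open U" "sphere 0 1 \<subseteq> U" and z: "C2_with U z G H"
  shows "\<exists>B. C2_hom0 (\<lambda>y. z (sgn y)) (\<lambda>y. inverse (norm y) *\<^sub>R (G (sgn y) - (sgn y \<bullet> G (sgn y)) *\<^sub>R sgn y)) B"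
proof -
  note dz = C2_withD[OF z] C2_with_continuous[OF z]
  have sU: "sgn y \<in> U" if "y \<in> - {0}" for y
    using that by (intro subsetD[OF U(2)]) (simp add: norm_sgn)
  let ?S = "\<lambda>y v::real^'a. (v - (sgn y \<bullet> v) *\<^sub>R sgn y) /\<^sub>R norm y"
  let ?Q = "\<lambda>y. G (sgn y) - (sgn y \<bullet> G (sgn y)) *\<^sub>R sgn y"
  let ?H = "\<lambda>y v. H (sgn y) (?S y v)"
  let ?B = "\<lambda>y v. inverse (norm y) *\<^sub>R (?H y v - ((sgn y \<bullet> G (sgn y)) *\<^sub>R ?S y v + (sgn y \<bullet> ?H y v + ?S y v \<bullet> G (sgn y)) *\<^sub>R sgn y))
     + (- (inverse (norm y) * (sgn y \<bullet> v) * inverse (norm y))) *\<^sub>R ?Q y"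
  have csgn: "continuous_on (- {0}) (sgn :: real^'a \<Rightarrow> real^'a)"
    unfolding sgn_div_norm by (intro continuous_intros) auto
  have "C2_hom0 (\<lambda>y. z (sgn y)) (\<lambda>y. inverse (norm y) *\<^sub>R ?Q y) ?B"
    unfolding C2_hom0_def C2_with_def
  proof (intro conjI ballI allI impI)
    fix y :: "real^'a" assume y: "y \<in> - {0}"
    then have y0: "y \<noteq> 0" by simp
    note ds = sgn_has_derivative[OF y0]
    have "((\<lambda>y. z (sgn y)) has_derivative (\<lambda>v. G (sgn y) \<bullet> ?S y v)) (at y)"
      by (rule has_derivative_compose[OF ds dz(1)[OF sU[OF y]]])
    then show "((\<lambda>y. z (sgn y)) has_derivative (\<bullet>) (inverse (norm y) *\<^sub>R ?Q y)) (at y)"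
      by (rule has_derivative_innerI) (simp add: inner_diff_left inner_diff_right inner_commute mult_ac)
    have dG: "((\<lambda>y. G (sgn y)) has_derivative ?H y) (at y)"
      by (rule has_derivative_compose[OF ds dz(2)[OF sU[OF y]]])
    have "((\<lambda>y. inverse (norm y)) has_derivative (\<lambda>v. - (inverse (norm y) * (sgn y \<bullet> v) * inverse (norm y)))) (at y)"
      by (rule Deriv.has_derivative_inverse[OF _ norm_has_derivative[OF y0]]) (use y0 in simp)
    moreover have "(?Q has_derivative
        (\<lambda>v. ?H y v - ((sgn y \<bullet> G (sgn y)) *\<^sub>R ?S y v + (sgn y \<bullet> ?H y v + ?S y v \<bullet> G (sgn y)) *\<^sub>R sgn y))) (at y)"
      by (rule has_derivative_diff[OF dG has_derivative_scaleR[OF has_derivative_inner[OF ds dG] ds]])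
    ultimately show "((\<lambda>y. inverse (norm y) *\<^sub>R ?Q y) has_derivative ?B y) (at y)"
      by (rule has_derivative_scaleR)
  next
    fix v :: "real^'a"
    have cS: "continuous_on (- {0}) (\<lambda>y. ?S y v)"
      by (intro continuous_intros csgn) auto
    have cH: "continuous_on (- {0}) (\<lambda>y. ?H y v)"
      by (rule continuous_on_linear_family[where V = U, OF dz(3,4) csgn _ cS]) (use sU in auto)
    have cG: "continuous_on (- {0}) (\<lambda>y. G (sgn y))"
      by (rule continuous_on_compose2[OF dz(6) csgn]) (use sU in auto)
    show "continuous_on (- {0}) (\<lambda>y. ?B y v)"
      by (intro continuous_intros csgn cS cH cG) auto
  next
    show "z (sgn (c *\<^sub>R y)) = z (sgn y)" if "0 < c" for c y
      using that by (simp add: sgn_scaleR)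
  qed
  then show ?thesis by blast
qed

lemma C2_hom0_C1_grad: "C2_hom0 z G B \<Longrightarrow> C1_grad z G"
  unfolding C1_grad_def C2_hom0_def by (auto simp: C2_withD(1) C2_with_continuous(2))

lemma C1_grad_orth:
  assumes f: "C1_grad f F" and y: "y \<noteq> 0"
  shows "F y \<bullet> y = 0"
proof -
  have "(f has_derivative (\<lambda>v. F y \<bullet> v)) (at y)" using f y by (simp add: C1_grad_def)
  from has_derivative_along_line[OF this, of y]
  have "((\<lambda>t. f (y + t *\<^sub>R y)) has_real_derivative (F y \<bullet> y)) (at 0)" .
  moreover have "((\<lambda>t. f (y + t *\<^sub>R y)) has_real_derivative 0) (at 0)"
  proof (rule has_field_derivative_transform_within_open[where S = "{-1<..}"])
    show "((\<lambda>t. f y) has_real_derivative 0) (at 0)" by simp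
    show "f y = f (y + t *\<^sub>R y)" if "t \<in> {-1<..}" for t
    proof -
      have "f ((1 + t) *\<^sub>R y) = f y" using f that unfolding C1_grad_def by auto
      then show ?thesis by (simp add: scaleR_left_distrib)
    qed
  qed auto
  ultimately show ?thesis by (rule DERIV_unique)
qed

lemma C1_grad_scaleR:
  assumes f: "C1_grad f F" and W: "C1_hom0 w W"
  shows "C1_hom0 (\<lambda>y. f y *\<^sub>R w y) (\<lambda>y v. f y *\<^sub>R W y v + (F y \<bullet> v) *\<^sub>R w y)"
  unfolding C1_hom0_def
proof (intro conjI allI impI)
  have cf: "continuous_on (- {0}) f"
    using f by (auto simp: C1_grad_def intro!: continuous_at_imp_continuous_on has_derivative_continuous)
  have cF: "continuous_on (- {0}) F" using f by (simp add: C1_grad_def)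
  show "((\<lambda>y. f y *\<^sub>R w y) has_derivative (\<lambda>v. f y *\<^sub>R W y v + (F y \<bullet> v) *\<^sub>R w y)) (at y)" if "y \<noteq> 0" for y
    by (rule has_derivative_scaleR) (use f that C1_hom0D(1)[OF W that] in \<open>auto simp: C1_grad_def\<close>)
  show "continuous_on (- {0}) (\<lambda>y. f y *\<^sub>R W y v + (F y \<bullet> v) *\<^sub>R w y)" for v
    by (intro continuous_intros cf cF C1_hom0D(2)[OF W] C1_hom0_continuous[OF W])
  show "f (c *\<^sub>R y) *\<^sub>R w (c *\<^sub>R y) = f y *\<^sub>R w y" if "0 < c" for c y
    using f that C1_hom0D(3)[OF W that] by (simp add: C1_grad_def)
qed

lemma C1_grad_continuous:
  assumes "C1_grad f F"
  shows "continuous_on (sphere 0 1) f" "continuous_on (sphere 0 1) F"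
proof -
  have "continuous_on (- {0}) f"
    using assms by (auto simp: C1_grad_def intro!: continuous_at_imp_continuous_on has_derivative_continuous)
  then show "continuous_on (sphere 0 1) f" by (rule continuous_on_subset[OF _ sphere_not_0])
  show "continuous_on (sphere 0 1) F"
    using assms by (auto simp: C1_grad_def intro: continuous_on_subset[OF _ sphere_not_0])
qed

section \<open>The Hilbert-Brunn-Minkowski operator\<close>

locale hbm_body =
  fixes K :: "(real^'n) set"
  assumes Kplus2: "Kplus2 K" and tdet_pos: "\<And>x. norm x = 1 \<Longrightarrow> 0 < tdet (supp K) x"
    and dim: "CARD('n) \<ge> 2"

sublocale hbm_body \<subseteq> gauss_param K "support_pt K" "support_hess K"
  by (rule Kplus2_gauss_param[OF Kplus2 tdet_pos])

context hbm_body
begin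

abbreviation h :: "real^'n \<Rightarrow> real" where "h \<equiv> supp K"
abbreviation Xs :: "real^'n \<Rightarrow> real^'n" where "Xs \<equiv> support_pt K"
abbreviation A :: "real^'n \<Rightarrow> real^'n \<Rightarrow> real^'n" where "A \<equiv> support_hess K"
abbreviation M :: "real^'n \<Rightarrow> real^'n^'n" where "M \<equiv> Dmat1 (supp K)"

definition wt :: "real^'n \<Rightarrow> real" where "wt x = h x * d1 x / real CARD('n)"

lemma n_gt_1: "real CARD('n) > 1" using dim by simp

lemmas C2h = supp_C2[OF Kplus2]

lemma nz: "norm x = 1 \<Longrightarrow> x \<noteq> (0 :: real^'n)" by auto

lemma h_gt_0: "y \<noteq> 0 \<Longrightarrow> 0 < h y"
  by (rule supp_pos[OF Kplus2_basic(1,4)[OF Kplus2]])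

lemma inner_Xs: "y \<bullet> Xs y = h y"
  by (rule support_pt(2)[OF Kplus2_basic(1,3)[OF Kplus2]])

lemma tdet_eq: "norm x = 1 \<Longrightarrow> tdet h x = d1 x"
  by (simp add: tdet_def d1_def Dmat1_supp[OF Kplus2])

lemma d1_gt_0: "norm x = 1 \<Longrightarrow> 0 < d1 x"
  using tdet_pos tdet_eq by simp

lemma det_M: "norm x = 1 \<Longrightarrow> det (M x) = d1 x"
  using tdet_eq by (simp add: tdet_def)

lemma wt_pos: "norm x = 1 \<Longrightarrow> 0 < wt x"
  using d1_gt_0 h_gt_0 nz by (simp add: wt_def)

lemma A_sym: "norm x = 1 \<Longrightarrow> A x u \<bullet> v = A x v \<bullet> u"
  by (rule C2_hom1_symmetric[OF C2h nz])

lemma A_radial: "norm x = 1 \<Longrightarrow> A x x = 0"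
  by (rule C1_hom0_derivative_radial[OF X nz])

lemma M_mult: "norm x = 1 \<Longrightarrow> M x *v u = A x u + (x \<bullet> u) *\<^sub>R x"
proof -
  assume x: "norm x = 1"
  have "linear (\<lambda>v. A x v + (x \<bullet> v) *\<^sub>R x)"
    using A_linear[OF nz[OF x]] by (auto intro!: linearI simp: linear_add linear_scale algebra_simps inner_add_right)
  then show ?thesis by (simp add: Dmat1_supp[OF Kplus2 x] matrix_works_real)
qed

lemma M_sym: "norm x = 1 \<Longrightarrow> (M x *v u) \<bullet> v = u \<bullet> (M x *v v)"
  using A_sym[of x u v] by (simp add: M_mult inner_add_left inner_add_right inner_commute)

abbreviation Minv :: "real^'n \<Rightarrow> real^'n \<Rightarrow> real^'n" where "Minv x v \<equiv> matrix_inv (M x) *v v"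

lemma M_Minv: assumes "norm x = 1" shows "M x *v Minv x v = v" "Minv x (M x *v v) = v"
  using matrix_inv_inverse[of "M x"] det_M[OF assms] d1_gt_0[OF assms]
  by (simp_all add: matrix_vector_mul_assoc)

lemma Minv_sym: "norm x = 1 \<Longrightarrow> u \<bullet> Minv x v = Minv x u \<bullet> v"
  using M_sym[of x "Minv x u" "Minv x v"] by (simp add: M_Minv)

text \<open>With \<open>v = M x *v u\<close> the quadratic form becomes that of the Hessian at
  \<open>u\<close> plus a square.\<close>

lemma Minv_nonneg: assumes x: "norm x = 1" shows "0 \<le> v \<bullet> Minv x v"
proof -
  let ?u = "Minv x v"
  have "v \<bullet> ?u = A x ?u \<bullet> ?u + (x \<bullet> ?u)\<^sup>2"
    using M_mult[OF x, of ?u] M_Minv(1)[OF x, of v]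
    by (metis inner_add_left inner_scaleR_left power2_eq_square)
  then show ?thesis using support_hess_psd[OF Kplus2 nz[OF x]] by simp
qed

lemma Minv_tangent:
  assumes x: "norm x = 1" and v: "x \<bullet> v = 0"
  shows "x \<bullet> Minv x v = 0" "A x (Minv x v) = v"
proof -
  have xx: "x \<bullet> x = 1" using x by (simp add: norm_eq_1)
  have e: "A x (Minv x v) + (x \<bullet> Minv x v) *\<^sub>R x = v"
    using M_mult[OF x] M_Minv(1)[OF x] by metis
  then have "x \<bullet> (A x (Minv x v) + (x \<bullet> Minv x v) *\<^sub>R x) = 0" using v by simp
  then show "x \<bullet> Minv x v = 0" by (simp add: inner_add_right A_orth[OF x] xx)
  then show "A x (Minv x v) = v" using e by simp
qed

lemma Minv_A: assumes x: "norm x = 1" shows "Minv x (A x v) = v - (x \<bullet> v) *\<^sub>R x"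
proof -
  have xx: "x \<bullet> x = 1" using x by (simp add: norm_eq_1)
  have "M x *v (v - (x \<bullet> v) *\<^sub>R x) = A x v"
    using A_linear[OF nz[OF x]]
    by (simp add: M_mult[OF x] linear_diff linear_scale A_radial[OF x] inner_diff_right xx)
  then show ?thesis using M_Minv(2)[OF x] by metis
qed

lemma J_M: assumes x: "norm x = 1" and v: "x \<bullet> v = 0" shows "J x *v Minv x v = v"
  by (simp add: J_mult[OF x] Minv_tangent[OF x v])

lemma det_J': "norm x = 1 \<Longrightarrow> det (J x) = h x * d1 x"
  by (simp add: det_J inner_Xs)

lemma Jinv_unique: assumes x: "norm x = 1" and e: "J x *v u = v" shows "matrix_inv (J x) *v v = u"
proof -
  have "det (J x) \<noteq> 0" using det_J_pos[OF x] by simp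
  then show ?thesis using e matrix_inv_inverse(2)[of "J x"]
    by (metis matrix_vector_mul_assoc matrix_vector_mul_lid)
qed

text \<open>The matrices \<open>J x\<close> and \<open>M x\<close> send the normal \<open>x\<close>
  to different vectors but agree on tangent vectors; hence their inverses agree on the range of a
  tangential map.\<close>

lemma ddet_J_hess:
  assumes x: "norm x = 1" and B: "linear B" "\<And>v. x \<bullet> B v = 0"
  shows "ddet (J x) (matrix B) = h x * d1 x * trace (matrix_inv (M x) ** matrix B)"
proof -
  have "matrix_inv (J x) ** matrix B = matrix_inv (M x) ** matrix B"
  proof (subst matrix_eq, intro allI)
    fix v
    have "matrix_inv (J x) *v B v = Minv x (B v)"
      by (rule Jinv_unique[OF x J_M[OF x B(2)]])
    then show "(matrix_inv (J x) ** matrix B) *v v = (matrix_inv (M x) ** matrix B) *v v"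
      by (simp only: matrix_vector_mul_assoc[symmetric] matrix_works_real[OF B(1)])
  qed
  moreover have "det (J x) \<noteq> 0" using det_J_pos[OF x] by simp
  ultimately show ?thesis by (simp add: ddet_eq_trace det_J'[OF x])
qed

text \<open>By the quotient rule this is the gradient of \<open>\<phi> y / h y\<close> when
  \<open>G\<close> is the gradient of \<open>\<phi>\<close>.\<close>

definition gr :: "(real^'n \<Rightarrow> real) \<Rightarrow> (real^'n \<Rightarrow> real^'n) \<Rightarrow> real^'n \<Rightarrow> real^'n" where
  "gr \<phi> G y = inverse (h y) *\<^sub>R (G y - (\<phi> y / h y) *\<^sub>R Xs y)"

text \<open>Split \<open>G x\<close> into \<open>h x\<close> times the tangential vector
  \<open>gr \<phi> G x\<close> and a multiple of \<open>Xs x\<close>. The inverse of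
  \<open>J x\<close> acts on the first part as \<open>Minv x\<close> and sends \<open>Xs x\<close>
  to \<open>x\<close>, which is orthogonal to \<open>F\<close>.\<close>

lemma ddet_J_rank_one:
  assumes x: "norm x = 1" and F: "F \<bullet> x = 0" and G: "x \<bullet> G x = \<phi> x"
  shows "ddet (J x) (matrix (\<lambda>v. (F \<bullet> v) *\<^sub>R G x)) = h x * d1 x * (h x * (F \<bullet> Minv x (gr \<phi> G x)))"
proof -
  have xx: "x \<bullet> x = 1" using x by (simp add: norm_eq_1)
  have hx: "h x \<noteq> 0" using h_gt_0[OF nz[OF x]] by simp
  let ?g = "gr \<phi> G x"
  have t: "x \<bullet> ?g = 0" using hx by (simp add: gr_def inner_diff_right G inner_Xs)
  let ?u = "h x *\<^sub>R Minv x ?g + (\<phi> x / h x) *\<^sub>R x"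
  have "J x *v ?u = h x *\<^sub>R (J x *v Minv x ?g) + (\<phi> x / h x) *\<^sub>R (J x *v x)"
    by (simp add: matrix_vector_right_distrib matrix_vector_mult_scaleR)
  also have "\<dots> = h x *\<^sub>R ?g + (\<phi> x / h x) *\<^sub>R Xs x"
    by (simp add: J_M[OF x t] J_mult[OF x, of x] A_radial[OF x] xx)
  also have "\<dots> = G x" using hx by (simp add: gr_def)
  finally have "matrix_inv (J x) *v G x = ?u" by (rule Jinv_unique[OF x])
  moreover have "det (J x) \<noteq> 0" using det_J_pos[OF x] by simp
  ultimately show ?thesis
    by (simp add: ddet_eq_trace trace_rank_one det_J'[OF x] inner_add_right F)
qed

text \<open>The density of the Dirichlet form of the Hilbert-Brunn-Minkowski operator, evaluated on
  two gradient fields.\<close>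

definition Gam :: "(real^'n \<Rightarrow> real^'n) \<Rightarrow> (real^'n \<Rightarrow> real^'n) \<Rightarrow> real^'n \<Rightarrow> real" where
  "Gam F F' x = h x / (real CARD('n) - 1) * (F x \<bullet> Minv x (F' x))"

lemma Gam_nonneg: "norm x = 1 \<Longrightarrow> 0 \<le> Gam F F x"
proof -
  assume x: "norm x = 1"
  have "0 \<le> h x / (real CARD('n) - 1)"
    using n_gt_1 h_gt_0[OF nz[OF x]] by (intro divide_nonneg_nonneg) auto
  then show ?thesis unfolding Gam_def by (rule mult_nonneg_nonneg[OF _ Minv_nonneg[OF x]])
qed

lemma h_nonzero_sphere: "\<forall>x\<in>sphere 0 1. h x \<noteq> 0"
proof
  fix x :: "real^'n" assume "x \<in> sphere 0 1"
  then have "x \<noteq> 0" by auto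
  then show "h x \<noteq> 0" using h_gt_0[of x] by simp
qed

lemma continuous_on_h: "continuous_on (sphere 0 1) h"
  by (rule continuous_on_subset[OF C2_with_continuous(1)[OF C2_hom1D[OF C2h]] sphere_not_0])

lemma continuous_on_Xs: "continuous_on (sphere 0 1) Xs"
  by (rule continuous_on_subset[OF C2_with_continuous(2)[OF C2_hom1D[OF C2h]] sphere_not_0])

lemma continuous_on_A: "continuous_on (sphere 0 1) (\<lambda>x. A x v)"
  by (rule continuous_on_subset[OF C2_withD(3)[OF C2_hom1D[OF C2h]] sphere_not_0])

lemma continuous_on_wt: "continuous_on (sphere 0 1) wt"
  unfolding wt_def by (intro continuous_intros continuous_on_h continuous_on_d1) simp

lemma continuous_on_Minv:
  assumes "continuous_on (sphere 0 1) F"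
  shows "continuous_on (sphere 0 1) (\<lambda>x. Minv x (F x))"
proof (rule continuous_on_matrix_inv_mult)
  show "continuous_on (sphere 0 1) (\<lambda>x. M x $ i $ j)" for i j
  proof -
    have "continuous_on (sphere 0 1) (\<lambda>x. A x (axis j 1) $ i + x $ j * x $ i)"
      by (intro continuous_intros continuous_on_component continuous_on_A)
    then show ?thesis
      by (rule continuous_on_eq) (simp add: Dmat1_supp[OF Kplus2] matrix_def inner_axis)
  qed
  show "continuous_on (sphere 0 1) (\<lambda>x. F x $ i)" for i using assms by (rule continuous_on_component)
  show "det (M x) \<noteq> 0" if "x \<in> sphere 0 1" for x using det_M d1_gt_0 that by force
qed

lemma continuous_on_Gam:
  assumes "continuous_on (sphere 0 1) F" "continuous_on (sphere 0 1) F'"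
  shows "continuous_on (sphere 0 1) (Gam F F')"
  unfolding Gam_def using n_gt_1
  by (intro continuous_intros continuous_on_h continuous_on_Minv assms) auto

section \<open>Integrals against the cone-volume measure and the weak form of the operator\<close>

lemma cv_eq: "cv_int K f = sph_int (\<lambda>x. f x * wt x)"
  unfolding cv_int_def by (rule sph_int_cong) (simp add: wt_def tdet_eq)

lemma cv_cong: "(\<And>x. norm x = 1 \<Longrightarrow> f x = g x) \<Longrightarrow> cv_int K f = cv_int K g"
  unfolding cv_eq by (rule sph_int_cong) simp

lemma cv_add:
  assumes "continuous_on (sphere 0 1) f" "continuous_on (sphere 0 1) g"
  shows "cv_int K (\<lambda>x. f x + g x) = cv_int K f + cv_int K g"
  unfolding cv_eq distrib_right by (intro sph_int_add continuous_intros assms continuous_on_wt)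

lemma cv_diff:
  assumes "continuous_on (sphere 0 1) f" "continuous_on (sphere 0 1) g"
  shows "cv_int K (\<lambda>x. f x - g x) = cv_int K f - cv_int K g"
  unfolding cv_eq left_diff_distrib by (intro sph_int_diff continuous_intros assms continuous_on_wt)

lemma cv_cmul: "cv_int K (\<lambda>x. c * f x) = c * cv_int K f"
  unfolding cv_eq mult.assoc by (rule sph_int_cmul)

lemma cv_sum:
  assumes "finite I" "\<And>i. i \<in> I \<Longrightarrow> continuous_on (sphere 0 1) (f i)"
  shows "cv_int K (\<lambda>x. \<Sum>i\<in>I. f i x) = (\<Sum>i\<in>I. cv_int K (f i))"
  unfolding cv_eq sum_distrib_right by (intro sph_int_sum continuous_intros assms continuous_on_wt)

lemma cv_zero: "cv_int K (\<lambda>x. 0) = 0"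
  using cv_cmul[of 0 "\<lambda>_. 0"] by simp

lemma cv_nonneg:
  assumes "continuous_on (sphere 0 1) f" "\<And>x. norm x = 1 \<Longrightarrow> 0 \<le> f x"
  shows "0 \<le> cv_int K f"
proof -
  have "sph_int (\<lambda>x::real^'n. 0) \<le> sph_int (\<lambda>x. f x * wt x)"
    by (intro sph_int_mono continuous_intros continuous_on_wt assms(1)
        mult_nonneg_nonneg[OF assms(2) less_imp_le[OF wt_pos]])
  then show ?thesis using sph_int_cmul[of 0 "\<lambda>_::real^'n. 0"] by (simp add: cv_eq)
qed

lemma cv_eq_0:
  assumes "continuous_on (sphere 0 1) f" "\<And>x. norm x = 1 \<Longrightarrow> 0 \<le> f x" "cv_int K f \<le> 0" "norm x = 1"
  shows "f x = 0"
proof -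
  have "f x * wt x = 0"
    by (rule sph_int_nonneg_eq_0[of "\<lambda>x. f x * wt x"])
       (use assms wt_pos in \<open>auto simp: cv_eq less_imp_le intro!: continuous_intros continuous_on_wt\<close>)
  then show ?thesis using wt_pos[OF assms(4)] by simp
qed

lemma cv_tendsto:
  assumes "\<And>m. continuous_on (sphere 0 1) (f m)" "continuous_on (sphere 0 1) g"
    "\<And>x. norm x = 1 \<Longrightarrow> (\<lambda>m. f m x) \<longlonglongrightarrow> g x"
    "\<And>m x. norm x = 1 \<Longrightarrow> \<bar>f m x\<bar> \<le> C"
  shows "(\<lambda>m. cv_int K (f m)) \<longlonglongrightarrow> cv_int K g"
proof -
  obtain D where D: "\<And>x. x \<in> sphere 0 1 \<Longrightarrow> norm (wt x) \<le> D"
    using sphere_bounded[OF continuous_on_wt] by blast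
  show ?thesis unfolding cv_eq
  proof (rule sph_int_tendsto[where C = "C * D"])
    fix m and x :: "real^'n" assume x: "norm x = 1"
    show "\<bar>f m x * wt x\<bar> \<le> C * D"
      unfolding abs_mult using assms(4)[OF x, of m] D[of x] x
      by (intro mult_mono) auto
  qed (use assms in \<open>auto intro!: continuous_intros continuous_on_wt tendsto_mult_right\<close>)
qed

lemma HBM_eq:
  assumes \<phi>: "C2_hom1 \<phi> G B" and z: "\<And>y. norm y = 1 \<Longrightarrow> z y * h y = \<phi> y" and x: "norm x = 1"
  shows "HBM K z x = trace (matrix_inv (M x) ** matrix (B x)) / (real CARD('n) - 1) - z x"
proof -
  have "Dmat (\<lambda>y. z y * h y) x = matrix (B x)" by (rule Dmat_hom1[OF \<phi> x z])
  then show ?thesis by (simp add: HBM_def ttr_def)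
qed

text \<open>The divergence identity for the field \<open>f\<close> times the gradient of
  \<open>\<phi>\<close>: the product rule yields the trace term of the operator and the Dirichlet
  term, and the normal component of the field, \<open>f * \<phi>\<close> by Euler's relation, yields
  the zeroth-order term.\<close>

theorem weak_form:
  assumes f: "C1_grad f F" and \<phi>: "C2_hom1 \<phi> G B" and z: "\<And>y. norm y = 1 \<Longrightarrow> z y * h y = \<phi> y"
  shows "cv_int K (\<lambda>x. f x * (- HBM K z x)) = cv_int K (Gam F (gr \<phi> G))"
proof -
  note G = C2_hom1_gradient[OF \<phi>]
  let ?w = "\<lambda>y. f y *\<^sub>R G y" and ?W = "\<lambda>y v. f y *\<^sub>R B y v + (F y \<bullet> v) *\<^sub>R G y"
  have w: "C1_hom0 ?w ?W" by (rule C1_grad_scaleR[OF f G])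
  let ?P = "\<lambda>x. ddet (J x) (matrix (?W x))" and ?Q = "\<lambda>x. d1 x * (x \<bullet> ?w x)"
  have PQ: "sph_int ?P = (real CARD('n) - 1) * sph_int ?Q" by (rule divergence_identity[OF w])
  have cP: "continuous_on (sphere 0 1) ?P"
    by (intro continuous_on_ddet continuous_on_coeff2 continuous_on_J continuous_on_matrix_derivative[OF w])
  have cQ: "continuous_on (sphere 0 1) ?Q"
    by (intro continuous_intros continuous_on_d1 continuous_on_subset[OF C1_hom0_continuous[OF w] sphere_not_0])
  have cgr: "continuous_on (sphere 0 1) (gr \<phi> G)"
    unfolding gr_def
    by (intro continuous_intros continuous_on_h continuous_on_Xs
        continuous_on_subset[OF C2_with_continuous(1)[OF C2_hom1D[OF \<phi>]] sphere_not_0]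
        continuous_on_subset[OF C2_with_continuous(2)[OF C2_hom1D[OF \<phi>]] sphere_not_0])
      (rule h_nonzero_sphere)+
  have cGam: "continuous_on (sphere 0 1) (\<lambda>x. Gam F (gr \<phi> G) x * wt x)"
    by (intro continuous_intros continuous_on_Gam continuous_on_wt C1_grad_continuous(2)[OF f] cgr)
  \<comment> \<open>The coefficients of \<open>?Q\<close> and \<open>?P\<close> stand in the ratio
    for which their integrals cancel by the divergence identity.\<close>
  have pw: "f x * (- HBM K z x) * wt x = Gam F (gr \<phi> G) x * wt x + (1 / real CARD('n) * ?Q x - 1 / (real CARD('n) * (real CARD('n) - 1)) * ?P x)"
    if x: "norm x = 1" for x
  proof -
    have B: "linear (B x)" "\<And>v. x \<bullet> B x v = 0"
      using C1_hom0D(4)[OF G nz[OF x]] C2_hom1_orth[OF \<phi> nz[OF x]] by auto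
    have Gx: "x \<bullet> G x = \<phi> x" using C2_hom1_euler[OF \<phi> nz[OF x]] by (simp add: inner_commute)
    let ?tr = "trace (matrix_inv (M x) ** matrix (B x))"
    let ?ip = "F x \<bullet> Minv x (gr \<phi> G x)"
    have "matrix (?W x) = f x *\<^sub>R matrix (B x) + matrix (\<lambda>v. (F x \<bullet> v) *\<^sub>R G x)"
      by (simp add: matrix_def vec_eq_iff)
    then have P: "?P x = f x * (h x * d1 x * ?tr) + h x * d1 x * (h x * ?ip)"
      by (simp only: ddet_add ddet_scaleR ddet_J_hess[OF x B]
          ddet_J_rank_one[OF x C1_grad_orth[OF f nz[OF x]], of G \<phi>, OF Gx])
    have Q: "?Q x = d1 x * (f x * (z x * h x))" using Gx z[OF x] by simp
    have n: "real CARD('n) \<noteq> 0" "real CARD('n) - 1 \<noteq> 0" using n_gt_1 by auto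
    have H: "HBM K z x = ?tr / (real CARD('n) - 1) - z x" by (rule HBM_eq[OF \<phi> z x])
    have alg: "f * (- (t / k - z)) * (h * d / n) = h / k * ip * (h * d / n)
        + (1 / n * (d * (f * (z * h))) - 1 / (n * k) * (f * (h * d * t) + h * d * (h * ip)))"
      if "n \<noteq> 0" "k \<noteq> 0" for f t k z h d n ip :: real
      using that by (simp add: divide_simps) (simp add: algebra_simps)
    show ?thesis
      unfolding P Q H Gam_def wt_def by (rule alg[OF n])
  qed
  have "cv_int K (\<lambda>x. f x * (- HBM K z x)) = sph_int (\<lambda>x. Gam F (gr \<phi> G) x * wt x + (1 / real CARD('n) * ?Q x - 1 / (real CARD('n) * (real CARD('n) - 1)) * ?P x))"
    unfolding cv_eq by (rule sph_int_cong) (rule pw)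
  also have "\<dots> = cv_int K (Gam F (gr \<phi> G)) + (1 / real CARD('n) * sph_int ?Q - 1 / (real CARD('n) * (real CARD('n) - 1)) * sph_int ?P)"
    unfolding cv_eq sph_int_cmul[symmetric]
    by (subst sph_int_add, (intro cGam continuous_intros cP cQ)+, subst sph_int_diff) (intro continuous_intros cP cQ refl)+
  also have "1 / real CARD('n) * sph_int ?Q - 1 / (real CARD('n) * (real CARD('n) - 1)) * sph_int ?P = 0"
    unfolding PQ using n_gt_1 by simp
  finally show ?thesis by simp
qed

end

section \<open>The spectral inequality\<close>

context hbm_body
begin

abbreviation V :: real where "V \<equiv> cv_int K (\<lambda>x. 1)"
abbreviation \<rho> :: real where "\<rho> \<equiv> cv_int K (\<lambda>x. 1 / (h x)\<^sup>2)"

text \<open>The gradient of \<open>ellv K v\<close>, as a quotient of the linear function by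
  \<open>h\<close>.\<close>

definition gl :: "real^'n \<Rightarrow> real^'n \<Rightarrow> real^'n" where
  "gl v = gr (\<lambda>y. y \<bullet> v) (\<lambda>_. v)"

lemma h_pos_sphere: "norm x = 1 \<Longrightarrow> 0 < h x"
  by (rule h_gt_0[OF nz])

lemma continuous_on_ellv: "continuous_on (sphere 0 1) (ellv K v)"
  unfolding ellv_def by (intro continuous_intros continuous_on_h h_nonzero_sphere)

lemma cv_pos:
  assumes f: "continuous_on (sphere 0 1) f" "\<And>x. norm x = 1 \<Longrightarrow> 0 < f x"
  shows "0 < cv_int K f"
proof (rule ccontr)
  assume "\<not> 0 < cv_int K f"
  then have le: "cv_int K f \<le> 0" by simp
  obtain x :: "real^'n" where x: "norm x = 1" using vector_choose_size[of 1] by auto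
  have "f x = 0" by (rule cv_eq_0[OF f(1) less_imp_le[OF f(2)] le x])
  then show False using f(2)[OF x] by simp
qed

lemma V_pos: "0 < V" by (rule cv_pos) auto

lemma continuous_on_inv_h2: "continuous_on (sphere 0 1) (\<lambda>x. 1 / (h x)\<^sup>2)"
  using h_nonzero_sphere by (intro continuous_intros continuous_on_h) auto

lemma \<rho>_pos: "0 < \<rho>"
proof (rule cv_pos[OF continuous_on_inv_h2])
  fix x :: "real^'n" assume "norm x = 1"
  from h_pos_sphere[OF this] show "0 < 1 / (h x)\<^sup>2" by simp
qed

lemma C1_grad_quot:
  assumes \<phi>: "C2_hom1 \<phi> G B"
  shows "C1_grad (\<lambda>y. \<phi> y / h y) (gr \<phi> G)"
    and "\<exists>B'. C2_hom0 (\<lambda>y. \<phi> y / h y) (gr \<phi> G) B'"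
proof -
  have "\<And>y. y \<noteq> 0 \<Longrightarrow> h y \<noteq> 0" using h_gt_0 by fastforce
  then show ex: "\<exists>B'. C2_hom0 (\<lambda>y. \<phi> y / h y) (gr \<phi> G) B'"
    using C2_hom1_divide[OF \<phi> C2h] unfolding gr_def by blast
  then show "C1_grad (\<lambda>y. \<phi> y / h y) (gr \<phi> G)" using C2_hom0_C1_grad by blast
qed

text \<open>Multiplied by \<open>h\<close>, the function \<open>ellv K v\<close> is linear and has
  zero Hessian, so it is an eigenfunction with eigenvalue 1; the weak form expresses this against
  any C^1 function.\<close>

lemma weak_ellv:
  assumes f: "C1_grad f F"
  shows "cv_int K (\<lambda>x. f x * ellv K v x) = cv_int K (Gam F (gl v))"
proof -
  have z: "ellv K v y * h y = y \<bullet> v" if "norm y = 1" for y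
    using h_pos_sphere[OF that] by (simp add: ellv_def)
  have H: "HBM K (ellv K v) x = - ellv K v x" if x: "norm x = 1" for x
  proof -
    have "matrix (\<lambda>_::real^'n. 0 :: real^'n) = 0" by (simp add: matrix_def vec_eq_iff)
    then show ?thesis
      using HBM_eq[OF C2_hom1_linear z x] by (simp add: trace_def matrix_matrix_mult_def)
  qed
  have "cv_int K (\<lambda>x. f x * ellv K v x) = cv_int K (\<lambda>x. f x * (- HBM K (ellv K v) x))"
    by (rule cv_cong) (simp add: H)
  also have "\<dots> = cv_int K (Gam F (gl v))"
    unfolding gl_def by (rule weak_form[OF f C2_hom1_linear z])
  finally show ?thesis .
qed

text \<open>Testing the eigenvalue relation with a constant function, whose gradient
  vanishes.\<close>

lemma cv_ellv: "cv_int K (ellv K v) = 0"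
proof -
  have "C1_grad (\<lambda>_. 1) (\<lambda>_. 0 :: real^'n)" by (simp add: C1_grad_def)
  from weak_ellv[OF this, of v] have "cv_int K (ellv K v) = cv_int K (Gam (\<lambda>_. 0) (gl v))" by simp
  also have "Gam (\<lambda>_. 0) (gl v) = (\<lambda>_. 0)" by (simp add: Gam_def fun_eq_iff)
  finally show ?thesis by (simp add: cv_zero)
qed

lemma ellv_add: "ellv K (u + v) x = ellv K u x + ellv K v x"
  by (simp add: ellv_def inner_add_right add_divide_distrib)

lemma ellv_scale: "ellv K (c *\<^sub>R v) x = c * ellv K v x"
  by (simp add: ellv_def)

lemma ellv_expand: "ellv K v x = (\<Sum>i\<in>UNIV. v $ i * ellv K (axis i 1) x)"
  by (simp only: ellv_def inner_axis) (simp add: inner_vec_def sum_divide_distrib mult.commute)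

lemma cv_mult_ellv:
  assumes z: "continuous_on (sphere 0 1) z"
  shows "cv_int K (\<lambda>x. z x * ellv K v x) = (\<chi> i. cv_int K (\<lambda>x. z x * ellv K (axis i 1) x)) \<bullet> v"
proof -
  have "cv_int K (\<lambda>x. z x * ellv K v x) = cv_int K (\<lambda>x. \<Sum>i\<in>UNIV. v $ i * (z x * ellv K (axis i 1) x))"
    by (rule cv_cong) (simp add: ellv_expand[of v] sum_distrib_left mult_ac)
  also have "\<dots> = (\<Sum>i\<in>UNIV. v $ i * cv_int K (\<lambda>x. z x * ellv K (axis i 1) x))"
    by (subst cv_sum) (auto simp: cv_cmul intro!: continuous_intros z continuous_on_ellv)
  finally show ?thesis by (simp add: inner_vec_def mult.commute)
qed

lemma S2_int_eq: "S2_int K f = real CARD('n) * cv_int K (\<lambda>x. f x / (h x)\<^sup>2)"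
  unfolding cv_eq S2_int_def sph_int_cmul[symmetric]
proof (rule sph_int_cong)
  fix x :: "real^'n" assume x: "norm x = 1"
  show "f x * tdet h x / h x = real CARD('n) * (f x / (h x)\<^sup>2 * wt x)"
    using h_pos_sphere[OF x] by (simp add: wt_def tdet_eq[OF x] power2_eq_square)
qed

text \<open>The measure S_2 K has density n/h^2 with respect to the cone-volume measure, so isotropy
  is a statement about squares of the \<open>ellv K w\<close>; polarisation gives the mixed
  integrals.\<close>

lemma isotropic_ellv:
  assumes iso: "S2_isotropic K"
  shows "cv_int K (\<lambda>x. ellv K u x * ellv K v x) = \<rho> / real CARD('n) * (u \<bullet> v)"
proof -
  have sq: "cv_int K (\<lambda>x. (ellv K w x)\<^sup>2) = \<rho> / real CARD('n) * (w \<bullet> w)" for w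
  proof -
    have "S2_int K (\<lambda>x. (x \<bullet> w)\<^sup>2) = S2_int K (\<lambda>x. 1) / real CARD('n) * (w \<bullet> w)"
      using iso by (simp add: S2_isotropic_def power2_norm_eq_inner)
    then have "cv_int K (\<lambda>x. (x \<bullet> w)\<^sup>2 / (h x)\<^sup>2) = \<rho> / real CARD('n) * (w \<bullet> w)"
      unfolding S2_int_eq by (simp add: nonzero_eq_divide_eq mult.commute)
    then show ?thesis by (simp add: ellv_def power_divide)
  qed
  have c: "continuous_on (sphere 0 1) (\<lambda>x. (ellv K w x)\<^sup>2)" for w
    by (intro continuous_intros continuous_on_ellv)
  have "cv_int K (\<lambda>x. ellv K u x * ellv K v x) = cv_int K (\<lambda>x. 1/4 * ((ellv K (u + v) x)\<^sup>2 - (ellv K (u - v) x)\<^sup>2))"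
  proof (rule cv_cong)
    fix x
    have e: "ellv K (u - v) x = ellv K u x - ellv K v x"
      using ellv_add[of u "- 1 *\<^sub>R v" x] ellv_scale[of "-1" v x] by simp
    show "ellv K u x * ellv K v x = 1/4 * ((ellv K (u + v) x)\<^sup>2 - (ellv K (u - v) x)\<^sup>2)"
      unfolding ellv_add e by (simp add: power2_eq_square algebra_simps)
  qed
  also have "\<dots> = 1/4 * (\<rho> / real CARD('n) * ((u + v) \<bullet> (u + v)) - \<rho> / real CARD('n) * ((u - v) \<bullet> (u - v)))"
    unfolding cv_cmul cv_diff[OF c c] sq ..
  also have "\<dots> = \<rho> / real CARD('n) * (u \<bullet> v)"
  proof -
    have "(u + v) \<bullet> (u + v) - (u - v) \<bullet> (u - v) = 4 * (u \<bullet> v)"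
      by (simp add: inner_add_left inner_add_right inner_diff_left inner_diff_right inner_commute)
    then show ?thesis by (simp only: right_diff_distrib[symmetric])
  qed
  finally show ?thesis .
qed

text \<open>Brings an arbitrary C^2 function near the sphere into the quotient form
  \<open>\<phi> / h\<close> on which the weak form operates; on the sphere the gradient of the
  quotient is the tangential gradient.\<close>

lemma C2_on_extend:
  assumes U: "sphere 0 1 \<subseteq> U" and z: "C2_with U z G H" and op: "open U"
  shows "\<exists>\<phi> G' B. C2_hom1 \<phi> G' B \<and>
    (\<forall>x. norm x = 1 \<longrightarrow> \<phi> x / h x = z x \<and> gr \<phi> G' x = G x - (x \<bullet> G x) *\<^sub>R x)"
proof -
  let ?Gz = "\<lambda>y. inverse (norm y) *\<^sub>R (G (sgn y) - (sgn y \<bullet> G (sgn y)) *\<^sub>R sgn y)"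
  obtain B where "C2_hom0 (\<lambda>y. z (sgn y)) ?Gz B"
    using C2_on_normalize[OF op U z] by blast
  from C2_hom0_mult_hom1[OF this C2h] obtain B' where
    B': "C2_hom1 (\<lambda>y. z (sgn y) * h y) (\<lambda>y. z (sgn y) *\<^sub>R Xs y + h y *\<^sub>R ?Gz y) B'" by blast
  show ?thesis
  proof (rule exI, rule exI, rule exI, rule conjI[OF B'], intro allI impI conjI)
    fix x :: "real^'n" assume x: "norm x = 1"
    have sx: "sgn x = x" using x by (simp add: sgn_div_norm)
    have hx: "h x \<noteq> 0" using h_pos_sphere[OF x] by simp
    show "z (sgn x) * h x / h x = z x" using hx sx by simp
    show "gr (\<lambda>y. z (sgn y) * h y) (\<lambda>y. z (sgn y) *\<^sub>R Xs y + h y *\<^sub>R ?Gz y) x = G x - (x \<bullet> G x) *\<^sub>R x"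
      using hx by (simp add: gr_def sx x)
  qed
qed

text \<open>Provides a lower bound for all Rayleigh quotients, so that the real-valued
  \<open>Inf\<close> in \<open>lambda2\<close> is a genuine infimum and bounds each quotient from
  below.\<close>

lemma quotient_nonneg:
  assumes "admissible K z"
  shows "0 \<le> cv_int K (\<lambda>x. z x * (- HBM K z x)) / cv_int K (\<lambda>x. (z x)\<^sup>2)"
proof -
  obtain U G H where U: "sphere 0 1 \<subseteq> U" "open U" and z: "C2_with U z G H"
    using assms by (auto simp: admissible_def C2_on_def)
  obtain \<phi> G' B where \<phi>: "C2_hom1 \<phi> G' B" and q: "\<And>x. norm x = 1 \<Longrightarrow> \<phi> x / h x = z x"
    using C2_on_extend[OF U(1) z U(2)] by blast
  have zh: "z y * h y = \<phi> y" if "norm y = 1" for y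
    using q[OF that] h_pos_sphere[OF that] by (simp add: field_simps)
  have cz: "continuous_on (sphere 0 1) z"
    by (rule continuous_on_subset[OF C2_with_continuous(1)[OF z] U(1)])
  note f = C1_grad_quot(1)[OF \<phi>]
  have "cv_int K (\<lambda>x. z x * (- HBM K z x)) = cv_int K (\<lambda>x. \<phi> x / h x * (- HBM K z x))"
    by (rule cv_cong) (simp add: q)
  also have "\<dots> = cv_int K (Gam (gr \<phi> G') (gr \<phi> G'))"
    by (rule weak_form[OF f \<phi> zh])
  also have "\<dots> \<ge> 0"
    by (rule cv_nonneg) (intro continuous_on_Gam C1_grad_continuous(2)[OF f], rule Gam_nonneg)
  finally have "0 \<le> cv_int K (\<lambda>x. z x * (- HBM K z x))" .
  moreover have "0 \<le> cv_int K (\<lambda>x. (z x)\<^sup>2)"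
    by (rule cv_nonneg) (auto intro!: continuous_intros cz)
  ultimately show ?thesis by (rule divide_nonneg_nonneg)
qed

lemma spectral_gap:
  assumes \<phi>: "C2_hom1 \<phi> G B" and q: "q \<le> lambda2 K" "0 < q"
    and o1: "cv_int K (\<lambda>x. \<phi> x / h x) = 0" and o2: "\<And>v. cv_int K (\<lambda>x. \<phi> x / h x * ellv K v x) = 0"
  shows "q * cv_int K (\<lambda>x. (\<phi> x / h x)\<^sup>2) \<le> cv_int K (Gam (gr \<phi> G) (gr \<phi> G))"
proof -
  let ?z = "\<lambda>x. \<phi> x / h x"
  note f = C1_grad_quot(1)[OF \<phi>]
  have cz: "continuous_on (sphere 0 1) ?z" by (rule C1_grad_continuous(1)[OF f])
  have zh: "?z y * h y = \<phi> y" if "norm y = 1" for y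
    using h_pos_sphere[OF that] by simp
  have D: "cv_int K (\<lambda>x. ?z x * (- HBM K ?z x)) = cv_int K (Gam (gr \<phi> G) (gr \<phi> G))"
    by (rule weak_form[OF f \<phi> zh])
  have nn: "0 \<le> cv_int K (\<lambda>x. (?z x)\<^sup>2)"
    by (rule cv_nonneg) (auto intro!: continuous_intros cz)
  show ?thesis
  proof (cases "\<exists>x\<in>sphere 0 1. ?z x \<noteq> 0")
    case True
    have "C2_on (- {0}) ?z"
    proof -
      obtain B' where "C2_hom0 ?z (gr \<phi> G) B'" using C1_grad_quot(2)[OF \<phi>] by blast
      from C2_hom0D[OF this] show ?thesis
        unfolding C2_on_def by (intro conjI exI) (auto simp: open_Compl)
    qed
    then have adm: "admissible K ?z"
      unfolding admissible_def using True o1 o2 sphere_not_0 by blast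
    let ?S = "{cv_int K (\<lambda>x. z x * (- HBM K z x)) / cv_int K (\<lambda>x. (z x)\<^sup>2) | z. admissible K z}"
    have "bdd_below ?S" by (rule bdd_belowI[of _ 0]) (use quotient_nonneg in blast)
    moreover have "cv_int K (\<lambda>x. ?z x * (- HBM K ?z x)) / cv_int K (\<lambda>x. (?z x)\<^sup>2) \<in> ?S"
      by (rule CollectI, rule exI[of _ ?z]) (simp add: adm)
    ultimately have "lambda2 K \<le> cv_int K (\<lambda>x. ?z x * (- HBM K ?z x)) / cv_int K (\<lambda>x. (?z x)\<^sup>2)"
      unfolding lambda2_def by (intro cInf_lower)
    then have le: "q \<le> cv_int K (Gam (gr \<phi> G) (gr \<phi> G)) / cv_int K (\<lambda>x. (?z x)\<^sup>2)"
      using q(1) unfolding D by simp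
    \<comment> \<open>Division by zero yields 0, so a vanishing denominator would contradict
      \<open>0 < q\<close>.\<close>
    then have "cv_int K (\<lambda>x. (?z x)\<^sup>2) \<noteq> 0" using q(2) by auto
    then have "0 < cv_int K (\<lambda>x. (?z x)\<^sup>2)" using nn by simp
    then show ?thesis using le by (simp add: pos_le_divide_eq)
  next
    case False
    then have "cv_int K (\<lambda>x. (?z x)\<^sup>2) = cv_int K (\<lambda>x. 0)" by (intro cv_cong) auto
    moreover have "0 \<le> cv_int K (Gam (gr \<phi> G) (gr \<phi> G))"
      by (rule cv_nonneg) (intro continuous_on_Gam C1_grad_continuous(2)[OF f], rule Gam_nonneg)
    ultimately show ?thesis by (simp add: cv_zero)
  qed
qed

lemma Gam_diff:
  assumes x: "norm x = 1"
  shows "Gam (\<lambda>x. g x - g' x) (\<lambda>x. g x - g' x) x = Gam g g x - 2 * Gam g g' x + Gam g' g' x"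
proof -
  have "Minv x (g x - g' x) = Minv x (g x) - Minv x (g' x)"
    by (simp add: matrix_vector_mult_diff_distrib)
  then show ?thesis
    unfolding Gam_def using Minv_sym[OF x, of "g' x" "g x"]
    by (simp add: inner_diff_left inner_diff_right algebra_simps inner_commute)
qed

text \<open>The vector that represents the linear functional sending \<open>v\<close> to the
  integral of \<open>z\<close> against \<open>ellv K v\<close>.\<close>

definition coef :: "(real^'n \<Rightarrow> real) \<Rightarrow> real^'n" where
  "coef z = (\<chi> i. cv_int K (\<lambda>x. z x * ellv K (axis i 1) x))"

text \<open>Subtracting from \<open>z\<close> its mean and \<open>ellv K v\<close> with
  \<open>v = (n / \<rho>) coef z\<close> makes it orthogonal to the constants and to all
  \<open>ellv K u\<close>; this choice of \<open>v\<close> is where isotropy enters. The number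
  \<open>S\<close> is the squared norm of the subtracted \<open>ellv K v\<close> and, the eigenvalue
  being 1, also its energy, so it is lost on both sides.\<close>

lemma spectral_inequality:
  assumes iso: "S2_isotropic K" and \<phi>: "C2_hom1 \<phi> G B" and q: "q \<le> lambda2 K" "0 < q"
  defines "z \<equiv> \<lambda>x. \<phi> x / h x"
  defines "S \<equiv> real CARD('n) / \<rho> * (coef z \<bullet> coef z)"
  shows "q * (cv_int K (\<lambda>x. (z x)\<^sup>2) - (cv_int K z)\<^sup>2 / V - S) \<le> cv_int K (Gam (gr \<phi> G) (gr \<phi> G)) - S"
proof -
  let ?n = "real CARD('n)"
  note f = C1_grad_quot(1)[OF \<phi>, folded z_def]
  have cz: "continuous_on (sphere 0 1) z" by (rule C1_grad_continuous(1)[OF f])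
  have cl: "continuous_on (sphere 0 1) (ellv K v)" for v by (rule continuous_on_ellv)
  define a where "a = cv_int K z / V"
  define v where "v = (?n / \<rho>) *\<^sub>R coef z"
  have zl: "cv_int K (\<lambda>x. z x * ellv K u x) = coef z \<bullet> u" for u
    unfolding coef_def by (rule cv_mult_ellv[OF cz])
  have zv: "cv_int K (\<lambda>x. z x * ellv K v x) = S" unfolding zl by (simp add: v_def S_def)
  have vv: "cv_int K (\<lambda>x. ellv K v x * ellv K v x) = S"
    unfolding isotropic_ellv[OF iso] using \<rho>_pos by (simp add: v_def S_def)
  let ?\<psi> = "\<lambda>y. (\<phi> y - a * h y) - y \<bullet> v" and ?G = "\<lambda>y. (G y - a *\<^sub>R Xs y) - v"
  have \<psi>: "C2_hom1 ?\<psi> ?G (\<lambda>y u. (B y u - a *\<^sub>R A y u) - 0)"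
    by (rule C2_hom1_diff[OF C2_hom1_diff[OF \<phi> C2_hom1_cmul[OF C2h]] C2_hom1_linear])
  have \<psi>h: "?\<psi> x / h x = (z x - a) - ellv K v x" if "norm x = 1" for x
    using h_pos_sphere[OF that] by (simp add: z_def ellv_def diff_divide_distrib)
  have gr\<psi>: "gr ?\<psi> ?G x = gr \<phi> G x - gl v x" if "norm x = 1" for x
  proof -
    have e: "(\<phi> x - a * h x - x \<bullet> v) / h x = \<phi> x / h x - a - (x \<bullet> v) / h x"
      using h_pos_sphere[OF that] by (simp add: diff_divide_distrib)
    show ?thesis unfolding gr_def gl_def e by (simp add: algebra_simps)
  qed
  have o1: "cv_int K (\<lambda>x. ?\<psi> x / h x) = 0"
  proof -
    have "cv_int K (\<lambda>x. ?\<psi> x / h x) = cv_int K (\<lambda>x. (z x - a * 1) - ellv K v x)"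
      by (rule cv_cong) (simp add: \<psi>h)
    also have "\<dots> = (cv_int K z - a * V) - cv_int K (ellv K v)"
      by (subst cv_diff, (intro continuous_intros cz cl)+, subst cv_diff, (intro continuous_intros cz)+)
         (simp only: cv_cmul)
    also have "\<dots> = 0" using V_pos by (simp add: cv_ellv a_def)
    finally show ?thesis .
  qed
  have o2: "cv_int K (\<lambda>x. ?\<psi> x / h x * ellv K u x) = 0" for u
  proof -
    have "cv_int K (\<lambda>x. ?\<psi> x / h x * ellv K u x)
        = cv_int K (\<lambda>x. (z x * ellv K u x - a * ellv K u x) - ellv K v x * ellv K u x)"
      by (rule cv_cong) (simp only: \<psi>h, simp add: algebra_simps)
    also have "\<dots> = (cv_int K (\<lambda>x. z x * ellv K u x) - a * cv_int K (ellv K u)) - cv_int K (\<lambda>x. ellv K v x * ellv K u x)"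
      by (subst cv_diff, (intro continuous_intros cz cl)+, subst cv_diff, (intro continuous_intros cz cl)+)
         (simp only: cv_cmul)
    also have "\<dots> = 0"
      unfolding zl cv_ellv isotropic_ellv[OF iso] using \<rho>_pos by (simp add: v_def)
    finally show ?thesis .
  qed
  have gc: "continuous_on (sphere 0 1) (gr \<phi> G)" by (rule C1_grad_continuous(2)[OF f])
  have lv: "C1_grad (ellv K v) (gl v)"
    using C1_grad_quot(1)[OF C2_hom1_linear, of v] unfolding gl_def ellv_def by simp
  have glc: "continuous_on (sphere 0 1) (gl v)" by (rule C1_grad_continuous(2)[OF lv])
  have "cv_int K (Gam (gr ?\<psi> ?G) (gr ?\<psi> ?G))
      = cv_int K (\<lambda>x. (Gam (gr \<phi> G) (gr \<phi> G) x - 2 * Gam (gr \<phi> G) (gl v) x) + Gam (gl v) (gl v) x)"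
  proof (rule cv_cong)
    fix x :: "real^'n" assume x: "norm x = 1"
    have "Gam (gr ?\<psi> ?G) (gr ?\<psi> ?G) x = Gam (\<lambda>x. gr \<phi> G x - gl v x) (\<lambda>x. gr \<phi> G x - gl v x) x"
      by (simp add: Gam_def gr\<psi>[OF x])
    then show "Gam (gr ?\<psi> ?G) (gr ?\<psi> ?G) x
        = (Gam (gr \<phi> G) (gr \<phi> G) x - 2 * Gam (gr \<phi> G) (gl v) x) + Gam (gl v) (gl v) x"
      by (simp only: Gam_diff[OF x])
  qed
  also have "\<dots> = (cv_int K (Gam (gr \<phi> G) (gr \<phi> G)) - 2 * cv_int K (Gam (gr \<phi> G) (gl v))) + cv_int K (Gam (gl v) (gl v))"
    by (subst cv_add, (intro continuous_intros continuous_on_Gam gc glc)+,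
        subst cv_diff, (intro continuous_intros continuous_on_Gam gc glc)+) (simp only: cv_cmul)
  also have "\<dots> = cv_int K (Gam (gr \<phi> G) (gr \<phi> G)) - S"
    unfolding weak_ellv[OF f, symmetric] weak_ellv[OF lv, symmetric] zv vv by simp
  finally have D: "cv_int K (Gam (gr ?\<psi> ?G) (gr ?\<psi> ?G)) = cv_int K (Gam (gr \<phi> G) (gr \<phi> G)) - S" .
  have "cv_int K (\<lambda>x. (?\<psi> x / h x)\<^sup>2)
      = cv_int K (\<lambda>x. ((z x)\<^sup>2 - 2 * a * z x) + a\<^sup>2 * 1 - 2 * (z x * ellv K v x) + 2 * a * ellv K v x + ellv K v x * ellv K v x)"
    by (rule cv_cong) (simp only: \<psi>h, simp add: power2_eq_square algebra_simps)
  also have "\<dots> = (cv_int K (\<lambda>x. (z x)\<^sup>2) - 2 * a * cv_int K z) + a\<^sup>2 * V - 2 * cv_int K (\<lambda>x. z x * ellv K v x)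
      + 2 * a * cv_int K (ellv K v) + cv_int K (\<lambda>x. ellv K v x * ellv K v x)"
    by (subst cv_add, (intro continuous_intros cz cl)+, subst cv_add, (intro continuous_intros cz cl)+,
        subst cv_diff, (intro continuous_intros cz cl)+, subst cv_add, (intro continuous_intros cz cl)+,
        subst cv_diff, (intro continuous_intros cz cl)+) (simp only: cv_cmul)
  also have "\<dots> = cv_int K (\<lambda>x. (z x)\<^sup>2) - (cv_int K z)\<^sup>2 / V - S"
    unfolding zv vv cv_ellv using V_pos by (simp add: a_def power2_eq_square)
  finally have E: "cv_int K (\<lambda>x. (?\<psi> x / h x)\<^sup>2) = cv_int K (\<lambda>x. (z x)\<^sup>2) - (cv_int K z)\<^sup>2 / V - S" .
  show ?thesis using spectral_gap[OF \<psi> q o1 o2] unfolding D E .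
qed

end

section \<open>Coordinates of the support point as limits of admissible functions\<close>

lemma difference_quotient_C2:
  assumes f: "C2_with (- {0}) f G H"
  shows "C2_with (- {0} \<inter> - {- c}) (\<lambda>y. (f (y + c) - f y) / \<epsilon>) (\<lambda>y. (1 / \<epsilon>) *\<^sub>R (G (y + c) - G y))
    (\<lambda>y v. (1 / \<epsilon>) *\<^sub>R (H (y + c) v - H y v))"
  unfolding C2_with_def
proof (intro conjI ballI allI)
  note d = C2_withD[OF f]
  fix y assume y: "y \<in> - {0} \<inter> - {- c}"
  then have y1: "y \<in> - {0}" and y2: "y + c \<in> - {0}" by (auto simp: eq_neg_iff_add_eq_0)
  have t: "((\<lambda>y. y + c) has_derivative (\<lambda>v. v)) (at y)" by (auto intro!: derivative_eq_intros)
  have "((\<lambda>y. (1 / \<epsilon>) * (f (y + c) - f y)) has_derivative (\<lambda>v. (1 / \<epsilon>) * (G (y + c) \<bullet> v - G y \<bullet> v))) (at y)"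
    by (rule has_derivative_mult_right[OF has_derivative_diff[OF has_derivative_compose[OF t d(1)[OF y2]] d(1)[OF y1]]])
  then have "((\<lambda>y. (f (y + c) - f y) / \<epsilon>) has_derivative (\<lambda>v. (1 / \<epsilon>) * (G (y + c) \<bullet> v - G y \<bullet> v))) (at y)"
    by (simp only: times_divide_eq_left mult_1)
  then show "((\<lambda>y. (f (y + c) - f y) / \<epsilon>) has_derivative (\<bullet>) ((1 / \<epsilon>) *\<^sub>R (G (y + c) - G y))) (at y)"
    by (rule has_derivative_innerI) (simp add: inner_diff_left)
  show "((\<lambda>y. (1 / \<epsilon>) *\<^sub>R (G (y + c) - G y)) has_derivative (\<lambda>v. (1 / \<epsilon>) *\<^sub>R (H (y + c) v - H y v))) (at y)"
    by (rule has_derivative_scaleR_right[OF has_derivative_diff[OF has_derivative_compose[OF t d(2)[OF y2]] d(2)[OF y1]]])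
next
  fix v
  have c1: "continuous_on (- {0} \<inter> - {- c}) (\<lambda>y. H (y + c) v)"
    by (rule continuous_on_compose2[OF C2_withD(3)[OF f]]) (auto intro!: continuous_intros simp: eq_neg_iff_add_eq_0)
  have c2: "continuous_on (- {0} \<inter> - {- c}) (\<lambda>y. H y v)"
    by (rule continuous_on_subset[OF C2_withD(3)[OF f]]) simp
  show "continuous_on (- {0} \<inter> - {- c}) (\<lambda>y. (1 / \<epsilon>) *\<^sub>R (H (y + c) v - H y v))"
    by (intro continuous_on_scaleR continuous_on_const continuous_on_diff c1 c2)
qed

lemma DERIV_sequentially:
  assumes "(f has_real_derivative D) (at 0)" "\<epsilon> \<longlonglongrightarrow> 0" "\<And>m. \<epsilon> m \<noteq> 0"
  shows "(\<lambda>m. (f (\<epsilon> m) - f 0) / \<epsilon> m) \<longlonglongrightarrow> D"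
proof -
  have "((\<lambda>h. (f (0 + h) - f 0) / h) \<longlongrightarrow> D) (at 0)" using assms(1) by (simp add: DERIV_def)
  moreover have "filterlim \<epsilon> (at 0) sequentially"
    using assms(2,3) by (simp add: filterlim_at)
  ultimately show ?thesis by (auto dest: filterlim_compose)
qed

context hbm_body
begin

text \<open>The gradient of a coordinate is a row of the Hessian; symmetry makes it the column
  \<open>A y (axis k 1)\<close>.\<close>

lemma Xs_component: "C1_grad (\<lambda>y. Xs y $ k) (\<lambda>y. A y (axis k 1))"
  unfolding C1_grad_def
proof (intro conjI allI impI)
  fix y :: "real^'n" assume y: "y \<noteq> 0"
  have "((\<lambda>y. Xs y $ k) has_derivative (\<lambda>v. A y v $ k)) (at y)"
    by (rule bounded_linear.has_derivative[OF bounded_linear_vec_nth C1_hom0D(1)[OF X y]])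
  then show "((\<lambda>y. Xs y $ k) has_derivative (\<bullet>) (A y (axis k 1))) (at y)"
  proof (rule has_derivative_innerI)
    show "A y v $ k = A y (axis k 1) \<bullet> v" for v
      using C2_hom1_symmetric[OF C2h y, of v "axis k 1"] by (simp add: inner_axis)
  qed
qed (use C1_hom0D(2,3)[OF X] in auto)

lemma A_component: "norm x = 1 \<Longrightarrow> A x (axis i 1) $ k = A x (axis k 1) $ i"
  using A_sym[of x "axis i 1" "axis k 1"] by (simp add: inner_axis)

text \<open>The inverse matrices form a continuous family over the compact sphere. The resulting
  constant is the dominating function for the energies of the difference quotients.\<close>

lemma Gam_bounded:
  obtains C where "\<And>g x. norm x = 1 \<Longrightarrow> norm (g x) \<le> c \<Longrightarrow> \<bar>Gam g g x\<bar> \<le> C"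
proof -
  have "continuous_on (sphere 0 1) (\<lambda>x. matrix_inv (M x))"
  proof (rule continuous_on_matrix)
    fix i j
    have "continuous_on (sphere 0 1) (\<lambda>x. Minv x (axis j 1) $ i)"
      by (intro continuous_on_component continuous_on_Minv continuous_on_const)
    then show "continuous_on (sphere 0 1) (\<lambda>x. matrix_inv (M x) $ i $ j)"
      by (simp add: matrix_vector_mult_basis column_def)
  qed
  from sphere_bounded[OF this] obtain D where D: "\<And>x. x \<in> sphere 0 1 \<Longrightarrow> norm (matrix_inv (M x)) \<le> D"
    by blast
  have "continuous_on (sphere 0 1) (\<lambda>x. h x / (real CARD('n) - 1))"
    using n_gt_1 by (intro continuous_intros continuous_on_h) auto
  from sphere_bounded[OF this] obtain L
    where L: "\<And>x. x \<in> sphere 0 1 \<Longrightarrow> norm (h x / (real CARD('n) - 1)) \<le> L" by blast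
  show thesis
  proof (rule that)
    fix g :: "real^'n \<Rightarrow> real^'n" and x assume x: "norm x = 1" and g: "norm (g x) \<le> c"
    have c: "0 \<le> c" using g norm_ge_zero order_trans by blast
    have x': "x \<in> sphere 0 1" using x by simp
    have D0: "0 \<le> D" using D[OF x'] norm_ge_zero order_trans by blast
    have L0: "0 \<le> L" using L[OF x'] norm_ge_zero order_trans by blast
    have comp: "\<bar>Minv x (g x) $ i\<bar> \<le> D * c" for i
    proof -
      have "Minv x (g x) $ i = matrix_inv (M x) $ i \<bullet> g x"
        by (simp add: matrix_vector_mul_component)
      also have "\<bar>\<dots>\<bar> \<le> norm (matrix_inv (M x) $ i) * norm (g x)" by (rule Cauchy_Schwarz_ineq2)
      also have "\<dots> \<le> D * c"
        using Finite_Cartesian_Product.norm_nth_le[of "matrix_inv (M x)" i] D[OF x'] g D0 by (intro mult_mono) auto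
      finally show ?thesis .
    qed
    have "norm (Minv x (g x)) \<le> (\<Sum>i\<in>UNIV. \<bar>Minv x (g x) $ i\<bar>)" by (rule norm_le_l1_cart)
    also have "\<dots> \<le> real CARD('n) * (D * c)"
      using sum_bounded_above[of UNIV "\<lambda>i. \<bar>Minv x (g x) $ i\<bar>", OF comp] by simp
    finally have "norm (Minv x (g x)) \<le> real CARD('n) * (D * c)" .
    then have "norm (g x) * norm (Minv x (g x)) \<le> c * (real CARD('n) * (D * c))"
      using g c by (intro mult_mono) auto
    then have "\<bar>g x \<bullet> Minv x (g x)\<bar> \<le> c * (real CARD('n) * (D * c))"
      using Cauchy_Schwarz_ineq2 order_trans by blast
    then show "\<bar>Gam g g x\<bar> \<le> L * (c * (real CARD('n) * (D * c)))"
      unfolding Gam_def abs_mult using L[OF x'] L0 by (intro mult_mono) auto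
  qed
qed

text \<open>The quotients of \<open>h\<close> lie between coordinates of points of the compact body.
  Those of the gradient are bounded by the mean value theorem: for
  \<open>\<epsilon> \<le> 1/2\<close> the segment stays at distance at least 1/2 from the origin,
  where degree -1 costs a factor of at most 2 compared with the sphere.\<close>

lemma difference_quotient_bounds:
  obtains C where "\<And>\<epsilon> x. 0 < \<epsilon> \<Longrightarrow> \<epsilon> \<le> 1/2 \<Longrightarrow> norm x = 1 \<Longrightarrow> \<bar>(h (x + \<epsilon> *\<^sub>R axis k 1) - h x) / \<epsilon>\<bar> \<le> C"
    "\<And>\<epsilon> x. 0 < \<epsilon> \<Longrightarrow> \<epsilon> \<le> 1/2 \<Longrightarrow> norm x = 1 \<Longrightarrow> norm ((1 / \<epsilon>) *\<^sub>R (Xs (x + \<epsilon> *\<^sub>R axis k 1) - Xs x)) \<le> C"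
proof -
  note b = Kplus2_basic[OF Kplus2]
  let ?e = "axis k 1 :: real^'n"
  have XK: "Xs y \<in> K" for y by (rule support_pt(1)[OF b(1,3)])
  obtain C1 where C1: "\<And>z. z \<in> K \<Longrightarrow> norm z \<le> C1"
    using compact_imp_bounded[OF b(1)] by (auto simp: bounded_iff)
  have "\<forall>i. \<exists>C. \<forall>x\<in>sphere 0 1. norm (A x (axis i 1)) \<le> C"
    using sphere_bounded[OF continuous_on_A] by metis
  then obtain B where B: "\<And>i x. x \<in> sphere 0 1 \<Longrightarrow> norm (A x (axis i 1)) \<le> B i" by metis
  let ?C2 = "\<Sum>i\<in>UNIV. 2 * B i"
  show thesis
  proof (rule that)
    fix \<epsilon> :: real and x :: "real^'n" assume \<epsilon>: "0 < \<epsilon>" "\<epsilon> \<le> 1/2" and x: "norm x = 1"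
    let ?y = "x + \<epsilon> *\<^sub>R ?e"
    have 1: "x \<bullet> Xs ?y \<le> h x" "?y \<bullet> Xs x \<le> h ?y"
      using supp_ge[OF b(1) XK] by auto
    have "h ?y - h x \<le> \<epsilon> * (?e \<bullet> Xs ?y)"
      using 1(1) inner_Xs[of ?y] by (simp add: inner_add_left)
    moreover have "\<epsilon> * (?e \<bullet> Xs x) \<le> h ?y - h x"
      using 1(2) inner_Xs[of x] by (simp add: inner_add_left)
    moreover have "\<bar>?e \<bullet> Xs z\<bar> \<le> C1" for z
      using Cauchy_Schwarz_ineq2[of ?e "Xs z"] C1[OF XK[of z]] by simp
    then have "?e \<bullet> Xs ?y \<le> C1" "- C1 \<le> ?e \<bullet> Xs x" by (simp_all only: abs_le_iff minus_le_iff)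
    then have "\<epsilon> * (?e \<bullet> Xs ?y) \<le> \<epsilon> * C1" "\<epsilon> * - C1 \<le> \<epsilon> * (?e \<bullet> Xs x)"
      using \<epsilon> by (simp_all only: mult_left_mono less_imp_le)
    ultimately have "\<bar>h ?y - h x\<bar> \<le> C1 * \<epsilon>" by (simp add: abs_le_iff mult.commute)
    then have "\<bar>(h ?y - h x) / \<epsilon>\<bar> \<le> C1" using \<epsilon> by (simp add: pos_divide_le_eq)
    then show "\<bar>(h ?y - h x) / \<epsilon>\<bar> \<le> max C1 ?C2" by simp
    have comp: "\<bar>((1 / \<epsilon>) *\<^sub>R (Xs ?y - Xs x)) $ i\<bar> \<le> 2 * B i" for i
    proof -
      have nb: "1/2 \<le> norm (x + t *\<^sub>R ?e)" if "0 \<le> t" "t \<le> \<epsilon>" for t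
      proof -
        have "norm x - norm (t *\<^sub>R ?e) \<le> norm (x + t *\<^sub>R ?e)" by (rule norm_diff_ineq)
        then show ?thesis using that \<epsilon> x by simp
      qed
      have der: "((\<lambda>t. Xs (x + t *\<^sub>R ?e) $ i) has_real_derivative (A (x + t *\<^sub>R ?e) (axis i 1) \<bullet> ?e)) (at t within {0..\<epsilon>})"
        if t: "t \<in> {0..\<epsilon>}" for t
      proof -
        have y0: "x + t *\<^sub>R ?e \<noteq> 0" using nb[of t] t by auto
        then have "((\<lambda>y. Xs y $ i) has_derivative (\<bullet>) (A (x + t *\<^sub>R ?e) (axis i 1))) (at (x + t *\<^sub>R ?e))"
          using Xs_component[of i] by (simp add: C1_grad_def)
        from has_derivative_along_line[OF this, of ?e]
        have "((\<lambda>s. Xs ((x + t *\<^sub>R ?e) + s *\<^sub>R ?e) $ i) has_real_derivative (A (x + t *\<^sub>R ?e) (axis i 1) \<bullet> ?e)) (at 0)" .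
        then have "((\<lambda>s. Xs (x + (t + s) *\<^sub>R ?e) $ i) has_real_derivative (A (x + t *\<^sub>R ?e) (axis i 1) \<bullet> ?e)) (at 0)"
          by (simp add: scaleR_left_distrib add.assoc)
        then have "((\<lambda>t. Xs (x + t *\<^sub>R ?e) $ i) has_real_derivative (A (x + t *\<^sub>R ?e) (axis i 1) \<bullet> ?e)) (at (t + 0))"
          using DERIV_shift[of "\<lambda>t. Xs (x + t *\<^sub>R ?e) $ i" _ 0 t] by (simp add: add.commute[of _ t])
        then show ?thesis by (simp add: has_field_derivative_at_within)
      qed
      have bnd: "norm (A (x + t *\<^sub>R ?e) (axis i 1) \<bullet> ?e) \<le> 2 * B i" if t: "t \<in> {0..\<epsilon>}" for t
      proof -
        let ?z = "x + t *\<^sub>R ?e"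
        have n: "1/2 \<le> norm ?z" using nb t by auto
        then have z0: "?z \<noteq> 0" by auto
        have "A ?z (axis i 1) = (1 / norm ?z) *\<^sub>R A (?z /\<^sub>R norm ?z) (axis i 1)"
          using C1_hom0_derivative_scale[OF X, of "norm ?z" "?z /\<^sub>R norm ?z"] z0 by simp
        then have "norm (A ?z (axis i 1)) = (1 / norm ?z) * norm (A (?z /\<^sub>R norm ?z) (axis i 1))" by simp
        also have "\<dots> \<le> 2 * B i"
        proof (rule mult_mono)
          have "?z /\<^sub>R norm ?z \<in> sphere 0 1" using z0 by (simp only: mem_sphere_0 norm_scaleR norm_inverse abs_norm_cancel abs_inverse left_inverse norm_eq_zero not_False_eq_True)
          then show "norm (A (?z /\<^sub>R norm ?z) (axis i 1)) \<le> B i" by (rule B)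
          show "1 / norm ?z \<le> 2" using n z0 by (simp add: pos_divide_le_eq)
        qed auto
        finally show ?thesis using Cauchy_Schwarz_ineq2[of "A ?z (axis i 1)" ?e] by simp
      qed
      have "norm (Xs (x + \<epsilon> *\<^sub>R ?e) $ i - Xs (x + 0 *\<^sub>R ?e) $ i) \<le> 2 * B i * norm (\<epsilon> - 0)"
        by (rule field_differentiable_bound[OF convex_real_interval(5) der bnd]) (use \<epsilon> in auto)
      then show ?thesis using \<epsilon> by (simp add: abs_mult pos_divide_le_eq)
    qed
    have "norm ((1 / \<epsilon>) *\<^sub>R (Xs ?y - Xs x)) \<le> (\<Sum>i\<in>UNIV. \<bar>((1 / \<epsilon>) *\<^sub>R (Xs ?y - Xs x)) $ i\<bar>)"
      by (rule norm_le_l1_cart)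
    also have "\<dots> \<le> ?C2" by (rule sum_mono) (rule comp)
    finally show "norm ((1 / \<epsilon>) *\<^sub>R (Xs ?y - Xs x)) \<le> max C1 ?C2" by simp
  qed
qed

lemma coef_cong: "(\<And>x. norm x = 1 \<Longrightarrow> f x = g x) \<Longrightarrow> coef f = coef g"
  unfolding coef_def by (simp add: vec_eq_iff) (auto intro: cv_cong)

text \<open>The difference quotients and their tangential gradients converge boundedly on the
  sphere, and every term of the inequality is built from integrals that pass to the limit. No
  convergence of second derivatives is needed, since the energy involves gradients only.\<close>

theorem spectral_inequality_support_pt:
  fixes k :: 'n
  assumes iso: "S2_isotropic K" and q: "q \<le> lambda2 K" "0 < q"
  defines "z \<equiv> \<lambda>x. Xs x $ k"
  defines "S \<equiv> real CARD('n) / \<rho> * (coef z \<bullet> coef z)"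
  shows "q * (cv_int K (\<lambda>x. (z x)\<^sup>2) - (cv_int K z)\<^sup>2 / V - S)
    \<le> cv_int K (Gam (\<lambda>x. A x (axis k 1)) (\<lambda>x. A x (axis k 1))) - S"
proof -
  let ?e = "axis k 1 :: real^'n"
  \<comment> \<open>Starting at 1/2 keeps the shifted points away from the origin.\<close>
  define \<epsilon> where "\<epsilon> m = inverse (real (Suc (Suc m)))" for m
  have \<epsilon>: "0 < \<epsilon> m" "\<epsilon> m \<le> 1/2" for m by (auto simp: \<epsilon>_def field_simps)
  have \<epsilon>0: "\<epsilon> \<longlonglongrightarrow> 0"
    unfolding \<epsilon>_def using LIMSEQ_Suc[OF LIMSEQ_inverse_real_of_nat] .
  define f where "f m x = (h (x + \<epsilon> m *\<^sub>R ?e) - h x) / \<epsilon> m" for m x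
  define G where "G m x = (1 / \<epsilon> m) *\<^sub>R (Xs (x + \<epsilon> m *\<^sub>R ?e) - Xs x)" for m x
  \<comment> \<open>The difference quotient is not homogeneous, so the radial part of its gradient
    has to be removed.\<close>
  define g where "g m x = G m x - (x \<bullet> G m x) *\<^sub>R x" for m x
  obtain C where Cf: "\<And>m x. norm x = 1 \<Longrightarrow> \<bar>f m x\<bar> \<le> C" and CG: "\<And>m x. norm x = 1 \<Longrightarrow> norm (G m x) \<le> C"
  proof -
    obtain C where "\<And>\<epsilon> x. 0 < \<epsilon> \<Longrightarrow> \<epsilon> \<le> 1/2 \<Longrightarrow> norm x = 1 \<Longrightarrow> \<bar>(h (x + \<epsilon> *\<^sub>R ?e) - h x) / \<epsilon>\<bar> \<le> C"
      "\<And>\<epsilon> x. 0 < \<epsilon> \<Longrightarrow> \<epsilon> \<le> 1/2 \<Longrightarrow> norm x = 1 \<Longrightarrow> norm ((1 / \<epsilon>) *\<^sub>R (Xs (x + \<epsilon> *\<^sub>R ?e) - Xs x)) \<le> C"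
      using difference_quotient_bounds[of k] by blast
    then show ?thesis using that \<epsilon> unfolding f_def G_def by blast
  qed
  have Cg: "norm (g m x) \<le> 2 * C" if x: "norm x = 1" for m x
  proof -
    have "norm (g m x) \<le> norm (G m x) + \<bar>x \<bullet> G m x\<bar> * norm x"
      unfolding g_def by (rule order_trans[OF norm_triangle_ineq4]) simp
    then show ?thesis using Cauchy_Schwarz_ineq2[of x "G m x"] CG[OF x, of m] x by simp
  qed
  have main: "q * (cv_int K (\<lambda>x. (f m x)\<^sup>2) - (cv_int K (f m))\<^sup>2 / V - real CARD('n) / \<rho> * (coef (f m) \<bullet> coef (f m)))
      \<le> cv_int K (Gam (g m) (g m)) - real CARD('n) / \<rho> * (coef (f m) \<bullet> coef (f m))"
    and cf: "continuous_on (sphere 0 1) (f m)" and cg: "continuous_on (sphere 0 1) (g m)" for m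
  proof -
    let ?c = "\<epsilon> m *\<^sub>R ?e"
    let ?U = "- {0} \<inter> - {- ?c}"
    \<comment> \<open>The shifted singularity lies at distance \<open>\<epsilon> m\<close> from the
      origin, hence off the unit sphere.\<close>
    have "norm (- ?c) \<noteq> 1" using \<epsilon>[of m] by simp
    then have U: "sphere 0 1 \<subseteq> ?U" by auto
    have op: "open ?U" by (auto simp: open_Int open_Compl)
    have C2: "C2_with ?U (f m) (G m) (\<lambda>y v. (1 / \<epsilon> m) *\<^sub>R (A (y + ?c) v - A y v))"
      using difference_quotient_C2[OF C2_hom1D[OF C2h], of ?c "\<epsilon> m"] unfolding f_def G_def .
    show cf: "continuous_on (sphere 0 1) (f m)"
      by (rule continuous_on_subset[OF C2_with_continuous(1)[OF C2] U])
    show "continuous_on (sphere 0 1) (g m)"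
      unfolding g_def by (intro continuous_intros continuous_on_subset[OF C2_with_continuous(2)[OF C2] U])
    obtain \<phi> G' B where \<phi>: "C2_hom1 \<phi> G' B"
      and e: "\<And>x. norm x = 1 \<Longrightarrow> \<phi> x / h x = f m x" "\<And>x. norm x = 1 \<Longrightarrow> gr \<phi> G' x = g m x"
      using C2_on_extend[OF U C2 op] unfolding g_def by blast
    have "cv_int K (\<lambda>x. (\<phi> x / h x)\<^sup>2) = cv_int K (\<lambda>x. (f m x)\<^sup>2)" by (rule cv_cong) (simp add: e)
    moreover have "cv_int K (\<lambda>x. \<phi> x / h x) = cv_int K (f m)" by (rule cv_cong) (simp add: e)
    moreover have "coef (\<lambda>x. \<phi> x / h x) = coef (f m)" by (rule coef_cong) (simp add: e)
    moreover have "cv_int K (Gam (gr \<phi> G') (gr \<phi> G')) = cv_int K (Gam (g m) (g m))"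
      by (rule cv_cong) (simp add: Gam_def e)
    ultimately show "q * (cv_int K (\<lambda>x. (f m x)\<^sup>2) - (cv_int K (f m))\<^sup>2 / V - real CARD('n) / \<rho> * (coef (f m) \<bullet> coef (f m)))
      \<le> cv_int K (Gam (g m) (g m)) - real CARD('n) / \<rho> * (coef (f m) \<bullet> coef (f m))"
      using spectral_inequality[OF iso \<phi> q] by simp
  qed
  have cz: "continuous_on (sphere 0 1) z"
    unfolding z_def by (rule C1_grad_continuous(1)[OF Xs_component])
  have fz: "(\<lambda>m. f m x) \<longlonglongrightarrow> z x" if x: "norm x = 1" for x
  proof -
    have "(h has_derivative (\<bullet>) (Xs x)) (at x)" using C2_withD(1)[OF C2_hom1D[OF C2h]] nz[OF x] by simp
    from DERIV_sequentially[OF has_derivative_along_line[OF this, of ?e] \<epsilon>0]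
    show ?thesis using \<epsilon>(1) unfolding f_def z_def by (simp add: inner_axis less_imp_neq[symmetric])
  qed
  have GA: "(\<lambda>m. G m x) \<longlonglongrightarrow> A x ?e" if x: "norm x = 1" for x
  proof (rule vec_tendstoI)
    fix i
    have "((\<lambda>y. Xs y $ i) has_derivative (\<bullet>) (A x (axis i 1))) (at x)"
      using Xs_component[of i] nz[OF x] by (simp add: C1_grad_def)
    from DERIV_sequentially[OF has_derivative_along_line[OF this, of ?e] \<epsilon>0]
    show "(\<lambda>m. G m x $ i) \<longlonglongrightarrow> A x ?e $ i"
      using \<epsilon>(1) A_component[OF x, of i k] unfolding G_def by (simp add: inner_axis less_imp_neq[symmetric])
  qed
  have gA: "(\<lambda>m. g m x) \<longlonglongrightarrow> A x ?e" if x: "norm x = 1" for x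
  proof -
    have "(\<lambda>m. G m x - (x \<bullet> G m x) *\<^sub>R x) \<longlonglongrightarrow> A x ?e - (x \<bullet> A x ?e) *\<^sub>R x"
      by (intro tendsto_intros GA[OF x])
    then show ?thesis by (simp add: g_def A_orth[OF x])
  qed
  have l1: "(\<lambda>m. cv_int K (\<lambda>x. (f m x)\<^sup>2)) \<longlonglongrightarrow> cv_int K (\<lambda>x. (z x)\<^sup>2)"
  proof (rule cv_tendsto[where C = "C\<^sup>2"])
    show "\<bar>(f m x)\<^sup>2\<bar> \<le> C\<^sup>2" if "norm x = 1" for m x
      using power_mono[OF Cf[OF that, of m], of 2] by simp
  qed (auto intro!: continuous_intros cf cz tendsto_intros fz)
  have l2: "(\<lambda>m. cv_int K (f m)) \<longlonglongrightarrow> cv_int K z"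
    by (rule cv_tendsto[OF cf cz fz Cf])
  have l3: "(\<lambda>m. coef (f m)) \<longlonglongrightarrow> coef z"
  proof (rule vec_tendstoI)
    fix i
    obtain D where D: "\<And>x. x \<in> sphere 0 1 \<Longrightarrow> norm (ellv K (axis i 1) x) \<le> D"
      using sphere_bounded[OF continuous_on_ellv] by blast
    have "(\<lambda>m. cv_int K (\<lambda>x. f m x * ellv K (axis i 1) x)) \<longlonglongrightarrow> cv_int K (\<lambda>x. z x * ellv K (axis i 1) x)"
    proof (rule cv_tendsto[where C = "C * D"])
      show "\<bar>f m x * ellv K (axis i 1) x\<bar> \<le> C * D" if x: "norm x = 1" for m x
        unfolding abs_mult using Cf[OF x, of m] D[of x] x
        by (intro mult_mono) auto
    qed (auto intro!: continuous_intros cf cz continuous_on_ellv tendsto_intros fz)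
    then show "(\<lambda>m. coef (f m) $ i) \<longlonglongrightarrow> coef z $ i" by (simp add: coef_def)
  qed
  have cA: "continuous_on (sphere 0 1) (\<lambda>x. A x ?e)" by (rule continuous_on_A)
  obtain CC where CC: "\<And>g x. norm x = 1 \<Longrightarrow> norm (g x) \<le> 2 * C \<Longrightarrow> \<bar>Gam g g x\<bar> \<le> CC"
    using Gam_bounded[of "2 * C"] by blast
  have l4: "(\<lambda>m. cv_int K (Gam (g m) (g m))) \<longlonglongrightarrow> cv_int K (Gam (\<lambda>x. A x ?e) (\<lambda>x. A x ?e))"
  proof (rule cv_tendsto[where C = CC])
    show "(\<lambda>m. Gam (g m) (g m) x) \<longlonglongrightarrow> Gam (\<lambda>x. A x ?e) (\<lambda>x. A x ?e) x" if x: "norm x = 1" for x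
      unfolding Gam_def
      by (intro tendsto_intros gA[OF x] bounded_linear.tendsto[OF matrix_vector_mul_bounded_linear])
  qed (auto intro!: continuous_on_Gam cg cA CC Cg)
  have V0: "V \<noteq> 0" using V_pos by simp
  have "(\<lambda>m. q * (cv_int K (\<lambda>x. (f m x)\<^sup>2) - (cv_int K (f m))\<^sup>2 / V - real CARD('n) / \<rho> * (coef (f m) \<bullet> coef (f m))))
      \<longlonglongrightarrow> q * (cv_int K (\<lambda>x. (z x)\<^sup>2) - (cv_int K z)\<^sup>2 / V - S)"
    unfolding S_def by (intro tendsto_intros l1 l2 l3 V0)
  moreover have "(\<lambda>m. cv_int K (Gam (g m) (g m)) - real CARD('n) / \<rho> * (coef (f m) \<bullet> coef (f m)))
      \<longlonglongrightarrow> cv_int K (Gam (\<lambda>x. A x ?e) (\<lambda>x. A x ?e)) - S"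
    unfolding S_def by (intro tendsto_intros l3 l4)
  ultimately show ?thesis by (rule LIMSEQ_le) (use main in blast)
qed

section \<open>Moments and energies of the coordinates of the support point\<close>

lemma gl_inner: assumes x: "norm x = 1" shows "gl v x \<bullet> x = 0"
  using h_pos_sphere[OF x] inner_Xs[of x]
  by (simp add: gl_def gr_def inner_diff_left inner_commute[of v x] inner_commute[of "Xs x" x])

text \<open>By the weak form the integral \<open>b\<close> equals an energy; there
  \<open>Minv x\<close> cancels the Hessian in the gradient of the coordinate, leaving a coordinate
  of \<open>gl v x\<close>. This gives (n - 1) b = v_k V - b, which is solved for
  \<open>b\<close>.\<close>

lemma cv_support_pt_ellv: "cv_int K (\<lambda>x. Xs x $ k * ellv K v x) = v $ k * V / real CARD('n)"
proof -
  let ?b = "cv_int K (\<lambda>x. Xs x $ k * ellv K v x)"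
  have c: "continuous_on (sphere 0 1) (\<lambda>x. Xs x $ k * ellv K v x)"
    by (intro continuous_intros C1_grad_continuous(1)[OF Xs_component] continuous_on_ellv)
  have "?b = cv_int K (Gam (\<lambda>x. A x (axis k 1)) (gl v))" by (rule weak_ellv[OF Xs_component])
  also have "\<dots> = cv_int K (\<lambda>x. 1 / (real CARD('n) - 1) * (v $ k * 1 - Xs x $ k * ellv K v x))"
  proof (rule cv_cong)
    fix x :: "real^'n" assume x: "norm x = 1"
    have "A x (axis k 1) \<bullet> Minv x (gl v x) = (axis k 1 - (x \<bullet> axis k 1) *\<^sub>R x) \<bullet> gl v x"
      by (simp only: Minv_sym[OF x] Minv_A[OF x])
    also have "\<dots> = gl v x $ k"
      using gl_inner[OF x, of v] by (simp add: inner_diff_left inner_axis' inner_commute[of x "gl v x"])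
    finally show "Gam (\<lambda>x. A x (axis k 1)) (gl v) x = 1 / (real CARD('n) - 1) * (v $ k * 1 - Xs x $ k * ellv K v x)"
      using h_pos_sphere[OF x] by (simp add: Gam_def gl_def gr_def ellv_def mult_ac)
  qed
  also have "\<dots> = 1 / (real CARD('n) - 1) * (v $ k * V - ?b)"
    unfolding cv_cmul by (subst cv_diff, (intro continuous_intros c)+) (simp only: cv_cmul)
  finally have "?b * (real CARD('n) - 1) = v $ k * V - ?b" using n_gt_1 by (simp add: field_simps)
  then show ?thesis using n_gt_1 by (simp add: field_simps)
qed

text \<open>As \<open>A x\<close> annihilates the normal \<open>x\<close>, the full trace is the
  trace of D^2 h over the tangent hyperplane.\<close>

definition trA :: "real^'n \<Rightarrow> real" where
  "trA x = (\<Sum>k\<in>UNIV. A x (axis k 1) $ k)"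

lemma continuous_on_trA: "continuous_on (sphere 0 1) trA"
  unfolding trA_def by (intro continuous_intros continuous_on_component continuous_on_A)

text \<open>By the explicit moments each coordinate loses the same amount V^2 / (rho n). Its energy
  density is \<open>h x / (n - 1)\<close> times a diagonal entry of the Hessian, since
  \<open>Minv x\<close> inverts \<open>A x\<close> on tangent vectors; the sum over coordinates
  produces the trace.\<close>

theorem summed_inequality:
  assumes iso: "S2_isotropic K" and q: "q \<le> lambda2 K" "0 < q"
    and cen: "\<And>k. cv_int K (\<lambda>x. Xs x $ k) = 0"
  shows "q * (cv_int K (\<lambda>x. Xs x \<bullet> Xs x) - V\<^sup>2 / \<rho>)
    \<le> cv_int K (\<lambda>x. h x * trA x) / (real CARD('n) - 1) - V\<^sup>2 / \<rho>"
proof -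
  let ?n = "real CARD('n)"
  have S: "?n / \<rho> * (coef (\<lambda>x. Xs x $ k) \<bullet> coef (\<lambda>x. Xs x $ k)) = V\<^sup>2 / \<rho> / ?n" for k
  proof -
    have "coef (\<lambda>x. Xs x $ k) = (V / ?n) *\<^sub>R axis k 1"
      by (auto simp: coef_def vec_eq_iff cv_support_pt_ellv axis_def)
    then show ?thesis by (simp add: inner_axis_axis power2_eq_square)
  qed
  have G: "cv_int K (Gam (\<lambda>x. A x (axis k 1)) (\<lambda>x. A x (axis k 1)))
      = cv_int K (\<lambda>x. 1 / (?n - 1) * (h x * A x (axis k 1) $ k))" for k
  proof (rule cv_cong)
    fix x :: "real^'n" assume x: "norm x = 1"
    have "A x (axis k 1) \<bullet> Minv x (A x (axis k 1)) = A x (axis k 1) $ k"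
      using A_orth[OF x, of "axis k 1"]
      by (simp add: Minv_A[OF x] inner_diff_right inner_axis inner_commute[of _ x])
    then show "Gam (\<lambda>x. A x (axis k 1)) (\<lambda>x. A x (axis k 1)) x = 1 / (?n - 1) * (h x * A x (axis k 1) $ k)"
      by (simp add: Gam_def)
  qed
  have "(\<Sum>k\<in>UNIV. q * (cv_int K (\<lambda>x. (Xs x $ k)\<^sup>2) - 0\<^sup>2 / V - V\<^sup>2 / \<rho> / ?n))
      \<le> (\<Sum>k\<in>UNIV. cv_int K (\<lambda>x. 1 / (?n - 1) * (h x * A x (axis k 1) $ k)) - V\<^sup>2 / \<rho> / ?n)"
    by (rule sum_mono) (use spectral_inequality_support_pt[OF iso q] in \<open>simp only: S G cen\<close>)
  moreover have "(\<Sum>k\<in>UNIV. cv_int K (\<lambda>x. (Xs x $ k)\<^sup>2)) = cv_int K (\<lambda>x. Xs x \<bullet> Xs x)"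
    unfolding inner_vec_def inner_real_def
    by (subst cv_sum) (auto simp: power2_eq_square intro!: continuous_intros continuous_on_component continuous_on_Xs)
  moreover have "(\<Sum>k\<in>UNIV. cv_int K (\<lambda>x. 1 / (?n - 1) * (h x * A x (axis k 1) $ k)))
      = cv_int K (\<lambda>x. h x * trA x) / (?n - 1)"
  proof -
    have "cv_int K (\<lambda>x. h x * trA x) = (\<Sum>k\<in>UNIV. cv_int K (\<lambda>x. h x * A x (axis k 1) $ k))"
      unfolding trA_def sum_distrib_left
      by (subst cv_sum) (auto intro!: continuous_intros continuous_on_component continuous_on_A continuous_on_h)
    then show ?thesis by (simp only: cv_cmul sum_distrib_left[symmetric]) simp
  qed
  moreover have "(\<Sum>k\<in>(UNIV :: 'n set). V\<^sup>2 / \<rho> / ?n) = V\<^sup>2 / \<rho>" by simp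
  ultimately show ?thesis
    by (simp only: sum_subtractf sum_distrib_left[symmetric]) simp
qed

end

section \<open>Rigidity\<close>

lemma C2_hom1_norm:
  "C2_hom1 norm sgn (\<lambda>y v :: real^'n. (v - (sgn y \<bullet> v) *\<^sub>R sgn y) /\<^sub>R norm y)"
  unfolding C2_hom1_def C2_with_def
proof (intro conjI ballI allI impI)
  fix y :: "real^'n" assume y: "y \<in> - {0}"
  show "(norm has_derivative (\<bullet>) (sgn y)) (at y)"
    using norm_has_derivative[of y] y by simp
  show "(sgn has_derivative (\<lambda>v. (v - (sgn y \<bullet> v) *\<^sub>R sgn y) /\<^sub>R norm y)) (at y)"
    using sgn_has_derivative[of y] y by simp
next
  show "continuous_on (- {0}) (\<lambda>y. (v - (sgn y \<bullet> v) *\<^sub>R sgn y) /\<^sub>R norm y)" for v :: "real^'n"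
    by (intro continuous_intros) auto
qed simp

lemma norm_scaleR_sgn: "norm y *\<^sub>R sgn y = (y :: 'a::real_normed_vector)"
  by (cases "y = 0") (simp_all add: sgn_div_norm)

lemma matrix_ident: "matrix (\<lambda>v. v) = (mat 1 :: real^'n^'n)"
  using matrix_id_mat_1 by (simp add: id_def)

text \<open>The divergence identity for the unit ball: with \<open>X = sgn\<close> the
  parametrisation is the identity map and \<open>J x\<close> the identity matrix, so the
  differential of the determinant becomes the trace.\<close>

lemma sphere_divergence:
  fixes w :: "real^'n \<Rightarrow> real^'n"
  assumes w: "C1_hom0 w W"
  shows "sph_int (\<lambda>x. trace (matrix (W x))) = (real CARD('n) - 1) * sph_int (\<lambda>x. x \<bullet> w x)"
proof -
  let ?S = "\<lambda>y v :: real^'n. (v - (sgn y \<bullet> v) *\<^sub>R sgn y) /\<^sub>R norm y"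
  have sx: "sgn x = x" if "norm x = 1" for x :: "real^'n" using that by (simp add: sgn_div_norm)
  have S: "?S x v + (x \<bullet> v) *\<^sub>R x = v" if "norm x = 1" for x v using that by (simp add: sx)
  have T: "(\<lambda>y. norm y *\<^sub>R sgn y) = (\<lambda>y :: real^'n. y)"
    by (simp add: fun_eq_iff norm_scaleR_sgn)
  interpret gauss_param "cball 0 1" sgn ?S
  proof
    show "C1_hom0 sgn ?S" by (rule C2_hom1_gradient[OF C2_hom1_norm])
    fix x v :: "real^'n" assume x: "norm x = 1"
    have xx: "x \<bullet> x = 1" using x by (simp add: norm_eq_1)
    show "x \<bullet> ?S x v = 0" using x xx by (simp add: sx inner_diff_right)
    show "0 < x \<bullet> sgn x" using x xx by (simp add: sx)
    show "0 < det (matrix (\<lambda>v. ?S x v + (x \<bullet> v) *\<^sub>R x))" by (simp only: S[OF x] matrix_ident det_I zero_less_one)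
  qed (simp_all only: T image_ident inj_on_id2 frontier_cball convex_cball compact_cball)
  have J: "J x = mat 1" if "norm x = 1" for x
    unfolding J_def sx[OF that] by (simp only: S[OF that, unfolded sx[OF that]] matrix_ident)
  have d: "d1 x = 1" if "norm x = 1" for x
    unfolding d1_def by (simp only: S[OF that] matrix_ident det_I)
  have E: "ddet (mat 1) E = trace E" for E :: "real^'n^'n"
    using ddet_eq_trace[of "mat 1 :: real^'n^'n" E] matrix_inv_inverse(1)[of "mat 1 :: real^'n^'n"] by simp
  have "sph_int (\<lambda>x. trace (matrix (W x))) = sph_int (\<lambda>x. ddet (J x) (matrix (W x)))"
    by (rule sph_int_cong) (simp add: J E)
  also have "\<dots> = (real CARD('n) - 1) * sph_int (\<lambda>x. d1 x * (x \<bullet> w x))"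
    by (rule divergence_identity[OF w])
  also have "sph_int (\<lambda>x. d1 x * (x \<bullet> w x)) = sph_int (\<lambda>x. x \<bullet> w x)"
    by (rule sph_int_cong) (simp add: d)
  finally show ?thesis .
qed

lemma C1_grad_powr:
  fixes f :: "real^'n \<Rightarrow> real"
  assumes f: "C1_grad f F" and pos: "\<And>y. y \<noteq> 0 \<Longrightarrow> 0 < f y"
  shows "C1_grad (\<lambda>y. f y powr a) (\<lambda>y. (a * f y powr (a - 1)) *\<^sub>R F y)"
  unfolding C1_grad_def
proof (intro conjI allI impI)
  have F: "\<And>y. y \<noteq> 0 \<Longrightarrow> (f has_derivative (\<bullet>) (F y)) (at y)" "continuous_on (- {0}) F"
    "\<And>c y. 0 < c \<Longrightarrow> f (c *\<^sub>R y) = f y" using f by (auto simp: C1_grad_def)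
  fix y :: "real^'n" assume y: "y \<noteq> 0"
  show "((\<lambda>y. f y powr a) has_derivative (\<bullet>) ((a * f y powr (a - 1)) *\<^sub>R F y)) (at y)"
    by (rule has_derivative_innerI[OF DERIV_compose_FDERIV[OF has_real_derivative_powr[OF pos[OF y]] F(1)[OF y]]])
      simp
next
  have F: "\<And>y. y \<noteq> 0 \<Longrightarrow> (f has_derivative (\<bullet>) (F y)) (at y)" "continuous_on (- {0}) F"
    using f by (auto simp: C1_grad_def)
  have "continuous_on (- {0}) f"
    by (intro continuous_at_imp_continuous_on ballI has_derivative_continuous[OF F(1)]) auto
  moreover have "\<forall>y\<in>- {0}. f y \<noteq> 0" using pos by force
  ultimately show "continuous_on (- {0}) (\<lambda>y. (a * f y powr (a - 1)) *\<^sub>R F y)"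
    by (intro continuous_intros F(2))
qed (use f in \<open>auto simp: C1_grad_def\<close>)

context hbm_body
begin

text \<open>On the sphere the Jacobian of the parametrisation is n times the cone-volume density.
  Hence \<open>V\<close> is the volume, which is nonzero and can be cleared from the centroid, and
  the first moment of \<open>K\<close> is a multiple of the mean of \<open>Xs\<close>.\<close>

lemma cv_support_pt_0:
  assumes "centroid K = 0"
  shows "cv_int K (\<lambda>x. Xs x $ k) = 0"
proof -
  have n: "real CARD('n) > 0" by simp
  have eq: "det (J x) = real CARD('n) * wt x" if "norm x = 1" for x
    using n by (simp add: det_J'[OF that] wt_def)
  have cJ: "continuous_on (sphere 0 1) (\<lambda>x. det (J x))" by (rule continuous_on_det_J)
  have "real CARD('n) * measure lebesgue K = sph_int (\<lambda>x. det (J x))"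
    unfolding measure_K_eq sph_int_eq_pball[OF cJ] ..
  also have "\<dots> = real CARD('n) * V"
    unfolding cv_eq sph_int_cmul[symmetric] by (rule sph_int_cong) (simp add: eq)
  finally have "measure lebesgue K = V" by simp
  moreover have "measure lebesgue K = measure lborel K"
    using compact_imp_closed[OF compact] by (intro measure_completion) auto
  ultimately have "measure lborel K \<noteq> 0" using V_pos by simp
  then have "integral K (\<lambda>z. z) = 0" using assms by (simp add: centroid_def)
  then have "0 = sph_int (\<lambda>x. det (J x) * Xs x $ k)" using centroid_identity[of k] by simp
  also have "\<dots> = real CARD('n) * cv_int K (\<lambda>x. Xs x $ k)"
    unfolding cv_eq sph_int_cmul[symmetric] by (rule sph_int_cong) (simp add: eq)
  finally show ?thesis using n by simp
qed

text \<open>The power of \<open>h\<close> is extended with degree 0 through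
  \<open>h y / norm y\<close>. The tangential gradient of \<open>h\<close> is
  \<open>Xs x - h x *\<^sub>R x\<close>, and its pairing with \<open>Xs x\<close> produces |X|^2 -
  h^2; the equation turns h^p dmu into n times the cone-volume measure.\<close>

lemma trace_identity:
  assumes pde: "\<And>x. norm x = 1 \<Longrightarrow> h x powr (1 - p) * tdet h x = 1"
  shows "cv_int K (\<lambda>x. h x * trA x) + (p + 1) * (cv_int K (\<lambda>x. Xs x \<bullet> Xs x) - cv_int K (\<lambda>x. (h x)\<^sup>2))
    = (real CARD('n) - 1) * cv_int K (\<lambda>x. (h x)\<^sup>2)"
proof -
  let ?n = "real CARD('n)"
  let ?u = "\<lambda>y. h y / norm y" and ?U = "\<lambda>y. inverse (norm y) *\<^sub>R (Xs y - (h y / norm y) *\<^sub>R sgn y)"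
  have "\<exists>B. C2_hom0 ?u ?U B"
    using C2_hom1_divide[OF C2h C2_hom1_norm] by auto
  then have u: "C1_grad ?u ?U" using C2_hom0_C1_grad by blast
  have f: "C1_grad (\<lambda>y. ?u y powr (p + 1)) (\<lambda>y. ((p + 1) * ?u y powr (p + 1 - 1)) *\<^sub>R ?U y)"
    by (rule C1_grad_powr[OF u]) (simp add: h_gt_0)
  note div = sphere_divergence[OF C1_grad_scaleR[OF f X]]
  have wt: "?n * wt x = h x powr p" if x: "norm x = 1" for x
  proof -
    have "h x * tdet h x = h x powr p * (h x powr (1 - p) * tdet h x)"
      using h_pos_sphere[OF x] by (simp add: powr_add[symmetric] mult.assoc[symmetric])
    also have "\<dots> = h x powr p" by (simp only: pde[OF x] mult_1_right)
    finally show ?thesis using tdet_eq[OF x] by (simp add: wt_def)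
  qed
  have pw: "h x powr (p + 1) = h x * (?n * wt x)" if x: "norm x = 1" for x
    using h_pos_sphere[OF x] wt[OF x] by (simp add: powr_add)
  have c: "continuous_on (sphere 0 1) (\<lambda>x. h x * trA x)" "continuous_on (sphere 0 1) (\<lambda>x. Xs x \<bullet> Xs x)"
    "continuous_on (sphere 0 1) (\<lambda>x. (h x)\<^sup>2)"
    by (intro continuous_intros continuous_on_h continuous_on_trA continuous_on_Xs)+
  have "sph_int (\<lambda>x. trace (matrix (\<lambda>v. ?u x powr (p + 1) *\<^sub>R A x v + (((p + 1) * ?u x powr (p + 1 - 1)) *\<^sub>R ?U x \<bullet> v) *\<^sub>R Xs x)))
      = ?n * cv_int K (\<lambda>x. h x * trA x + (p + 1) * (Xs x \<bullet> Xs x - (h x)\<^sup>2))"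
    unfolding cv_eq sph_int_cmul[symmetric]
  proof (rule sph_int_cong)
    fix x :: "real^'n" assume x: "norm x = 1"
    have sx: "sgn x = x" using x by (simp add: sgn_div_norm)
    have ux: "?u x = h x" and p: "p + 1 - 1 = p" using x by simp_all
    have m: "matrix (\<lambda>v. a *\<^sub>R A x v + (b \<bullet> v) *\<^sub>R Xs x) = a *\<^sub>R matrix (A x) + matrix (\<lambda>v. (b \<bullet> v) *\<^sub>R Xs x)" for a b
      by (simp add: matrix_def vec_eq_iff)
    have t: "trace (matrix (\<lambda>v. (b \<bullet> v) *\<^sub>R Xs x)) = b \<bullet> Xs x" for b
      using trace_rank_one[of "mat 1 :: real^'n^'n" b "Xs x"] by simp
    have t2: "trace (a *\<^sub>R matrix (A x)) = a * trA x" for a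
      by (simp add: trace_def trA_def matrix_def sum_distrib_left)
    show "trace (matrix (\<lambda>v. ?u x powr (p + 1) *\<^sub>R A x v + (((p + 1) * ?u x powr (p + 1 - 1)) *\<^sub>R ?U x \<bullet> v) *\<^sub>R Xs x))
      = ?n * ((h x * trA x + (p + 1) * (Xs x \<bullet> Xs x - (h x)\<^sup>2)) * wt x)"
      unfolding m trace_add t t2 ux p pw[OF x] wt[OF x, symmetric]
      by (simp add: x sx inner_diff_left inner_Xs power2_eq_square algebra_simps)
  qed
  moreover have "sph_int (\<lambda>x. x \<bullet> (?u x powr (p + 1) *\<^sub>R Xs x)) = ?n * cv_int K (\<lambda>x. (h x)\<^sup>2)"
    unfolding cv_eq sph_int_cmul[symmetric]
    by (rule sph_int_cong) (simp add: pw inner_Xs power2_eq_square)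
  ultimately have "?n * cv_int K (\<lambda>x. h x * trA x + (p + 1) * (Xs x \<bullet> Xs x - (h x)\<^sup>2))
      = (?n - 1) * (?n * cv_int K (\<lambda>x. (h x)\<^sup>2))"
    using div by simp
  moreover have "cv_int K (\<lambda>x. h x * trA x + (p + 1) * (Xs x \<bullet> Xs x - (h x)\<^sup>2))
      = cv_int K (\<lambda>x. h x * trA x) + (p + 1) * (cv_int K (\<lambda>x. Xs x \<bullet> Xs x) - cv_int K (\<lambda>x. (h x)\<^sup>2))"
    by (subst cv_add, (intro continuous_intros c)+) (simp only: cv_cmul cv_diff[OF c(2,3)])
  ultimately show ?thesis by simp
qed

text \<open>Since \<open>h\<close> and \<open>1 / h\<close> have product 1, Cauchy-Schwarz gives V^2
  <= rho times the integral of h^2. The hypothesis is the reverse inequality, and the equality case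
  makes the two functions proportional.\<close>

lemma supp_const_of_cv_le:
  assumes le: "cv_int K (\<lambda>x. (h x)\<^sup>2) \<le> V\<^sup>2 / \<rho>" and x: "norm x = 1"
  shows "(h x)\<^sup>2 = V / \<rho>"
proof -
  let ?c = "V / \<rho>"
  have hn: "h x \<noteq> 0" if "norm x = 1" for x using h_pos_sphere[OF that] by simp
  have c1: "continuous_on (sphere 0 1) (\<lambda>x. (h x)\<^sup>2)" by (intro continuous_intros continuous_on_h)
  have c2: "continuous_on (sphere 0 1) (\<lambda>x. h x - ?c / h x)"
    by (intro continuous_intros continuous_on_h h_nonzero_sphere)
  have "cv_int K (\<lambda>x. (h x - ?c / h x)\<^sup>2) = cv_int K (\<lambda>x. ((h x)\<^sup>2 - 2 * ?c * 1) + ?c\<^sup>2 * (1 / (h x)\<^sup>2))"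
  proof (rule cv_cong)
    fix x :: "real^'n" assume x: "norm x = 1"
    have "(h x - c / h x)\<^sup>2 = ((h x)\<^sup>2 - 2 * c * 1) + c\<^sup>2 * (1 / (h x)\<^sup>2)" for c
      by (simp add: power2_diff power_divide hn[OF x])
    then show "(h x - ?c / h x)\<^sup>2 = ((h x)\<^sup>2 - 2 * ?c * 1) + ?c\<^sup>2 * (1 / (h x)\<^sup>2)" .
  qed
  also have "\<dots> = (cv_int K (\<lambda>x. (h x)\<^sup>2) - 2 * ?c * V) + ?c\<^sup>2 * \<rho>"
    by (subst cv_add, (intro continuous_intros c1 continuous_on_inv_h2)+,
        subst cv_diff, (intro continuous_intros c1)+) (simp only: cv_cmul)
  also have "\<dots> = cv_int K (\<lambda>x. (h x)\<^sup>2) - V\<^sup>2 / \<rho>"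
  proof -
    have e: "2 * ?c * V = 2 * (V\<^sup>2 / \<rho>)" "?c\<^sup>2 * \<rho> = V\<^sup>2 / \<rho>"
      using \<rho>_pos by (simp_all add: power2_eq_square)
    show ?thesis unfolding e by simp
  qed
  finally have "cv_int K (\<lambda>x. (h x - ?c / h x)\<^sup>2) \<le> 0" using le by simp
  then have "(h x - ?c / h x)\<^sup>2 = 0"
    by (intro cv_eq_0[OF continuous_on_power[OF c2]] x) auto
  then have "h x = ?c / h x" by simp
  then show ?thesis using hn[OF x] by (metis nonzero_eq_divide_eq power2_eq_square)
qed

end

text \<open>The completed matrix is \<open>r\<close> on the tangent space and 1 on the normal, which
  is \<open>r\<close> times a rank-one perturbation of the identity; multiplication by
  \<open>r\<close> supplies the missing n-th factor.\<close>

lemma tdet_const: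
  assumes "\<And>x :: real^'n. norm x = 1 \<Longrightarrow> f x = r" and x: "norm x = 1" and r: "r \<noteq> 0"
  shows "r * tdet f x = r ^ CARD('n)"
proof -
  from Dmat_hom1[OF C2_hom1_cmul[OF C2_hom1_norm, of r] x, of f] assms(1) x
  have "Dmat f x = matrix (\<lambda>v. r *\<^sub>R (v - (x \<bullet> v) *\<^sub>R x))"
    by (simp add: sgn_div_norm)
  then have "Dmat1 f x = matrix (\<lambda>v. r *\<^sub>R (v + (x \<bullet> v) *\<^sub>R ((1 / r - 1) *\<^sub>R x)))"
    using r by (simp add: Dmat1_def matrix_def vec_eq_iff inner_axis algebra_simps)
  moreover have "linear (\<lambda>v. v + (x \<bullet> v) *\<^sub>R ((1 / r - 1) *\<^sub>R x))"
    by (rule linearI) (simp_all only: inner_add_right inner_scaleR_right scaleR_left_distrib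
        scaleR_right_distrib real_scaleR_def scaleR_scaleR distrib_right mult.assoc add_ac)
  ultimately have "tdet f x = r ^ CARD('n) * (1 + x \<bullet> ((1 / r - 1) *\<^sub>R x))"
    unfolding tdet_def by (simp only: det_matrix_scale det_one_plus_rank_one)
  then show ?thesis using x r by (simp add: norm_eq_1)
qed

theorem theorem1p1:
  fixes K :: "(real^'n) set" and p :: real
  assumes "CARD('n) \<ge> 3"
    and "- 2 * real CARD('n) - 1 \<le> p" and "p < - real CARD('n)"
    and "Kplus2 K"
    and "centroid K = 0"
    and "S2_isotropic K"
    and "\<forall>x\<in>sphere 0 1. supp K x powr (1 - p) * tdet (supp K) x = 1"
    and "lambda2 K \<ge> (- p - 1) / (real CARD('n) - 1)"
  shows "K = cball 0 1"
proof -
  let ?n = "real CARD('n)"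
  have pde: "supp K x powr (1 - p) * tdet (supp K) x = 1" if "norm x = 1" for x using assms(7) that by simp
  \<comment> \<open>Positivity of det(D^2 h) is read off from the equation: a nonnegative power
    times it equals 1.\<close>
  have tpos: "0 < tdet (supp K) x" if "norm x = 1" for x
    using pde[OF that] powr_ge_zero[of "supp K x" "1 - p"] by (metis zero_less_mult_pos zero_less_one order_le_less mult_zero_left)
  interpret hbm_body K
    using assms(1) by unfold_locales (auto intro: assms(4) tpos)
  let ?H = "cv_int K (\<lambda>x. (h x)\<^sup>2)" and ?Q = "cv_int K (\<lambda>x. Xs x \<bullet> Xs x)" and ?T = "cv_int K (\<lambda>x. h x * trA x)"
  define q where "q = (- p - 1) / (?n - 1)"
  have n1: "0 < ?n - 1" using n_gt_1 by simp
  have q1: "1 < q" unfolding q_def using assms(3) n1 by (simp add: pos_less_divide_eq)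
  have p1: "p + 1 = - (q * (?n - 1))" unfolding q_def using n1 by simp
  have "q * (?Q - V\<^sup>2 / \<rho>) \<le> ?T / (?n - 1) - V\<^sup>2 / \<rho>"
    by (rule summed_inequality[OF assms(6)])
      (use assms(8) q1 cv_support_pt_0[OF assms(5)] in \<open>simp_all add: q_def\<close>)
  moreover have "?T / (?n - 1) = ?H + q * (?Q - ?H)"
  proof -
    have "?T = (?H + q * (?Q - ?H)) * (?n - 1)"
      using trace_identity[OF pde] unfolding p1 by (simp add: algebra_simps)
    then show ?thesis using n1 by simp
  qed
  \<comment> \<open>The integral of |X|^2 occurs with the factor \<open>q\<close> on both sides and
    cancels; what remains is decided by the sign of \<open>q - 1\<close>.\<close>
  moreover have "(q - 1) * (H - e) \<le> 0" if "q * (Q - e) \<le> t - e" "t = H + q * (Q - H)" for H e Q t :: real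
    using that by (simp add: algebra_simps)
  ultimately have "(q - 1) * (?H - V\<^sup>2 / \<rho>) \<le> 0" by blast
  then have le: "?H \<le> V\<^sup>2 / \<rho>" using q1 by (simp add: mult_le_0_iff)
  define r where "r = sqrt (V / \<rho>)"
  have hr: "h x = r" if "norm x = 1" for x
    unfolding r_def supp_const_of_cv_le[OF le that, symmetric] using h_pos_sphere[OF that] by simp
  obtain x :: "real^'n" where x: "norm x = 1" using vector_choose_size[of 1] by auto
  have r0: "0 < r" using hr[OF x] h_pos_sphere[OF x] by simp
  have "r powr (1 - p) * (r * tdet h x) = r" using pde[OF x] hr[OF x] by simp
  then have "r powr (1 - p) * r powr ?n = r powr 1"
    using tdet_const[OF hr x] r0 by (simp add: powr_realpow)
  then have "r powr (1 - p + ?n) = r powr 1" by (simp only: powr_add)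
  \<comment> \<open>For a positive base other than 1 the exponents would agree, which would make
    \<open>p\<close> equal to the dimension, whereas \<open>p\<close> is negative.\<close>
  then have "r = 1" using r0 assms(3) powr_inj[of r "1 - p + ?n" 1] by auto
  then have h1: "h x = 1" if "norm x = 1" for x using hr[OF that] by simp
  note b = Kplus2_basic[OF assms(4)]
  have "y \<in> K \<longleftrightarrow> norm y \<le> 1" for y
  proof -
    have "y \<in> K \<longleftrightarrow> (\<forall>x. norm x = 1 \<longrightarrow> x \<bullet> y \<le> 1)"
      unfolding mem_convex_body_iff[OF b(1,2,3)] using h1 by auto
    also have "\<dots> \<longleftrightarrow> norm y \<le> 1"
    proof
      assume l: "\<forall>x. norm x = 1 \<longrightarrow> x \<bullet> y \<le> 1"
      show "norm y \<le> 1"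
      proof (cases "y = 0")
        case False
        then have "sgn y \<bullet> y \<le> 1" using l by (simp add: norm_sgn)
        moreover have "sgn y \<bullet> y = norm y"
          using False by (simp add: sgn_div_norm power2_norm_eq_inner[symmetric] power2_eq_square)
        ultimately show ?thesis by simp
      qed simp
    next
      assume "norm y \<le> 1"
      then show "\<forall>x. norm x = 1 \<longrightarrow> x \<bullet> y \<le> 1"
        using norm_cauchy_schwarz[of _ y] by (metis mult_1 order_trans)
    qed
    finally show ?thesis .
  qed
  then show ?thesis by auto
qed

end
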